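(* Let $h_0,\lambda_0,\lambda_1,K,\lambda>0$, $h_1\ge0$, and let $\widetilde\lambda_0,\widetilde\lambda_1\in\mathbb R$ satisfy $|\widetilde\lambda_0+\widetilde\lambda_1|<2\sqrt{\lambda_0\lambda_1}$. Consider, with given functions $f,g_0,g_1,\widetilde u_0,\widetilde u_1$ and real constants $\widetilde h_0,\widetilde h_1$, the problem $$u_{tt}-u_{xx}+Ku+\lambda u_t=f(x,t)\quad\text{in }(0,1)\times(0,\infty),$$ $$u_x(0,t)=h_0u(0,t)+\lambda_0u_t(0,t)+\widetilde h_1u(1,t)+\widetilde\lambda_1u_t(1,t)+g_0(t),$$ $$-u_x(1,t)=h_1u(1,t)+\lambda_1u_t(1,t)+\widetilde h_0u(0,t)+\widetilde\lambda_0u_t(0,t)+g_1(t),$$ $$u(x,0)=\widetilde u_0(x),\qquad u_t(x,0)=\widetilde u_1(x).$$ Assume that $\widetilde h_0$ and $\widetilde h_1$ are chosen small enough (that is, $|\widetilde h_0|,|\widetilde h_1|<\eta$ for a suitable $\eta>0$ determined by the constants $h_0,h_1,\lambda_0,\lambda_1,\widetilde\lambda_0,\widetilde\lambda_1,K,\lambda$), and that $$\|f(t)\|^2+g_0^2(t)+g_1^2(t)\le\sigma_1\exp(-\sigma_2t)\qquad\text{for all }t\ge0,$$ where $\sigma_1,\sigma_2$ are two positive constants. Then there exist positive constants $\gamma_1,\gamma_2$ such that $$E(t)\le\gamma_1\exp(-\gamma_2t)\qquad\text{for all }t\ge0,$$ for any strong solution $u$ of the problem, where $$E(t)=\tfrac12\|u'(t)\|^2+\tfrac12\|u(t)\|_a^2+\tfrac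 K2\|u(t)\|^2.$$
   Context: Let $\Omega=(0,1)$, $\langle u,v\rangle=\int_0^1u(x)v(x)\,dx$, $\|v\|=\sqrt{\langle v,v\rangle}$, $u(t)=u(\cdot,t)$, $u'=u_t$, and $$\|v\|_a^2=\|v_x\|^2+h_0v(0)^2+h_1v(1)^2,\qquad v\in H^1(\Omega).$$ The given functions satisfy, for every $T>0$, $g_0,g_1\in H^1(0,T)$, $f,f_t\in L^2(\Omega\times(0,T))$, and $(\widetilde u_0,\widetilde u_1)\in H^2(\Omega)\times H^1(\Omega)$. A strong solution is a function $u$ on $\Omega\times(0,\infty)$ satisfying the equation a.e., the boundary and initial conditions, and, for every $T>0$, $u\in C^0([0,T];H^1(\Omega))\cap C^1([0,T];L^2(\Omega))\cap L^\infty(0,T;H^2(\Omega))$, $u_t\in L^\infty(0,T;H^1(\Omega))$, $u_{tt}\in L^\infty(0,T;L^2(\Omega))$, $u(0,\cdot),u(1,\cdot)\in H^2(0,T)$. *)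

theory Defs
  imports "HOL-Analysis.Analysis"
begin

text \<open>
  Elements of \<open>L\<^sup>2\<close> and of Sobolev spaces are represented by Borel representatives of their
  almost-everywhere classes; all notions below depend only on the class.  A function \<open>u(x,t)\<close> of
  space and time is written \<open>u t x\<close>, so that \<open>u t\<close> is \<open>u(t) = u(\<cdot>,t)\<close>.
\<close>

subsection \<open>Sobolev spaces on an interval\<close>

definition L2 :: "real \<Rightarrow> real \<Rightarrow> (real \<Rightarrow> real) set" where
  "L2 a b = {v. set_borel_measurable lborel {a<..<b} v \<and>
                set_integrable lborel {a<..<b} (\<lambda>x. (v x)\<^sup>2)}"

definition L2_norm :: "real \<Rightarrow> real \<Rightarrow> (real \<Rightarrow> real) \<Rightarrow> real" where
  "L2_norm a b v = sqrt (LINT x:{a<..<b}|lborel. (v x)\<^sup>2)"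

definition test_fun :: "real \<Rightarrow> real \<Rightarrow> (real \<Rightarrow> real) set" where
  "test_fun a b = {\<phi>. (\<forall>n x. (deriv ^^ n) \<phi> differentiable (at x)) \<and>
                      (\<exists>c d. a < c \<and> d < b \<and> (\<forall>x. x \<notin> {c..d} \<longrightarrow> \<phi> x = 0))}"

definition weak_deriv :: "real \<Rightarrow> real \<Rightarrow> (real \<Rightarrow> real) \<Rightarrow> (real \<Rightarrow> real) \<Rightarrow> bool" where
  "weak_deriv a b v w \<longleftrightarrow> v \<in> L2 a b \<and> w \<in> L2 a b \<and>
     (\<forall>\<phi>\<in>test_fun a b. (LINT x:{a<..<b}|lborel. v x * deriv \<phi> x)
                        = - (LINT x:{a<..<b}|lborel. w x * \<phi> x))"

definition H1 :: "real \<Rightarrow> real \<Rightarrow> (real \<Rightarrow> real) set" where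
  "H1 a b = {v. \<exists>w. weak_deriv a b v w}"

definition H2 :: "real \<Rightarrow> real \<Rightarrow> (real \<Rightarrow> real) set" where
  "H2 a b = {v. \<exists>w\<in>H1 a b. weak_deriv a b v w}"

text \<open>The derivative \<open>v\<^sub>x\<close> of \<open>v \<in> H1 a b\<close>; it is unique up to null sets.\<close>

definition wderiv :: "real \<Rightarrow> real \<Rightarrow> (real \<Rightarrow> real) \<Rightarrow> real \<Rightarrow> real" where
  "wderiv a b v = (SOME w. weak_deriv a b v w)"

definition H1_norm :: "real \<Rightarrow> real \<Rightarrow> (real \<Rightarrow> real) \<Rightarrow> real" where
  "H1_norm a b v = sqrt ((L2_norm a b v)\<^sup>2 + (L2_norm a b (wderiv a b v))\<^sup>2)"

text \<open>The point value \<open>v(p)\<close>, \<open>p \<in> [0,1]\<close>, of \<open>v \<in> H1 0 1\<close>: the value at \<open>p\<close> of the representative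
  of \<open>v\<close> that is continuous on \<open>[0,1]\<close>.\<close>

definition trace :: "(real \<Rightarrow> real) \<Rightarrow> real \<Rightarrow> real" where
  "trace v p = (THE c. \<exists>w. continuous_on {0..1} w \<and>
                          (AE x\<in>{0<..<1} in lborel. v x = w x) \<and> w p = c)"

definition norm_a :: "real \<Rightarrow> real \<Rightarrow> (real \<Rightarrow> real) \<Rightarrow> real" where
  "norm_a h0 h1 v =
     sqrt ((L2_norm 0 1 (wderiv 0 1 v))\<^sup>2 + h0 * (trace v 0)\<^sup>2 + h1 * (trace v 1)\<^sup>2)"

subsection \<open>Spaces of functions of time with values in spaces over \<open>(0,1)\<close>\<close>

definition C0_L2 :: "real \<Rightarrow> (real \<Rightarrow> real \<Rightarrow> real) set" where
  "C0_L2 T = {u. \<forall>t\<in>{0..T}. u t \<in> L2 0 1 \<and>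
                ((\<lambda>s. L2_norm 0 1 (\<lambda>x. u s x - u t x)) \<longlongrightarrow> 0) (at t within {0..T})}"

definition C0_H1 :: "real \<Rightarrow> (real \<Rightarrow> real \<Rightarrow> real) set" where
  "C0_H1 T = {u. \<forall>t\<in>{0..T}. u t \<in> H1 0 1 \<and>
                ((\<lambda>s. H1_norm 0 1 (\<lambda>x. u s x - u t x)) \<longlongrightarrow> 0) (at t within {0..T})}"

text \<open>\<open>L2_diff S u t w\<close>: the map \<open>u\<close>, restricted to times in \<open>S\<close>, is differentiable at \<open>t\<close> in the
  norm of \<open>L\<^sup>2(0,1)\<close>, with derivative \<open>w\<close>.\<close>

definition L2_diff :: "real set \<Rightarrow> (real \<Rightarrow> real \<Rightarrow> real) \<Rightarrow> real \<Rightarrow> (real \<Rightarrow> real) \<Rightarrow> bool" where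
  "L2_diff S u t w \<longleftrightarrow> w \<in> L2 0 1 \<and>
     ((\<lambda>s. L2_norm 0 1 (\<lambda>x. (u s x - u t x) / (s - t) - w x)) \<longlongrightarrow> 0) (at t within S)"

text \<open>\<open>u \<in> C\<^sup>1([0,T]; L\<^sup>2(0,1))\<close> with derivative \<open>u' = v\<close>.\<close>

definition C1_L2_deriv :: "real \<Rightarrow> (real \<Rightarrow> real \<Rightarrow> real) \<Rightarrow> (real \<Rightarrow> real \<Rightarrow> real) \<Rightarrow> bool" where
  "C1_L2_deriv T u v \<longleftrightarrow> u \<in> C0_L2 T \<and> v \<in> C0_L2 T \<and> (\<forall>t\<in>{0..T}. L2_diff {0..T} u t (v t))"

text \<open>The derivative \<open>u'(t)\<close>, \<open>t \<ge> 0\<close>, in \<open>L\<^sup>2(0,1)\<close>; it is unique up to null sets.\<close>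

definition tderiv :: "(real \<Rightarrow> real \<Rightarrow> real) \<Rightarrow> real \<Rightarrow> real \<Rightarrow> real" where
  "tderiv u t = (SOME w. L2_diff {0..} u t w)"

definition meas_QT :: "real \<Rightarrow> (real \<Rightarrow> real \<Rightarrow> real) \<Rightarrow> bool" where
  "meas_QT T u \<longleftrightarrow> set_borel_measurable lborel ({0<..<T} \<times> {0<..<1}) (\<lambda>(t, x). u t x)"

definition L2_QT :: "real \<Rightarrow> (real \<Rightarrow> real \<Rightarrow> real) set" where
  "L2_QT T = {u. meas_QT T u \<and>
                 set_integrable lborel ({0<..<T} \<times> {0<..<1}) (\<lambda>(t, x). (u t x)\<^sup>2)}"

text \<open>\<open>L\<^sup>\<infinity>(0,T; X)\<close> for \<open>X = L\<^sup>2, H\<^sup>1, H\<^sup>2\<close> over \<open>(0,1)\<close>. Since these spaces are separable, strong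
  measurability of \<open>u\<close> into \<open>X\<close> amounts to joint measurability of \<open>u\<close> and of its \<open>x\<close>-derivatives.\<close>

definition Linf_L2 :: "real \<Rightarrow> (real \<Rightarrow> real \<Rightarrow> real) set" where
  "Linf_L2 T = {u. meas_QT T u \<and>
     (\<exists>M. AE t\<in>{0<..<T} in lborel. u t \<in> L2 0 1 \<and> L2_norm 0 1 (u t) \<le> M)}"

definition Linf_H1 :: "real \<Rightarrow> (real \<Rightarrow> real \<Rightarrow> real) set" where
  "Linf_H1 T = {u \<in> Linf_L2 T.
     \<exists>ux\<in>Linf_L2 T. AE t\<in>{0<..<T} in lborel. weak_deriv 0 1 (u t) (ux t)}"

definition Linf_H2 :: "real \<Rightarrow> (real \<Rightarrow> real \<Rightarrow> real) set" where
  "Linf_H2 T = {u \<in> Linf_L2 T.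
     \<exists>ux\<in>Linf_H1 T. AE t\<in>{0<..<T} in lborel. weak_deriv 0 1 (u t) (ux t)}"

text \<open>\<open>w\<close> is the distributional time derivative of \<open>v\<close> on \<open>(0,T)\<close>, both being functions of time
  with values in \<open>L\<^sup>2(0,1)\<close>: the identity of \<open>L\<^sup>2(0,1)\<close>-valued integrals is an identity for almost
  every \<open>x\<close>.\<close>

definition weak_tderiv :: "real \<Rightarrow> (real \<Rightarrow> real \<Rightarrow> real) \<Rightarrow> (real \<Rightarrow> real \<Rightarrow> real) \<Rightarrow> bool" where
  "weak_tderiv T v w \<longleftrightarrow> v \<in> L2_QT T \<and> w \<in> L2_QT T \<and>
     (\<forall>\<psi>\<in>test_fun 0 T. AE x\<in>{0<..<1} in lborel.
        (LINT t:{0<..<T}|lborel. v t x * deriv \<psi> t) = - (LINT t:{0<..<T}|lborel. w t x * \<psi> t))"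

subsection \<open>The problem\<close>

definition admissible_data ::
    "(real \<Rightarrow> real \<Rightarrow> real) \<Rightarrow> (real \<Rightarrow> real) \<Rightarrow> (real \<Rightarrow> real) \<Rightarrow>
     (real \<Rightarrow> real) \<Rightarrow> (real \<Rightarrow> real) \<Rightarrow> bool" where
  "admissible_data f g0 g1 u0 u1 \<longleftrightarrow>
     (\<forall>T>0. g0 \<in> H1 0 T \<and> g1 \<in> H1 0 T \<and> f \<in> L2_QT T \<and> (\<exists>ft\<in>L2_QT T. weak_tderiv T f ft)) \<and>
     u0 \<in> H2 0 1 \<and> u1 \<in> H1 0 1"

text \<open>\<open>lam\<close> stands for \<open>\<lambda>\<close>, and \<open>ht\<close>, \<open>lamt\<close> for \<open>h\<close>, \<open>\<lambda>\<close> with a tilde.  The traces of \<open>u\<^sub>x(t)\<close> and \<open>u\<^sub>t(t)\<close>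
  at \<open>0\<close> and \<open>1\<close> exist for almost every \<open>t\<close>, those \<open>t\<close> for which both functions lie in \<open>H1 0 1\<close>.
  The witnesses \<open>ut, utt, ux, uxx\<close> are determined by \<open>u\<close> up to null sets.\<close>

definition strong_solution ::
    "real \<Rightarrow> real \<Rightarrow> real \<Rightarrow> real \<Rightarrow> real \<Rightarrow> real \<Rightarrow> real \<Rightarrow> real \<Rightarrow> real \<Rightarrow> real \<Rightarrow>
     (real \<Rightarrow> real \<Rightarrow> real) \<Rightarrow> (real \<Rightarrow> real) \<Rightarrow> (real \<Rightarrow> real) \<Rightarrow>
     (real \<Rightarrow> real) \<Rightarrow> (real \<Rightarrow> real) \<Rightarrow> (real \<Rightarrow> real \<Rightarrow> real) \<Rightarrow> bool" where
  "strong_solution h0 h1 lam0 lam1 ht0 ht1 lamt0 lamt1 K lam f g0 g1 u0 u1 u \<longleftrightarrow>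
     (\<exists>ut utt ux uxx.
        (\<forall>T>0. u \<in> C0_H1 T \<and> C1_L2_deriv T u ut \<and> u \<in> Linf_H2 T \<and>
               ut \<in> Linf_H1 T \<and>
               utt \<in> Linf_L2 T \<and> weak_tderiv T ut utt \<and>
               (\<lambda>t. trace (u t) 0) \<in> H2 0 T \<and> (\<lambda>t. trace (u t) 1) \<in> H2 0 T \<and>
               meas_QT T ux \<and> meas_QT T uxx) \<and>
        (AE t\<in>{0<..} in lborel. weak_deriv 0 1 (u t) (ux t) \<and> weak_deriv 0 1 (ux t) (uxx t)) \<and>
        (AE (t, x) in lborel. 0 < t \<and> x \<in> {0<..<1} \<longrightarrow>
           utt t x - uxx t x + K * u t x + lam * ut t x = f t x) \<and>
        (AE t\<in>{0<..} in lborel.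
           trace (ux t) 0 = h0 * trace (u t) 0 + lam0 * trace (ut t) 0
                            + ht1 * trace (u t) 1 + lamt1 * trace (ut t) 1 + g0 t) \<and>
        (AE t\<in>{0<..} in lborel.
           - trace (ux t) 1 = h1 * trace (u t) 1 + lam1 * trace (ut t) 1
                              + ht0 * trace (u t) 0 + lamt0 * trace (ut t) 0 + g1 t) \<and>
        (AE x\<in>{0<..<1} in lborel. u 0 x = u0 x) \<and>
        (AE x\<in>{0<..<1} in lborel. ut 0 x = u1 x))"

definition energy :: "real \<Rightarrow> real \<Rightarrow> real \<Rightarrow> (real \<Rightarrow> real \<Rightarrow> real) \<Rightarrow> real \<Rightarrow> real" where
  "energy h0 h1 K u t =
     1/2 * (L2_norm 0 1 (tderiv u t))\<^sup>2 + 1/2 * (norm_a h0 h1 (u t))\<^sup>2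
     + K/2 * (L2_norm 0 1 (u t))\<^sup>2"

end

theory Submission
  imports Defs
begin

text \<open>
  The energy is perturbed to \<open>E + \<delta> \<Psi>\<close> with
  \<open>\<Psi> = \<langle>u, u'\<rangle> + \<lambda>/2 \<parallel>u\<parallel>\<^sup>2 + \<lambda>\<^sub>0/2 u(0)\<^sup>2 + \<lambda>\<^sub>1/2 u(1)\<^sup>2\<close>.  The condition on the \<open>\<lambda>\<close>'s makes the
  boundary form \<open>\<lambda>\<^sub>0 r\<^sup>2 + \<lambda>\<^sub>1 s\<^sup>2 + \<mu> r s\<close> coercive in \<open>(r, s) = (u'(0), u'(1))\<close>,
  where \<open>\<mu>\<close> is the sum of the two coupling coefficients, so that \<open>E'\<close> controls
  \<open>-\<parallel>u'\<parallel>\<^sup>2\<close> and the boundary velocities, while \<open>\<Psi>'\<close> supplies \<open>-\<parallel>u\<parallel>\<^sub>a\<^sup>2 - K \<parallel>u\<parallel>\<^sup>2\<close>.  For small \<open>\<delta>\<close> and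
  then small \<open>\<eta>\<close> this gives \<open>(E + \<delta> \<Psi>)' \<le> - \<beta> (E + \<delta> \<Psi>) + C \<sigma>\<^sub>1 exp (- \<sigma>\<^sub>2 t)\<close>.

  All derivatives in time are handled in integrated form.  A strong solution satisfies
  \<open>u(t) = u(0) + \<integral>\<^sub>0\<^sup>t u'\<close> for almost every \<open>x\<close>, and likewise for \<open>u'\<close> and \<open>u\<^sub>x\<close>; integration by parts in \<open>t\<close>
  for fixed \<open>x\<close> and Fubini's theorem then show that the inner products entering \<open>E\<close> and \<open>\<Psi>\<close> are
  absolutely continuous.  The traces are inner products too, since
  \<open>v(0) = \<integral> v - \<integral> (1 - x) v\<^sub>x\<close> and \<open>v(1) = \<integral> v + \<integral> x v\<^sub>x\<close>.
\<close>

subsection \<open>Test functions\<close>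

text \<open>In \<open>E'\<close> the products \<open>ht1 * u(1) * u'(0)\<close> and
  \<open>ht0 * u(0) * u'(1)\<close> have no sign and contain \<open>u\<close> itself, which the
  dissipation in \<open>E'\<close> does not control; only the corrector supplies a negative multiple
  of its norm. This fixes the order of choice: \<delta> small enough for \<open>E'\<close> to absorb
  the positive terms of the corrector, then \<eta> small relative to \<delta>, both from the
  coefficients alone.

  \<open>u_tt\<close> and the x-derivative of \<open>u_t\<close> are only bounded in time with
  values in \<open>L2\<close>, and the traces of \<open>u_x\<close> and \<open>u_t\<close> exist
  only for almost every time. So \<open>E\<close> is not known to be differentiable at any given
  time, and every time derivative becomes the integrable density of an absolutely continuous
  function.

  The decay constants are quantified before \<open>u\<close>. They may be, because
  \<open>E(0)\<close> depends on \<open>u\<close> only through the classes of its initial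
  data.\<close>

coinductive smooth :: "(real \<Rightarrow> real) \<Rightarrow> bool" where
  smooth_antideriv: "(\<And>x. (f has_real_derivative f' x) (at x)) \<Longrightarrow> smooth f' \<Longrightarrow> smooth f"

text \<open>The purpose of the coinductive encoding: infinite differentiability follows from a set
  of functions closed under differentiation, and no formula for the n-th derivative is required.
  Closure properties and the functions built from exp(-1/x) are both handled in this way.\<close>

lemma smooth_coinduct:
  assumes "f \<in> S" "\<And>g. g \<in> S \<Longrightarrow> \<exists>g'\<in>S. \<forall>x. (g has_real_derivative g' x) (at x)"
  shows "smooth f"
  using assms(1)
proof (coinduction arbitrary: f rule: smooth.coinduct)
  case smooth
  then obtain g' where "g' \<in> S" "\<forall>x. (f has_real_derivative g' x) (at x)"
    using assms(2)[of f] by auto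
  then show ?case by (intro exI[of _ f] exI[of _ g']) simp
qed

lemma smooth_derivE:
  assumes "smooth f"
  obtains f' where "smooth f'" "\<And>x. (f has_real_derivative f' x) (at x)"
  using assms by (cases rule: smooth.cases) auto

lemma smooth_imp_differentiable_deriv:
  assumes "smooth f"
  shows "(deriv ^^ n) f differentiable (at x)"
proof -
  have "smooth ((deriv ^^ n) f)"
  proof (induction n)
    case (Suc n)
    then obtain f' where f': "smooth f'" "\<And>x. ((deriv ^^ n) f has_real_derivative f' x) (at x)"
      by (erule smooth_derivE)
    then have "deriv ((deriv ^^ n) f) = f'"
      by (intro ext DERIV_imp_deriv)
    with f' show ?case by simp
  qed (use assms in simp)
  then show ?thesis
    by (cases rule: smooth.cases) (auto simp: real_differentiable_def)
qed

lemma differentiable_deriv_imp_smooth: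
  assumes "\<And>n x. (deriv ^^ n) f differentiable (at x)"
  shows "smooth f"
proof (rule smooth_coinduct[where S = "range (\<lambda>n. (deriv ^^ n) f)"])
  show "f \<in> range (\<lambda>n. (deriv ^^ n) f)"
    by (rule range_eqI[of _ _ 0]) simp
  fix g assume "g \<in> range (\<lambda>n. (deriv ^^ n) f)"
  then obtain n where g: "g = (deriv ^^ n) f" by auto
  have "(g has_real_derivative ((deriv ^^ Suc n) f) x) (at x)" for x
    using assms[of n x] unfolding g by (auto simp: real_differentiable_def DERIV_deriv_iff_real_differentiable)
  then show "\<exists>g'\<in>range (\<lambda>n. (deriv ^^ n) f). \<forall>x. (g has_real_derivative g' x) (at x)"
    by blast
qed

lemma test_fun_iff:
  "\<phi> \<in> test_fun a b \<longleftrightarrow> smooth \<phi> \<and> (\<exists>c d. a < c \<and> d < b \<and> (\<forall>x. x \<notin> {c..d} \<longrightarrow> \<phi> x = 0))"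
proof -
  have "(\<forall>n x. (deriv ^^ n) \<phi> differentiable (at x)) \<longleftrightarrow> smooth \<phi>"
    using smooth_imp_differentiable_deriv[of \<phi>] differentiable_deriv_imp_smooth[of \<phi>] by (rule_tac iffI) simp_all
  then show ?thesis by (simp add: test_fun_def)
qed

lemma smooth_continuous: "smooth f \<Longrightarrow> continuous_on A f"
proof -
  assume "smooth f"
  then obtain f' where "smooth f'" "\<And>x. (f has_real_derivative f' x) (at x)"
    by (erule smooth_derivE)
  then show ?thesis
    by (intro DERIV_continuous_on) (rule has_field_derivative_at_within)
qed

lemma smooth_const: "smooth (\<lambda>x. c)"
  by (rule smooth_coinduct[where S = "range (\<lambda>c x. c)"]) (auto intro!: derivative_eq_intros bexI)

text \<open>Coinduction up to algebraic operations: the derivative of a product is a sum of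
  products, so products alone are not invariant under differentiation, whereas the closure under all
  the operations together is.\<close>

inductive_set smooth_closure :: "(real \<Rightarrow> real) set" where
  base: "smooth f \<Longrightarrow> f \<in> smooth_closure"
| add: "f \<in> smooth_closure \<Longrightarrow> g \<in> smooth_closure \<Longrightarrow> (\<lambda>x. f x + g x) \<in> smooth_closure"
| mult: "f \<in> smooth_closure \<Longrightarrow> g \<in> smooth_closure \<Longrightarrow> (\<lambda>x. f x * g x) \<in> smooth_closure"
| comp: "f \<in> smooth_closure \<Longrightarrow> (\<lambda>x. f (c * x + d)) \<in> smooth_closure"

lemma smooth_closure_smooth:
  assumes "f \<in> smooth_closure"
  shows "smooth f"
proof (rule smooth_coinduct[OF assms])
  fix g assume "g \<in> smooth_closure"
  then show "\<exists>g'\<in>smooth_closure. \<forall>x. (g has_real_derivative g' x) (at x)"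
  proof induction
    case (base f)
    then show ?case by (metis smooth_closure.base smooth_derivE)
  next
    case (add f g)
    then obtain f' g' where "f' \<in> smooth_closure" "g' \<in> smooth_closure"
      "\<And>x. (f has_real_derivative f' x) (at x)" "\<And>x. (g has_real_derivative g' x) (at x)" by blast
    then show ?case
      by (intro bexI[of _ "\<lambda>x. f' x + g' x"]) (auto intro!: smooth_closure.add derivative_eq_intros)
  next
    case (mult f g)
    then obtain f' g' where "f' \<in> smooth_closure" "g' \<in> smooth_closure"
      "\<And>x. (f has_real_derivative f' x) (at x)" "\<And>x. (g has_real_derivative g' x) (at x)" by blast
    then show ?case using mult.hyps
      by (intro bexI[of _ "\<lambda>x. f' x * g x + f x * g' x"])
        (auto intro!: smooth_closure.add smooth_closure.mult derivative_eq_intros)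
  next
    case (comp f c d)
    then obtain f' where f': "f' \<in> smooth_closure" "\<And>x. (f has_real_derivative f' x) (at x)" by blast
    have "((\<lambda>x. f (c * x + d)) has_real_derivative f' (c * x + d) * c) (at x)" for x
      by (rule DERIV_chain2[OF f'(2)]) (auto intro!: derivative_eq_intros)
    moreover have "(\<lambda>x. f' (c * x + d) * c) \<in> smooth_closure"
      using smooth_closure.mult[OF smooth_closure.comp[OF f'(1)] smooth_closure.base[OF smooth_const]] .
    ultimately show ?case by (intro bexI) auto
  qed
qed

lemma smooth_add: "smooth f \<Longrightarrow> smooth g \<Longrightarrow> smooth (\<lambda>x. f x + g x)"
  and smooth_mult: "smooth f \<Longrightarrow> smooth g \<Longrightarrow> smooth (\<lambda>x. f x * g x)"
  and smooth_affine: "smooth f \<Longrightarrow> smooth (\<lambda>x. f (c * x + d))"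
  by (rule smooth_closure_smooth, simp add: smooth_closure.base smooth_closure.add smooth_closure.mult smooth_closure.comp)+

lemma smooth_cmult: "smooth f \<Longrightarrow> smooth (\<lambda>x. c * f x)"
  by (intro smooth_mult smooth_const)

lemma smooth_power: "smooth f \<Longrightarrow> smooth (\<lambda>x. f x ^ n)"
  by (induction n) (auto intro: smooth_const smooth_mult)

text \<open>This family contains \<open>exp (- 1/x)\<close> and is closed under differentiation.\<close>

definition poly_exp :: "real poly \<Rightarrow> real \<Rightarrow> real" where
  "poly_exp p x = (if x \<le> 0 then 0 else poly p (1/x) * exp (- (1/x)))"

lemma poly_exp_tendsto_0: "((\<lambda>y. poly p y * exp (- y)) \<longlongrightarrow> (0::real)) at_top"
proof (induction p)
  case (pCons a p)
  have "((\<lambda>y. a * (y ^ 0 / exp y)) \<longlongrightarrow> a * 0) at_top"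
    by (intro tendsto_intros tendsto_power_div_exp_0)
  moreover have "((\<lambda>y. poly (pCons 0 p) y * exp (- y)) \<longlongrightarrow> 0) at_top"
    unfolding poly_altdef sum_distrib_right
  proof (rule tendsto_null_sum)
    fix k
    show "((\<lambda>y. coeff (pCons 0 p) k * y ^ k * exp (- y)) \<longlongrightarrow> 0) at_top"
      using tendsto_mult_right_zero[OF tendsto_power_div_exp_0, of "coeff (pCons 0 p) k" k]
      by (simp add: exp_minus divide_inverse mult.assoc)
  qed
  ultimately have "((\<lambda>y. a * (y ^ 0 / exp y) + poly (pCons 0 p) y * exp (- y)) \<longlongrightarrow> a * 0 + 0) at_top"
    by (rule tendsto_add)
  then show ?case
    by (simp add: exp_minus divide_inverse algebra_simps)
qed simp

lemma smooth_poly_exp: "smooth (poly_exp p)"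
proof (rule smooth_coinduct[where S = "range poly_exp"])
  fix g assume "g \<in> range poly_exp"
  then obtain p where g: "g = poly_exp p" by auto
  \<comment> \<open>With y = 1/x, differentiation in x is -y^2 times differentiation in y, so it
    sends p(y) exp(-y) to y^2 (p - p')(y) exp(-y).\<close>
  define q where "q = [:0, 0, 1:] * (p - pderiv p)"
  have "(poly_exp p has_real_derivative poly_exp q x) (at x)" for x
  proof -
    consider "x < 0" | "x > 0" | "x = 0" by linarith
    then show ?thesis
    proof cases
      case 1
      have "((\<lambda>x. 0) has_real_derivative 0) (at x)" by simp
      then have "(poly_exp p has_real_derivative 0) (at x)"
        by (rule has_field_derivative_transform_within_open[where S = "{..<0}"])
          (use 1 in \<open>auto simp: poly_exp_def\<close>)
      then show ?thesis using 1 by (simp add: poly_exp_def)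
    next
      case 2
      have "((\<lambda>x. poly p (1/x) * exp (- (1/x))) has_real_derivative
          poly (pderiv p) (1/x) * (- (1/x^2)) * exp (- (1/x)) + poly p (1/x) * (exp (- (1/x)) * (1/x^2))) (at x)"
        using 2 by (auto intro!: derivative_eq_intros DERIV_chain2[OF poly_DERIV] simp: power2_eq_square)
      also have "poly (pderiv p) (1/x) * (- (1/x^2)) * exp (- (1/x)) + poly p (1/x) * (exp (- (1/x)) * (1/x^2))
          = poly_exp q x"
        using 2 by (simp add: poly_exp_def q_def power2_eq_square field_simps)
      finally show ?thesis
        by (rule has_field_derivative_transform_within_open[where S = "{0<..}"])
          (use 2 in \<open>auto simp: poly_exp_def\<close>)
    next
      case 3
      \<comment> \<open>At 0 from the right the difference quotient is y p(y) exp(-y) with y = 1/h,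
        and y p(y) is the polynomial \<open>pCons 0 p\<close>.\<close>
      have "((\<lambda>h. poly (pCons 0 p) (inverse h) * exp (- inverse h)) \<longlongrightarrow> 0) (at_right 0)"
        using poly_exp_tendsto_0 filterlim_inverse_at_top_right by (rule filterlim_compose)
      then have R: "((\<lambda>h. poly_exp p h / h) \<longlongrightarrow> 0) (at_right 0)"
        by (rule Lim_transform_eventually)
          (auto simp: eventually_at_right_field poly_exp_def field_simps inverse_eq_divide intro!: exI[of _ 1])
      have L: "((\<lambda>h. poly_exp p h / h) \<longlongrightarrow> 0) (at_left 0)"
        by (rule tendsto_eventually) (auto simp: eventually_at_left_field poly_exp_def intro!: exI[of _ "-1"])
      show ?thesis
        using L R 3 by (simp add: DERIV_def filterlim_split_at poly_exp_def)
    qed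
  qed
  then show "\<exists>g'\<in>range poly_exp. \<forall>x. (g has_real_derivative g' x) (at x)"
    unfolding g by blast
qed simp

section \<open>Bump functions and approximation of indicators\<close>

definition bump :: "real \<Rightarrow> real \<Rightarrow> real \<Rightarrow> real" where
  "bump c d x = poly_exp 1 (x - c) * poly_exp 1 (d - x)"

lemma smooth_bump: "smooth (bump c d)"
proof -
  have "smooth (\<lambda>x. poly_exp 1 (1 * x + (-c)) * poly_exp 1 ((-1) * x + d))"
    by (intro smooth_mult smooth_affine smooth_poly_exp)
  then show ?thesis by (simp add: bump_def[abs_def] algebra_simps)
qed

lemma bump_bounds: "0 \<le> bump c d x" "bump c d x \<le> 1"
proof -
  have "0 \<le> poly_exp 1 y" "poly_exp 1 y \<le> 1" for y
    by (auto simp: poly_exp_def)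
  then show "0 \<le> bump c d x" "bump c d x \<le> 1"
    by (auto simp: bump_def intro: mult_le_one)
qed

lemma bump_pos: "c < x \<Longrightarrow> x < d \<Longrightarrow> 0 < bump c d x"
  and bump_eq_0: "x \<notin> {c<..<d} \<Longrightarrow> bump c d x = 0"
  by (auto simp: bump_def poly_exp_def)

text \<open>Powers of one bump replace mollification: \<open>(1 - bump c d x) ^ n\<close> tends to 0
  where the bump is positive and is constantly 1 elsewhere. The uniform bound is what dominated
  convergence asks for.\<close>

lemma test_fun_approx_indicator:
  assumes "a < c" "d < b"
  obtains \<phi> where "\<And>n. \<phi> n \<in> test_fun a b" "\<And>n x. \<bar>\<phi> n x\<bar> \<le> 1"
    "\<And>x. (\<lambda>n. \<phi> n x) \<longlonglongrightarrow> indicat_real {c<..<d} x"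
proof
  fix n :: nat and x :: real
  let ?\<phi> = "\<lambda>n x. 1 - (1 - bump c d x) ^ n"
  have "smooth (\<lambda>x. 1 + (-1) * (1 + (-1) * bump c d x) ^ n)"
    by (intro smooth_add smooth_const smooth_cmult smooth_power smooth_bump)
  moreover have "?\<phi> n x = 0" if "x \<notin> {c..d}" for x
    using that by (subst bump_eq_0) auto
  ultimately show "?\<phi> n \<in> test_fun a b"
    unfolding test_fun_iff using assms by auto
  show "\<bar>?\<phi> n x\<bar> \<le> 1"
    using bump_bounds[of c d x] power_le_one[of "1 - bump c d x" n] zero_le_power[of "1 - bump c d x" n]
    by auto
  show "(\<lambda>n. ?\<phi> n x) \<longlonglongrightarrow> indicator {c<..<d} x"
  proof (cases "x \<in> {c<..<d}")
    case True
    then have "(\<lambda>n. (1 - bump c d x) ^ n) \<longlonglongrightarrow> 0"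
      using bump_bounds[of c d x] bump_pos[of c x d] by (intro LIMSEQ_realpow_zero) auto
    from tendsto_diff[OF tendsto_const[of 1] this] show ?thesis using True by simp
  qed (simp add: bump_eq_0)
qed

subsection \<open>Integration over an interval\<close>

text \<open>Restricting the measure, rather than multiplying integrands by an indicator, yields a
  finite measure space: constants are integrable and product measures can be formed
  directly.\<close>

abbreviation ivl_measure :: "real \<Rightarrow> real \<Rightarrow> real measure" where
  "ivl_measure a b \<equiv> restrict_space lborel {a<..<b}"

lemma finite_measure_ivl: "finite_measure (ivl_measure a b)"
  by (intro finite_measureI)
    (cases "a \<le> b", auto simp: emeasure_restrict_space space_restrict_space)

lemma sigma_finite_ivl: "sigma_finite_measure (ivl_measure a b)"
  using finite_measure_ivl[of a b] by (rule finite_measure.axioms)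

lemma pair_sigma_finite_ivl: "pair_sigma_finite (ivl_measure a b) (ivl_measure c d)"
  by (intro pair_sigma_finite.intro sigma_finite_ivl)

lemma space_ivl [simp]: "space (ivl_measure a b) = {a<..<b}"
  by (simp add: space_restrict_space)

lemma set_integral_ivl: "(LINT x:{a<..<b}|lborel. f x) = (\<integral>x. f x \<partial>ivl_measure a b)"
  for f :: "real \<Rightarrow> real"
  by (simp add: integral_restrict_space set_lebesgue_integral_def)

lemma set_integrable_ivl: "set_integrable lborel {a<..<b} f \<longleftrightarrow> integrable (ivl_measure a b) f"
  for f :: "real \<Rightarrow> real"
  by (simp add: integrable_restrict_space set_integrable_def)

lemma AE_ivl: "(AE x\<in>{a<..<b} in lborel. Q x) \<longleftrightarrow> (AE x in ivl_measure a b. Q x)"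
  by (simp add: AE_restrict_space_iff)

lemma set_borel_measurable_ivl:
  "set_borel_measurable lborel {a<..<b} f \<longleftrightarrow> f \<in> borel_measurable (ivl_measure a b)"
  for f :: "real \<Rightarrow> real"
  by (simp add: set_borel_measurable_def borel_measurable_restrict_space_iff)

text \<open>Moves a variable endpoint out of the measure and into the integrand, so that integrals
  with different endpoints live on one space. Dominated convergence, Fubini and joint measurability
  are all applied after this change.\<close>

lemma integral_ivl_mono_end:
  fixes f :: "real \<Rightarrow> real"
  assumes "x \<le> b"
  shows "(\<integral>y. f y \<partial>ivl_measure a x) = (\<integral>y. indicator {..<x} y * f y \<partial>ivl_measure a b)"
  using assms
  by (auto simp: integral_restrict_space indicator_def intro!: Bochner_Integration.integral_cong)

lemma integrable_ivl_subset:
  fixes f :: "real \<Rightarrow> real"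
  assumes "integrable (ivl_measure a b) f" "a \<le> c" "d \<le> b"
  shows "integrable (ivl_measure c d) f"
proof -
  have "{c<..<d} \<subseteq> {a<..<b}"
    by (rule subsetI) (use assms in simp)
  with set_integrable_subset[of lborel "{a<..<b}" f "{c<..<d}"] assms(1) show ?thesis
    by (simp add: set_integrable_ivl)
qed

lemma integrable_ivl_const: "integrable (ivl_measure a b) (\<lambda>x. c)"
  for c :: real
  using finite_measure.integrable_const[OF finite_measure_ivl] .

lemma integral_ivl_const: "a \<le> b \<Longrightarrow> (\<integral>x. c \<partial>ivl_measure a b) = (b - a) * c"
  for c :: real
  by (simp add: measure_restrict_space)

lemma integrable_ivl_bounded:
  fixes f g :: "real \<Rightarrow> real"
  assumes "integrable (ivl_measure a b) f" "g \<in> borel_measurable (ivl_measure a b)"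
    "\<And>x. x \<in> {a<..<b} \<Longrightarrow> \<bar>g x\<bar> \<le> C"
  shows "integrable (ivl_measure a b) (\<lambda>x. f x * g x)"
proof (rule Bochner_Integration.integrable_bound)
  show "integrable (ivl_measure a b) (\<lambda>x. C * \<bar>f x\<bar>)"
    using assms(1) by auto
  show "(\<lambda>x. f x * g x) \<in> borel_measurable (ivl_measure a b)"
    using assms by measurable
  show "AE x in ivl_measure a b. norm (f x * g x) \<le> norm (C * \<bar>f x\<bar>)"
  proof (rule AE_I2)
    fix x assume "x \<in> space (ivl_measure a b)"
    then have "\<bar>g x\<bar> \<le> C" using assms(3)[of x] by simp
    then have "\<bar>g x\<bar> * \<bar>f x\<bar> \<le> \<bar>C\<bar> * \<bar>f x\<bar>"
      by (intro mult_right_mono) auto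
    then show "norm (f x * g x) \<le> norm (C * \<bar>f x\<bar>)"
      by (simp add: abs_mult mult.commute)
  qed
qed

lemma continuous_ivl_integral:
  fixes f :: "real \<Rightarrow> real"
  assumes f: "integrable (ivl_measure a b) f"
  shows "continuous_on {a..b} (\<lambda>x. \<integral>y. f y \<partial>ivl_measure a x)"
proof -
  have "continuous_on {a..b} (\<lambda>x. \<integral>y. indicator {..<x} y * f y \<partial>ivl_measure a b)"
    unfolding continuous_on_sequentially comp_def
  proof safe
    fix X :: "nat \<Rightarrow> real" and x
    assume X: "X \<longlonglongrightarrow> x"
    show "(\<lambda>n. \<integral>y. indicator {..<X n} y * f y \<partial>ivl_measure a b) \<longlonglongrightarrow>
        (\<integral>y. indicator {..<x} y * f y \<partial>ivl_measure a b)"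
    proof (rule integral_dominated_convergence[where w = "\<lambda>y. \<bar>f y\<bar>"])
      \<comment> \<open>The indicators of \<open>{..<X n}\<close> converge at every point except
        possibly \<open>x\<close> itself.\<close>
      have "AE y in lborel. y \<noteq> x" by (rule AE_lborel_singleton)
      then have "AE y in ivl_measure a b. y \<noteq> x"
        unfolding AE_ivl[symmetric] by eventually_elim auto
      then show "AE y in ivl_measure a b. (\<lambda>n. indicator {..<X n} y * f y) \<longlonglongrightarrow> indicator {..<x} y * f y"
      proof eventually_elim
        case (elim y)
        have "\<forall>\<^sub>F n in sequentially. indicator {..<X n} y * f y = indicator {..<x} y * f y"
        proof (cases "y < x")
          case True
          from order_tendstoD(1)[OF X this] show ?thesis
            by eventually_elim (use True in auto)
        next
          case False
          with elim have "x < y" by simp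
          from order_tendstoD(2)[OF X this] show ?thesis
            by eventually_elim (use False in auto)
        qed
        then show ?case by (rule tendsto_eventually)
      qed
      show "(\<lambda>y. indicator {..<x} y * f y) \<in> borel_measurable (ivl_measure a b)"
        using f by (intro borel_measurable_times borel_measurable_indicator') (auto simp: sets_restrict_space)
      show "(\<lambda>y. indicator {..<X n} y * f y) \<in> borel_measurable (ivl_measure a b)" for n
        using f by (intro borel_measurable_times borel_measurable_indicator') (auto simp: sets_restrict_space)
    qed (use f in \<open>auto simp: indicator_def\<close>)
  qed
  then show ?thesis
    by (rule continuous_on_eq) (simp add: integral_ivl_mono_end[where b = b, symmetric])
qed

lemma AE_ivl_neq: "AE y in ivl_measure a b. y \<noteq> x"
  using AE_lborel_singleton[of x] unfolding AE_ivl[symmetric] by eventually_elim auto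

lemma measurable_ivl_borel: "(\<lambda>x. x) \<in> borel_measurable (ivl_measure a b)"
  by (auto intro: measurable_restrict_space1)

text \<open>By splitting the square \<open>(a,b)\<^sup>2\<close> along its diagonal.\<close>

lemma ivl_integral_mult:
  fixes f g :: "real \<Rightarrow> real"
  assumes f: "integrable (ivl_measure a b) f" and g: "integrable (ivl_measure a b) g"
  shows "integrable (ivl_measure a b) (\<lambda>x. f x * (\<integral>y. g y \<partial>ivl_measure a x))"
    and "integrable (ivl_measure a b) (\<lambda>x. g x * (\<integral>y. f y \<partial>ivl_measure a x))"
    and "(\<integral>x. f x \<partial>ivl_measure a b) * (\<integral>x. g x \<partial>ivl_measure a b) =
     (\<integral>x. f x * (\<integral>y. g y \<partial>ivl_measure a x) + g x * (\<integral>y. f y \<partial>ivl_measure a x) \<partial>ivl_measure a b)"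
proof -
  let ?M = "ivl_measure a b"
  interpret pair_sigma_finite ?M ?M by (rule pair_sigma_finite_ivl)
  note [measurable] = measurable_ivl_borel borel_measurable_integrable[OF f] borel_measurable_integrable[OF g]
  have lt [measurable]: "(\<lambda>z. indicator {..<fst z} (snd z) :: real) \<in> borel_measurable (?M \<Otimes>\<^sub>M ?M)"
  proof -
    have "(\<lambda>z. if snd z < fst z then 1 else 0 :: real) \<in> borel_measurable (?M \<Otimes>\<^sub>M ?M)"
      by measurable
    then show ?thesis by (simp add: indicator_def[abs_def] of_bool_def)
  qed
  have prod: "integrable (?M \<Otimes>\<^sub>M ?M) (\<lambda>(x, y). h x * k y)"
    if h: "integrable ?M h" and k: "integrable ?M k" for h k :: "real \<Rightarrow> real"
  proof (rule Fubini_integrable)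
    note [measurable] = borel_measurable_integrable[OF h] borel_measurable_integrable[OF k]
    show "(\<lambda>(x, y). h x * k y) \<in> borel_measurable (?M \<Otimes>\<^sub>M ?M)" by measurable
  qed (use h k in \<open>auto simp: abs_mult\<close>)
  have trunc: "integrable (?M \<Otimes>\<^sub>M ?M) (\<lambda>(x, y). h x * (indicator {..<x} y * k y))"
    if h: "integrable ?M h" and k: "integrable ?M k" for h k :: "real \<Rightarrow> real"
  proof (rule Bochner_Integration.integrable_bound[OF prod[OF h k]])
    note [measurable] = borel_measurable_integrable[OF h] borel_measurable_integrable[OF k]
    have "(\<lambda>z. h (fst z) * (indicator {..<fst z} (snd z) * k (snd z))) \<in> borel_measurable (?M \<Otimes>\<^sub>M ?M)"
      by measurable
    then show "(\<lambda>(x, y). h x * (indicator {..<x} y * k y)) \<in> borel_measurable (?M \<Otimes>\<^sub>M ?M)"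
      by (simp add: case_prod_beta')
  qed (auto simp: indicator_def)
  have part: "integrable ?M (\<lambda>x. h x * (\<integral>y. k y \<partial>ivl_measure a x))"
    if h: "integrable ?M h" and k: "integrable ?M k" for h k :: "real \<Rightarrow> real"
    using integrable_fst'[OF trunc[OF h k]]
    by (rule Bochner_Integration.integrable_cong[OF refl, THEN iffD1, rotated]) (simp add: integral_ivl_mono_end[where b = b, symmetric])
  show F: "integrable ?M (\<lambda>x. f x * (\<integral>y. g y \<partial>ivl_measure a x))"
    and G: "integrable ?M (\<lambda>x. g x * (\<integral>y. f y \<partial>ivl_measure a x))"
    by (intro part f g)+
  have ind_int: "integrable ?M (\<lambda>y. indicator {..<x} y * h y)" "integrable ?M (\<lambda>y. indicator {x<..} y * h y)"
    if "integrable ?M h" for h :: "real \<Rightarrow> real" and x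
    using integrable_ivl_bounded[OF that, of "indicator {..<x}" 1] integrable_ivl_bounded[OF that, of "indicator {x<..}" 1]
    by (simp_all add: mult.commute indicator_le_1 borel_measurable_indicator')
  have split: "(\<integral>y. g y \<partial>?M) = (\<integral>y. indicator {..<x} y * g y \<partial>?M) + (\<integral>y. indicator {x<..} y * g y \<partial>?M)" for x
  proof -
    have "(\<integral>y. g y \<partial>?M) = (\<integral>y. indicator {..<x} y * g y + indicator {x<..} y * g y \<partial>?M)"
    proof (rule integral_cong_AE)
      show "AE y in ?M. g y = indicator {..<x} y * g y + indicator {x<..} y * g y"
        using AE_ivl_neq[where x = x] by eventually_elim (auto simp: indicator_def)
      show "(\<lambda>y. indicator {..<x} y * g y + indicator {x<..} y * g y) \<in> borel_measurable ?M"
        by (intro borel_measurable_integrable Bochner_Integration.integrable_add ind_int g)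
    qed measurable
    also have "\<dots> = (\<integral>y. indicator {..<x} y * g y \<partial>?M) + (\<integral>y. indicator {x<..} y * g y \<partial>?M)"
      by (intro Bochner_Integration.integral_add ind_int g)
    finally show ?thesis .
  qed
  have trunc': "integrable (?M \<Otimes>\<^sub>M ?M) (\<lambda>(x, y). f x * (indicator {x<..} y * g y))"
  proof -
    have "integrable (?M \<Otimes>\<^sub>M ?M) (\<lambda>(x, y). g y * (indicator {..<y} x * f x))"
      using integrable_product_swap[OF trunc[OF g f]] by simp
    then show ?thesis
      by (rule Bochner_Integration.integrable_cong[OF refl, THEN iffD1, rotated]) (auto simp: indicator_def)
  qed
  \<comment> \<open>On the triangle \<open>x < y\<close>, exchanging the order of integration turns
    the inner integral of \<open>g\<close> into an inner integral of \<open>f\<close>.\<close>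
  have "(\<integral>x. f x * (\<integral>y. indicator {x<..} y * g y \<partial>?M) \<partial>?M)
      = (\<integral>x. (\<integral>y. f x * (indicator {x<..} y * g y) \<partial>?M) \<partial>?M)" by simp
  also have "\<dots> = (\<integral>y. (\<integral>x. f x * (indicator {x<..} y * g y) \<partial>?M) \<partial>?M)"
    using Fubini_integral[of "\<lambda>x y. f x * (indicator {x<..} y * g y)"] trunc' by simp
  also have "\<dots> = (\<integral>y. (\<integral>x. g y * (indicator {..<y} x * f x) \<partial>?M) \<partial>?M)"
    by (intro Bochner_Integration.integral_cong) (auto simp: indicator_def)
  also have "\<dots> = (\<integral>y. g y * (\<integral>x. f x \<partial>ivl_measure a y) \<partial>?M)"
    by (intro Bochner_Integration.integral_cong) (auto simp: integral_ivl_mono_end[where b = b, symmetric])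
  finally have swap: "(\<integral>x. f x * (\<integral>y. indicator {x<..} y * g y \<partial>?M) \<partial>?M) =
    (\<integral>y. g y * (\<integral>x. f x \<partial>ivl_measure a y) \<partial>?M)" .
  have F2: "integrable ?M (\<lambda>x. f x * (\<integral>y. indicator {x<..} y * g y \<partial>?M))"
    using integrable_fst'[OF trunc'] by simp
  have "(\<integral>x. f x \<partial>?M) * (\<integral>x. g x \<partial>?M) = (\<integral>x. f x * (\<integral>y. g y \<partial>?M) \<partial>?M)" by simp
  also have "\<dots> = (\<integral>x. f x * (\<integral>y. g y \<partial>ivl_measure a x) + f x * (\<integral>y. indicator {x<..} y * g y \<partial>?M) \<partial>?M)"
  proof (intro Bochner_Integration.integral_cong refl)
    fix x assume "x \<in> space ?M"
    then show "f x * (\<integral>y. g y \<partial>?M) =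
        f x * (\<integral>y. g y \<partial>ivl_measure a x) + f x * (\<integral>y. indicator {x<..} y * g y \<partial>?M)"
      using split[of x] integral_ivl_mono_end[of x b a g] by (simp add: distrib_left)
  qed
  also have "\<dots> = (\<integral>x. f x * (\<integral>y. g y \<partial>ivl_measure a x) \<partial>?M) +
      (\<integral>x. f x * (\<integral>y. indicator {x<..} y * g y \<partial>?M) \<partial>?M)"
    by (intro Bochner_Integration.integral_add F F2)
  also have "\<dots> = (\<integral>x. f x * (\<integral>y. g y \<partial>ivl_measure a x) + g x * (\<integral>y. f y \<partial>ivl_measure a x) \<partial>?M)"
    unfolding swap by (intro Bochner_Integration.integral_add[symmetric] F G)
  finally show "(\<integral>x. f x \<partial>?M) * (\<integral>x. g x \<partial>?M) =
     (\<integral>x. f x * (\<integral>y. g y \<partial>ivl_measure a x) + g x * (\<integral>y. f y \<partial>ivl_measure a x) \<partial>?M)" .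
qed

text \<open>After extension by zero, the positive and the negative part are densities of two
  measures that agree on all half-lines, hence everywhere. Densities are unique almost everywhere,
  and equal positive and negative parts force the value 0.\<close>

lemma ivl_integral_zero_imp_AE_zero:
  fixes f :: "real \<Rightarrow> real"
  assumes f: "integrable (ivl_measure a b) f"
    and zero: "\<And>x. x \<in> {a..b} \<Longrightarrow> (\<integral>y. f y \<partial>ivl_measure a x) = 0"
  shows "AE x in ivl_measure a b. f x = 0"
proof (cases "a < b")
  case False
  then have "space (ivl_measure a b) = {}" by auto
  then show ?thesis by (intro AE_I2) auto
next
  case ab: True
  define g where "g y = indicator {a<..<b} y * f y" for y
  have g: "integrable lborel g"
    using f by (simp add: integrable_restrict_space g_def[abs_def])
  then have [measurable]: "g \<in> borel_measurable borel" by auto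
  have tail: "(\<integral>y. indicator {x<..} y * g y \<partial>lborel) = 0" for x
  proof (cases "x \<in> {a..b}")
    case True
    have gi: "integrable lborel (\<lambda>y. indicator {x<..} y * g y)" "integrable lborel (\<lambda>y. indicator {..<x} y * g y)"
      using integrable_real_mult_indicator[of "{x<..}" lborel g] integrable_real_mult_indicator[of "{..<x}" lborel g] g
      by (simp_all add: mult.commute)
    have "0 = (\<integral>y. g y \<partial>lborel)"
      using zero[of b] ab by (simp add: integral_restrict_space g_def)
    also have "\<dots> = (\<integral>y. indicator {x<..} y * g y + indicator {..<x} y * g y \<partial>lborel)"
      by (intro integral_cong_AE) (use AE_lborel_singleton[of x] in \<open>auto elim!: eventually_mono simp: indicator_def\<close>)
    also have "\<dots> = (\<integral>y. indicator {x<..} y * g y \<partial>lborel) + (\<integral>y. indicator {..<x} y * g y \<partial>lborel)"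
      using gi by (rule Bochner_Integration.integral_add)
    also have "(\<integral>y. indicator {..<x} y * g y \<partial>lborel) = (\<integral>y. f y \<partial>ivl_measure a x)"
      using True by (auto simp: integral_restrict_space g_def indicator_def intro!: Bochner_Integration.integral_cong)
    also have "\<dots> = 0" using zero True by simp
    finally show ?thesis by simp
  next
    case False
    then consider "x < a" | "x > b" by fastforce
    then show ?thesis
    proof cases
      case 1
      then have "(\<integral>y. indicator {x<..} y * g y \<partial>lborel) = (\<integral>y. f y \<partial>ivl_measure a b)"
        by (auto simp: integral_restrict_space g_def indicator_def intro!: Bochner_Integration.integral_cong)
      then show ?thesis using zero[of b] ab by simp
    next
      case 2
      then have *: "indicator {x<..} y * g y = 0" for y by (auto simp: g_def indicator_def)
      show ?thesis by (simp only: *) simp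
    qed
  qed
  have dens: "density lborel (\<lambda>y. ennreal (g y)) = density lborel (\<lambda>y. ennreal (- g y))"
  proof (rule measure_eqI_lessThan)
    fix x :: real
    have gi: "integrable lborel (\<lambda>y. indicator {x<..} y * g y)"
      using integrable_real_mult_indicator[of "{x<..}" lborel g] g by (simp add: mult.commute)
    have eq: "(\<integral>\<^sup>+y. ennreal (h y) * indicator {x<..} y \<partial>lborel) = (\<integral>\<^sup>+y. ennreal (indicator {x<..} y * h y) \<partial>lborel)"
      for h :: "real \<Rightarrow> real"
      by (intro nn_integral_cong) (simp add: indicator_def)
    have fin: "(\<integral>\<^sup>+y. ennreal (indicator {x<..} y * g y) \<partial>lborel) \<noteq> \<infinity>"
      "(\<integral>\<^sup>+y. ennreal (indicator {x<..} y * - g y) \<partial>lborel) \<noteq> \<infinity>"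
      using gi by (auto simp: real_integrable_def)
    have "enn2real (\<integral>\<^sup>+y. ennreal (indicator {x<..} y * g y) \<partial>lborel)
        = enn2real (\<integral>\<^sup>+y. ennreal (indicator {x<..} y * - g y) \<partial>lborel)"
      using tail[of x] by (simp add: real_lebesgue_integral_def[OF gi])
    then have "(\<integral>\<^sup>+y. ennreal (indicator {x<..} y * g y) \<partial>lborel)
        = (\<integral>\<^sup>+y. ennreal (indicator {x<..} y * - g y) \<partial>lborel)"
      using fin by (metis (no_types) ennreal_enn2real infinity_ennreal_def less_top)
    then show "emeasure (density lborel (\<lambda>y. ennreal (g y))) {x<..} =
        emeasure (density lborel (\<lambda>y. ennreal (- g y))) {x<..}"
      by (simp add: emeasure_density eq)
    show "emeasure (density lborel (\<lambda>y. ennreal (g y))) {x<..} < \<infinity>"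
      using fin by (simp add: emeasure_density eq less_top)
  qed auto
  have "AE y in lborel. ennreal (g y) = ennreal (- g y)"
    by (rule sigma_finite_measure.density_unique[OF sigma_finite_lborel _ _ dens]) auto
  then have "AE y in lborel. g y = 0"
  proof eventually_elim
    case (elim y)
    then show ?case
      by (cases "0 \<le> g y") (auto simp: ennreal_neg ennreal_eq_0_iff)
  qed
  then show ?thesis
    unfolding AE_ivl[symmetric] by eventually_elim (auto simp: g_def)
qed

subsection \<open>Weak derivatives and absolute continuity\<close>

lemma integral_ivl_refl: "(\<integral>x. f x \<partial>ivl_measure a a) = 0"
  for f :: "real \<Rightarrow> real"
  by (rule Bochner_Integration.integral_empty) (simp only: space_ivl, simp)

lemma borel_measurable_indicator_ivl:
  assumes "A \<in> sets borel"
  shows "indicat_real A \<in> borel_measurable (ivl_measure a b)"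
  using borel_measurable_indicator[of A lborel] assms by (intro measurable_restrict_space1) simp

lemma ivl_integral_FTC:
  fixes F f :: "real \<Rightarrow> real"
  assumes "a \<le> b" "\<And>x. x \<in> {a..b} \<Longrightarrow> (F has_real_derivative f x) (at x within {a..b})"
    "continuous_on {a..b} f"
  shows "integrable (ivl_measure a b) f" "(\<integral>x. f x \<partial>ivl_measure a b) = F b - F a"
proof -
  have I: "set_integrable lborel {a..b} f"
    using assms(3) by (rule borel_integrable_atLeastAtMost')
  then have "set_integrable lborel {a<..<b} f"
    by (rule set_integrable_subset) auto
  then show "integrable (ivl_measure a b) f"
    by (simp add: set_integrable_ivl)
  have "(\<integral>x. f x \<partial>ivl_measure a b) = (LINT x:{a<..<b}|lborel. f x)"
    by (simp add: set_integral_ivl)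
  also have "\<dots> = (LINT x:{a..b}|lborel. f x)"
    unfolding set_lebesgue_integral_def
  proof (rule integral_cong_AE)
    show "AE x in lborel. indicator {a<..<b} x *\<^sub>R f x = indicator {a..b} x *\<^sub>R f x"
      using AE_lborel_singleton[of a] AE_lborel_singleton[of b]
      by eventually_elim (auto simp: indicator_def)
    show "(\<lambda>x. indicator {a..b} x *\<^sub>R f x) \<in> borel_measurable lborel"
      using I by (auto simp: set_integrable_def)
    show "(\<lambda>x. indicator {a<..<b} x *\<^sub>R f x) \<in> borel_measurable lborel"
      using \<open>set_integrable lborel {a<..<b} f\<close> unfolding set_integrable_def
      by (rule borel_measurable_integrable)
  qed
  also have "\<dots> = F b - F a"
    unfolding set_lebesgue_integral_def
    by (rule integral_FTC_atLeastAtMost) (use assms in \<open>auto simp: has_real_derivative_iff_has_vector_derivative\<close>)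
  finally show "(\<integral>x. f x \<partial>ivl_measure a b) = F b - F a" .
qed

lemma continuous_ivl_integrable:
  fixes f :: "real \<Rightarrow> real"
  assumes "continuous_on {a..b} f"
  shows "integrable (ivl_measure a b) f"
proof -
  have "set_integrable lborel {a..b} f"
    using assms by (rule borel_integrable_atLeastAtMost')
  then have "set_integrable lborel {a<..<b} f"
    by (rule set_integrable_subset) auto
  then show ?thesis by (simp add: set_integrable_ivl)
qed

lemma test_fun_deriv:
  assumes "\<psi> \<in> test_fun a b"
  shows "smooth (deriv \<psi>)" "(\<psi> has_real_derivative deriv \<psi> x) (at x)"
proof -
  from assms have "smooth \<psi>" by (simp add: test_fun_iff)
  then obtain f' where f': "smooth f'" "\<And>x. (\<psi> has_real_derivative f' x) (at x)"
    by (erule smooth_derivE)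
  then have "deriv \<psi> = f'" by (intro ext DERIV_imp_deriv)
  with f' show "smooth (deriv \<psi>)" "(\<psi> has_real_derivative deriv \<psi> x) (at x)" by auto
qed

lemma smooth_ivl_integral:
  assumes "a \<le> b" "\<And>x. (F has_real_derivative f x) (at x)" "smooth f"
  shows "(\<integral>x. f x \<partial>ivl_measure a b) = F b - F a"
  using assms by (intro ivl_integral_FTC) (auto intro: has_field_derivative_at_within smooth_continuous)

lemma test_fun_smooth: "\<psi> \<in> test_fun a b \<Longrightarrow> smooth \<psi>"
  by (simp add: test_fun_iff)

lemma test_fun_ends: "\<psi> \<in> test_fun a b \<Longrightarrow> \<psi> a = 0" "\<psi> \<in> test_fun a b \<Longrightarrow> \<psi> b = 0"
  by (auto simp: test_fun_iff)

lemma smooth_bounded: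
  assumes "smooth f"
  obtains C where "\<And>x. x \<in> {a<..<b} \<Longrightarrow> \<bar>f x\<bar> \<le> C"
proof -
  have "compact (f ` {a..b})"
    using smooth_continuous[OF assms] by (rule compact_continuous_image) simp
  then obtain C where "\<forall>y\<in>f ` {a..b}. norm y \<le> C"
    using compact_imp_bounded bounded_iff by blast
  then show ?thesis by (intro that[of C]) auto
qed

lemma smooth_measurable: "smooth f \<Longrightarrow> f \<in> borel_measurable (ivl_measure a b)"
  by (intro borel_measurable_integrable continuous_ivl_integrable smooth_continuous)

lemma integrable_mult_smooth:
  assumes "integrable (ivl_measure a b) f" "smooth g"
  shows "integrable (ivl_measure a b) (\<lambda>x. f x * g x)"
proof -
  obtain C where "\<And>x. x \<in> {a<..<b} \<Longrightarrow> \<bar>g x\<bar> \<le> C"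
    using smooth_bounded[OF assms(2)] by blast
  with assms smooth_measurable[OF assms(2)] show ?thesis
    by (intro integrable_ivl_bounded) auto
qed

section \<open>From test functions to primitives: the lemmas of du Bois-Reymond type\<close>

text \<open>The zero mean makes the primitive that vanishes to the left of the support vanish to its
  right as well, so the primitive is again compactly supported.\<close>

lemma test_fun_antideriv:
  assumes ab: "a < b" and \<theta>: "\<theta> \<in> test_fun a b" and zero: "(\<integral>x. \<theta> x \<partial>ivl_measure a b) = 0"
  obtains \<psi> where "\<psi> \<in> test_fun a b" "deriv \<psi> = \<theta>"
proof -
  from \<theta> obtain c d where cd: "a < c" "d < b" and supp: "\<And>x. x \<notin> {c..d} \<Longrightarrow> \<theta> x = 0"
    and sm: "smooth \<theta>"
    by (auto simp: test_fun_iff)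
  have "\<exists>F. \<forall>x::real. -\<infinity> < ereal x \<longrightarrow> ereal x < \<infinity> \<longrightarrow> (F has_vector_derivative \<theta> x) (at x)"
    by (intro einterval_antiderivative)
      (use smooth_continuous[OF sm, of UNIV] in \<open>simp_all add: continuous_on_eq_continuous_at\<close>)
  then obtain F where "\<forall>x::real. -\<infinity> < ereal x \<longrightarrow> ereal x < \<infinity> \<longrightarrow> (F has_vector_derivative \<theta> x) (at x)" ..
  then have F: "(F has_real_derivative \<theta> x) (at x)" for x
    by (simp add: has_real_derivative_iff_has_vector_derivative)
  have const: "F x = F y" if "x \<le> y" "\<And>z. z \<in> {x<..<y} \<Longrightarrow> \<theta> z = 0" for x y
  proof -
    have "F y - F x = (\<integral>z. \<theta> z \<partial>ivl_measure x y)"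
      using smooth_ivl_integral[of x y F \<theta>, OF that(1) F sm] by simp
    also have "\<dots> = (\<integral>z. 0 \<partial>ivl_measure x y)"
      using that(2) by (intro Bochner_Integration.integral_cong) auto
    finally show ?thesis by simp
  qed
  have ba: "F b = F a"
    using smooth_ivl_integral[OF less_imp_le[OF ab] F sm] zero by simp
  have 1: "F x = F a" if "x < c" for x
  proof (cases "x \<le> a")
    case True
    show ?thesis by (rule const[OF True]) (use cd in \<open>auto intro!: supp\<close>)
  next
    case False
    show ?thesis by (rule const[symmetric]) (use that False in \<open>auto intro!: supp\<close>)
  qed
  have 2: "F x = F b" if "x > d" for x
  proof (cases "x \<le> b")
    case True
    show ?thesis by (rule const[OF True]) (use that in \<open>auto intro!: supp\<close>)
  next
    case False
    show ?thesis by (rule const[symmetric]) (use cd False in \<open>auto intro!: supp\<close>)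
  qed
  define \<psi> where "\<psi> x = F x - F a" for x
  have D: "(\<psi> has_real_derivative \<theta> x) (at x)" for x
    unfolding \<psi>_def by (auto intro!: derivative_eq_intros F)
  then have "smooth \<psi>"
    using sm by (rule smooth_antideriv)
  moreover have "\<psi> x = 0" if "x \<notin> {c..d}" for x
    using that 1[of x] 2[of x] ba by (auto simp: \<psi>_def not_le)
  ultimately have "\<psi> \<in> test_fun a b"
    using cd by (auto simp: test_fun_iff)
  moreover have "deriv \<psi> = \<theta>"
    using D by (intro ext DERIV_imp_deriv)
  ultimately show ?thesis by (rule that)
qed

text \<open>The fundamental lemma of the calculus of variations. Approximating indicators by test
  functions shows that the primitive of \<open>f\<close> is constant on the open interval; by
  continuity it is constant up to \<open>a\<close>, where it is 0.\<close>

lemma test_fun_orthogonal_imp_zero: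
  fixes f :: "real \<Rightarrow> real"
  assumes f: "integrable (ivl_measure a b) f"
    and orth: "\<And>\<phi>. \<phi> \<in> test_fun a b \<Longrightarrow> (\<integral>x. f x * \<phi> x \<partial>ivl_measure a b) = 0"
  shows "AE x in ivl_measure a b. f x = 0"
proof (cases "a < b")
  case False
  then have "space (ivl_measure a b) = {}" by auto
  then show ?thesis by (intro AE_I2) auto
next
  case ab: True
  let ?F = "\<lambda>x. \<integral>y. f y \<partial>ivl_measure a x"
  have mid: "(\<integral>x. f x * indicator {c<..<d} x \<partial>ivl_measure a b) = 0" if "a < c" "d < b" for c d
  proof -
    obtain \<phi> where \<phi>: "\<And>n. \<phi> n \<in> test_fun a b" "\<And>n x. \<bar>\<phi> n x\<bar> \<le> 1"
      "\<And>x. (\<lambda>n. \<phi> n x) \<longlonglongrightarrow> indicat_real {c<..<d} x"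
      using test_fun_approx_indicator[OF \<open>a < c\<close> \<open>d < b\<close>] by blast
    have "(\<lambda>n. \<integral>x. f x * \<phi> n x \<partial>ivl_measure a b) \<longlonglongrightarrow> (\<integral>x. f x * indicator {c<..<d} x \<partial>ivl_measure a b)"
    proof (rule integral_dominated_convergence[where w = "\<lambda>y. \<bar>f y\<bar>"])
      show "(\<lambda>x. f x * indicator {c<..<d} x) \<in> borel_measurable (ivl_measure a b)"
        using f by (intro borel_measurable_times borel_measurable_indicator_ivl) auto
      show "(\<lambda>x. f x * \<phi> n x) \<in> borel_measurable (ivl_measure a b)" for n
        using integrable_mult_smooth[OF f test_fun_smooth[OF \<phi>(1)]] by (rule borel_measurable_integrable)
      show "AE x in ivl_measure a b. (\<lambda>n. f x * \<phi> n x) \<longlonglongrightarrow> f x * indicator {c<..<d} x"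
        by (intro AE_I2 tendsto_mult tendsto_const \<phi>(3))
      show "AE x in ivl_measure a b. norm (f x * \<phi> n x) \<le> \<bar>f x\<bar>" for n
        using \<phi>(2)[of n] by (intro AE_I2) (auto simp: abs_mult intro: mult_left_le)
    qed (use f in auto)
    then have "(\<lambda>n. 0) \<longlonglongrightarrow> (\<integral>x. f x * indicator {c<..<d} x \<partial>ivl_measure a b)"
      by (simp add: orth \<phi>(1))
    then show ?thesis by (simp add: LIMSEQ_const_iff)
  qed
  have Fcd: "?F c = ?F d" if "a < c" "c \<le> d" "d < b" for c d
  proof -
    have fc: "integrable (ivl_measure a d) f" "integrable (ivl_measure a c) f"
      using that by (auto intro: integrable_ivl_subset[OF f])
    have ind: "integrable (ivl_measure a d) (\<lambda>y. f y * indicator A y)" if "A \<in> sets borel" for A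
      using that by (intro integrable_ivl_bounded[OF fc(1), where C = 1])
        (auto simp: indicator_le_1 intro: borel_measurable_indicator_ivl)
    have "0 = (\<integral>x. f x * indicator {c<..<d} x \<partial>ivl_measure a b)" using mid that by simp
    also have "\<dots> = (\<integral>x. f x * indicator {c<..<d} x \<partial>ivl_measure a d)"
      using that by (subst integral_ivl_mono_end[of d b])
        (auto intro!: Bochner_Integration.integral_cong simp: indicator_def)
    finally have 0: "(\<integral>x. f x * indicator {c<..<d} x \<partial>ivl_measure a d) = 0" by simp
    have "?F d = (\<integral>y. f y * indicator {..<c} y + f y * indicator {c<..<d} y \<partial>ivl_measure a d)"
    proof (rule integral_cong_AE)
      show "AE y in ivl_measure a d. f y = f y * indicator {..<c} y + f y * indicator {c<..<d} y"
      proof -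
        have "AE y in ivl_measure a d. y \<in> space (ivl_measure a d)" by (rule AE_space)
        with AE_ivl_neq[where x = c] show ?thesis
          by eventually_elim (auto simp: indicator_def)
      qed
      show "(\<lambda>y. f y * indicator {..<c} y + f y * indicator {c<..<d} y) \<in> borel_measurable (ivl_measure a d)"
        by (intro borel_measurable_integrable Bochner_Integration.integrable_add ind) auto
    qed (use fc in auto)
    also have "\<dots> = (\<integral>y. f y * indicator {..<c} y \<partial>ivl_measure a d)"
      using ind[of "{..<c}"] ind[of "{c<..<d}"] 0 by simp
    also have "\<dots> = ?F c"
      using integral_ivl_mono_end[OF that(2), of a f] by (simp add: mult.commute)
    finally show ?thesis by simp
  qed
  define m where "m = (a + b) / 2"
  have m: "a < m" "m < b" using ab by (auto simp: m_def)
  have in_const: "?F x = ?F m" if "x \<in> {a<..<b}" for x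
  proof (cases "x \<le> m")
    case True
    show ?thesis by (rule Fcd) (use True m that in auto)
  next
    case False
    show ?thesis by (rule Fcd[symmetric]) (use False m that in auto)
  qed
  have "?F x = ?F m" if "x \<in> {a..b}" for x
  proof (rule continuous_constant_on_closure[where S = "{a<..<b}" and f = ?F and a = "?F m"])
    show "continuous_on (closure {a<..<b}) ?F"
      using continuous_ivl_integral[OF f] ab by simp
    show "x \<in> closure {a<..<b}" using that ab by simp
  qed (rule in_const)
  note const = this
  show ?thesis
  proof (rule ivl_integral_zero_imp_AE_zero[OF f])
    fix x assume "x \<in> {a..b}"
    moreover have "?F a = 0"
      by (rule integral_ivl_refl)
    moreover have "?F a = ?F m" by (rule const) (use ab in auto)
    ultimately show "?F x = 0" using const[of x] by metis
  qed
qed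

text \<open>The du Bois-Reymond lemma. Every test function of zero mean is the derivative of a test
  function, and any test function acquires zero mean after subtraction of a multiple of a fixed
  \<rho> with nonzero mean. That multiple determines the constant \<open>c\<close>.\<close>

lemma deriv_orthogonal_imp_const:
  fixes v :: "real \<Rightarrow> real"
  assumes ab: "a < b" and v: "integrable (ivl_measure a b) v"
    and orth: "\<And>\<psi>. \<psi> \<in> test_fun a b \<Longrightarrow> (\<integral>x. v x * deriv \<psi> x \<partial>ivl_measure a b) = 0"
  obtains c where "AE x in ivl_measure a b. v x = c"
proof -
  let ?M = "ivl_measure a b"
  \<comment> \<open>If all test functions had zero mean, the constant 1 would be orthogonal to each
    of them and hence vanish almost everywhere.\<close>
  have "\<exists>\<rho>\<in>test_fun a b. (\<integral>x. \<rho> x \<partial>?M) \<noteq> 0"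
  proof (rule ccontr)
    assume "\<not> ?thesis"
    then have "AE x in ?M. (1::real) = 0"
      by (intro test_fun_orthogonal_imp_zero) (auto intro: integrable_ivl_const)
    then have "(\<integral>x. (1::real) \<partial>?M) = 0"
      by (rule integral_eq_zero_AE)
    then show False
      using ab integral_ivl_const[of a b 1] by simp
  qed
  then obtain \<rho> where \<rho>: "\<rho> \<in> test_fun a b" "(\<integral>x. \<rho> x \<partial>?M) \<noteq> 0" by blast
  define k where "k = (\<integral>x. \<rho> x \<partial>?M)"
  define c where "c = (\<integral>x. v x * \<rho> x \<partial>?M) / k"
  have int: "integrable ?M f" if "smooth f" for f
    using that by (intro continuous_ivl_integrable smooth_continuous)
  have "AE x in ?M. v x - c = 0"
  proof (rule test_fun_orthogonal_imp_zero)
    show "integrable ?M (\<lambda>x. v x - c)"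
      using v by (intro Bochner_Integration.integrable_diff integrable_ivl_const)
    fix \<phi> assume \<phi>: "\<phi> \<in> test_fun a b"
    note sm = test_fun_smooth[OF \<phi>] test_fun_smooth[OF \<rho>(1)]
    define j where "j = (\<integral>x. \<phi> x \<partial>?M)"
    define \<theta> where "\<theta> x = \<phi> x + (- (j / k)) * \<rho> x" for x
    obtain c1 d1 where s1: "a < c1" "d1 < b" "\<And>x. x \<notin> {c1..d1} \<Longrightarrow> \<phi> x = 0"
      using \<phi> by (auto simp: test_fun_iff)
    obtain c2 d2 where s2: "a < c2" "d2 < b" "\<And>x. x \<notin> {c2..d2} \<Longrightarrow> \<rho> x = 0"
      using \<rho>(1) by (auto simp: test_fun_iff)
    have "\<theta> x = 0" if "x \<notin> {min c1 c2..max d1 d2}" for x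
    proof -
      have "x \<notin> {c1..d1}" "x \<notin> {c2..d2}" using that by auto
      then show ?thesis using s1(3) s2(3) by (simp add: \<theta>_def)
    qed
    moreover have "smooth \<theta>"
      unfolding \<theta>_def[abs_def] using sm by (intro smooth_add smooth_cmult)
    moreover have "a < min c1 c2" "max d1 d2 < b" using s1 s2 by auto
    ultimately have \<theta>: "\<theta> \<in> test_fun a b" unfolding test_fun_iff by blast
    have "(\<integral>x. \<theta> x \<partial>?M) = j + (- (j / k)) * k"
      unfolding \<theta>_def j_def k_def using int[OF sm(1)] int[OF sm(2)] by simp
    then have "(\<integral>x. \<theta> x \<partial>?M) = 0" using \<rho>(2) by (simp add: k_def)
    then obtain \<psi> where \<psi>: "\<psi> \<in> test_fun a b" "deriv \<psi> = \<theta>"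
      using test_fun_antideriv[OF ab \<theta>] by blast
    have i1: "integrable ?M (\<lambda>x. v x * \<phi> x)" "integrable ?M (\<lambda>x. v x * \<rho> x)"
      using integrable_mult_smooth[OF v] sm by auto
    have "0 = (\<integral>x. v x * \<phi> x + (- (j / k)) * (v x * \<rho> x) \<partial>?M)"
      using orth[OF \<psi>(1)] unfolding \<psi>(2) by (simp add: \<theta>_def algebra_simps)
    also have "\<dots> = (\<integral>x. v x * \<phi> x \<partial>?M) - j * c"
      using i1 by (simp add: c_def)
    also have "\<dots> = (\<integral>x. v x * \<phi> x - c * \<phi> x \<partial>?M)"
      using i1 int[OF sm(1)] by (simp add: j_def)
    finally show "(\<integral>x. (v x - c) * \<phi> x \<partial>?M) = 0"
      by (simp add: algebra_simps)
  qed
  then show ?thesis by (intro that[of c]) simp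
qed

text \<open>The case \<open>c = d = 0\<close> is \<open>ivl_integral_mult\<close>; the constants add
  only linear terms. Since \<open>v\<close> and \<open>y\<close> are known only almost everywhere,
  the right-hand side uses the endpoint values of their continuous representatives.\<close>

lemma ac_integral_by_parts:
  fixes v w y z :: "real \<Rightarrow> real"
  assumes ab: "a < b" and w: "integrable (ivl_measure a b) w" and z: "integrable (ivl_measure a b) z"
    and v: "AE x in ivl_measure a b. v x = c + (\<integral>s. w s \<partial>ivl_measure a x)"
    and y: "AE x in ivl_measure a b. y x = d + (\<integral>s. z s \<partial>ivl_measure a x)"
    and meas: "v \<in> borel_measurable (ivl_measure a b)" "y \<in> borel_measurable (ivl_measure a b)"
  shows "(\<integral>x. v x * z x \<partial>ivl_measure a b) + (\<integral>x. w x * y x \<partial>ivl_measure a b) =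
    (c + (\<integral>s. w s \<partial>ivl_measure a b)) * (d + (\<integral>s. z s \<partial>ivl_measure a b)) - c * d"
proof -
  let ?M = "ivl_measure a b"
  let ?W = "\<lambda>x. \<integral>s. w s \<partial>ivl_measure a x" and ?Z = "\<lambda>x. \<integral>s. z s \<partial>ivl_measure a x"
  note P = ivl_integral_mult[OF w z]
  have [measurable]: "w \<in> borel_measurable ?M" "z \<in> borel_measurable ?M"
    "v \<in> borel_measurable ?M" "y \<in> borel_measurable ?M"
    using w z meas by auto
  have i1: "integrable ?M (\<lambda>x. c * z x + z x * ?W x)" and i2: "integrable ?M (\<lambda>x. d * w x + w x * ?Z x)"
    using w z P by auto
  have "(\<integral>x. v x * z x \<partial>?M) = (\<integral>x. c * z x + z x * ?W x \<partial>?M)"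
    by (intro integral_cong_AE borel_measurable_integrable[OF i1])
      (measurable, use v in \<open>eventually_elim, simp add: algebra_simps\<close>)
  moreover have "(\<integral>x. w x * y x \<partial>?M) = (\<integral>x. d * w x + w x * ?Z x \<partial>?M)"
    by (intro integral_cong_AE borel_measurable_integrable[OF i2])
      (measurable, use y in \<open>eventually_elim, simp add: algebra_simps\<close>)
  moreover have "(\<integral>x. w x * ?Z x + z x * ?W x \<partial>?M) = (\<integral>x. w x * ?Z x \<partial>?M) + (\<integral>x. z x * ?W x \<partial>?M)"
    using P by (intro Bochner_Integration.integral_add)
  ultimately show ?thesis
    using w z P by (simp add: algebra_simps)
qed

text \<open>The primitive of \<open>w\<close> also has weak derivative \<open>w\<close>, so its
  difference from \<open>v\<close> is orthogonal to all derivatives of test functions and is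
  therefore constant.\<close>

lemma weak_deriv_imp_ac:
  fixes v w :: "real \<Rightarrow> real"
  assumes ab: "a < b" and v: "integrable (ivl_measure a b) v" and w: "integrable (ivl_measure a b) w"
    and wd: "\<And>\<psi>. \<psi> \<in> test_fun a b \<Longrightarrow>
      (\<integral>x. v x * deriv \<psi> x \<partial>ivl_measure a b) = - (\<integral>x. w x * \<psi> x \<partial>ivl_measure a b)"
  obtains c where "AE x in ivl_measure a b. v x = c + (\<integral>s. w s \<partial>ivl_measure a x)"
proof -
  let ?M = "ivl_measure a b" and ?W = "\<lambda>x. \<integral>s. w s \<partial>ivl_measure a x"
  have W: "integrable ?M ?W"
    by (intro continuous_ivl_integrable continuous_ivl_integral w)
  obtain c where "AE x in ?M. v x - ?W x = c"
  proof (rule deriv_orthogonal_imp_const[OF ab])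
    show "integrable ?M (\<lambda>x. v x - ?W x)" using v W by simp
    fix \<psi> assume \<psi>: "\<psi> \<in> test_fun a b"
    note D = test_fun_deriv[OF \<psi>]
    have \<psi>_eq: "\<psi> x = 0 + (\<integral>s. deriv \<psi> s \<partial>ivl_measure a x)" if "a \<le> x" for x
      using smooth_ivl_integral[OF that D(2) D(1)] test_fun_ends[OF \<psi>] by simp
    have i\<psi>: "integrable ?M (deriv \<psi>)"
      by (intro continuous_ivl_integrable smooth_continuous D)
    have "(\<integral>x. ?W x * deriv \<psi> x \<partial>?M) + (\<integral>x. w x * \<psi> x \<partial>?M) =
      (0 + (\<integral>s. w s \<partial>ivl_measure a b)) * (0 + (\<integral>s. deriv \<psi> s \<partial>ivl_measure a b)) - 0 * 0"
      by (rule ac_integral_by_parts[OF ab w i\<psi>])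
        (use W smooth_measurable[OF test_fun_smooth[OF \<psi>]] \<psi>_eq in \<open>auto intro!: AE_I2\<close>)
    also have "(\<integral>s. deriv \<psi> s \<partial>ivl_measure a b) = 0"
      using \<psi>_eq[of b] ab test_fun_ends[OF \<psi>] by simp
    finally have "(\<integral>x. ?W x * deriv \<psi> x \<partial>?M) = (\<integral>x. v x * deriv \<psi> x \<partial>?M)"
      using wd[OF \<psi>] by simp
    then show "(\<integral>x. (v x - ?W x) * deriv \<psi> x \<partial>?M) = 0"
      using integrable_mult_smooth[OF v D(1)] integrable_mult_smooth[OF W D(1)]
      by (simp add: left_diff_distrib)
  qed blast
  then show ?thesis
    by (intro that[of c]) (auto elim!: eventually_mono)
qed

subsection \<open>Sobolev functions on the unit interval and their traces\<close>

lemma L2_iff: "v \<in> L2 a b \<longleftrightarrow>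
    v \<in> borel_measurable (ivl_measure a b) \<and> integrable (ivl_measure a b) (\<lambda>x. (v x)\<^sup>2)"
  by (simp add: L2_def set_borel_measurable_ivl set_integrable_ivl)

lemma L2_norm_square: "(L2_norm a b v)\<^sup>2 = (\<integral>x. (v x)\<^sup>2 \<partial>ivl_measure a b)"
  unfolding L2_norm_def set_integral_ivl
  by (intro real_sqrt_pow2 Bochner_Integration.integral_nonneg) simp

lemma L2_measurable: "v \<in> L2 a b \<Longrightarrow> v \<in> borel_measurable (ivl_measure a b)"
  by (simp add: L2_iff)

lemma L2_integrable_square: "v \<in> L2 a b \<Longrightarrow> integrable (ivl_measure a b) (\<lambda>x. (v x)\<^sup>2)"
  by (simp add: L2_iff)

lemma L2_integrable_mult:
  assumes "v \<in> L2 a b" "w \<in> L2 a b"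
  shows "integrable (ivl_measure a b) (\<lambda>x. v x * w x)"
proof (rule Bochner_Integration.integrable_bound)
  show "integrable (ivl_measure a b) (\<lambda>x. (v x)\<^sup>2 + (w x)\<^sup>2)"
    using assms by (simp add: L2_iff)
  show "(\<lambda>x. v x * w x) \<in> borel_measurable (ivl_measure a b)"
    using assms by (intro borel_measurable_times) (simp_all add: L2_iff)
  have "norm (s * t) \<le> norm (s\<^sup>2 + t\<^sup>2)" for s t :: real
  proof -
    have "2 * (\<bar>s\<bar> * \<bar>t\<bar>) \<le> s\<^sup>2 + t\<^sup>2" "0 \<le> \<bar>s\<bar> * \<bar>t\<bar>"
      using sum_squares_bound[of "\<bar>s\<bar>" "\<bar>t\<bar>"] by auto
    then have "\<bar>s\<bar> * \<bar>t\<bar> \<le> s\<^sup>2 + t\<^sup>2" by linarith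
    then show ?thesis by (simp add: abs_mult)
  qed
  then show "AE x in ivl_measure a b. norm (v x * w x) \<le> norm ((v x)\<^sup>2 + (w x)\<^sup>2)" by simp
qed

lemma L2_bounded:
  assumes "v \<in> borel_measurable (ivl_measure a b)" "\<And>x. x \<in> {a<..<b} \<Longrightarrow> \<bar>v x\<bar> \<le> C"
  shows "v \<in> L2 a b"
proof -
  have "integrable (ivl_measure a b) (\<lambda>x. v x * v x)"
    using integrable_ivl_bounded[OF integrable_ivl_bounded[OF integrable_ivl_const assms] assms, of 1] by simp
  then show ?thesis using assms by (simp add: L2_iff power2_eq_square)
qed

lemma L2_const: "(\<lambda>x. c) \<in> L2 a b"
  by (rule L2_bounded[where C = "\<bar>c\<bar>"]) auto

lemma L2_integrable: "v \<in> L2 a b \<Longrightarrow> integrable (ivl_measure a b) v"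
  using L2_integrable_mult[OF _ L2_const[of 1]] by simp

lemma L2_cmult: "v \<in> L2 a b \<Longrightarrow> (\<lambda>x. c * v x) \<in> L2 a b"
  by (auto simp: L2_iff power_mult_distrib)

lemma L2_add:
  assumes "v \<in> L2 a b" "w \<in> L2 a b"
  shows "(\<lambda>x. v x + w x) \<in> L2 a b"
proof -
  have "integrable (ivl_measure a b) (\<lambda>x. (v x)\<^sup>2 + (w x)\<^sup>2 + 2 * (v x * w x))"
    using assms L2_integrable_mult[OF assms] by (simp add: L2_iff)
  moreover have "(\<lambda>x. v x + w x) \<in> borel_measurable (ivl_measure a b)"
    using assms by (intro borel_measurable_add) (simp_all add: L2_iff)
  ultimately show ?thesis by (simp add: L2_iff power2_sum mult.assoc)
qed

lemma L2_diff: "v \<in> L2 a b \<Longrightarrow> w \<in> L2 a b \<Longrightarrow> (\<lambda>x. v x - w x) \<in> L2 a b"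
  using L2_add[OF _ L2_cmult[of w a b "-1"], of v] by simp

lemma L2_cong_AE:
  assumes "v \<in> L2 a b" "w \<in> borel_measurable (ivl_measure a b)" "AE x in ivl_measure a b. v x = w x"
  shows "w \<in> L2 a b"
proof -
  have "integrable (ivl_measure a b) (\<lambda>x. (w x)\<^sup>2)"
    by (rule integrable_cong_AE_imp[OF L2_integrable_square[OF assms(1)]])
      (use assms in \<open>auto elim!: eventually_mono\<close>)
  with assms show ?thesis by (simp add: L2_iff)
qed

section \<open>The inner product on the unit interval\<close>

definition L2_inner :: "(real \<Rightarrow> real) \<Rightarrow> (real \<Rightarrow> real) \<Rightarrow> real" where
  "L2_inner v w = (\<integral>x. v x * w x \<partial>ivl_measure 0 1)"

lemma L2_inner_commute: "L2_inner v w = L2_inner w v"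
  by (simp add: L2_inner_def mult.commute)

lemma L2_inner_add_left:
  "v \<in> L2 0 1 \<Longrightarrow> w \<in> L2 0 1 \<Longrightarrow> z \<in> L2 0 1 \<Longrightarrow>
    L2_inner (\<lambda>x. v x + w x) z = L2_inner v z + L2_inner w z"
  by (simp add: L2_inner_def distrib_right L2_integrable_mult)

lemma L2_inner_diff_left:
  "v \<in> L2 0 1 \<Longrightarrow> w \<in> L2 0 1 \<Longrightarrow> z \<in> L2 0 1 \<Longrightarrow>
    L2_inner (\<lambda>x. v x - w x) z = L2_inner v z - L2_inner w z"
  by (simp add: L2_inner_def left_diff_distrib L2_integrable_mult)

lemma L2_inner_cmult_left: "L2_inner (\<lambda>x. c * v x) z = c * L2_inner v z"
  by (simp add: L2_inner_def mult.assoc)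

lemma L2_inner_cong_AE:
  assumes "AE x in ivl_measure 0 1. v x = v' x" "AE x in ivl_measure 0 1. w x = w' x"
    "v \<in> L2 0 1" "v' \<in> L2 0 1" "w \<in> L2 0 1" "w' \<in> L2 0 1"
  shows "L2_inner v w = L2_inner v' w'"
  unfolding L2_inner_def
proof (rule integral_cong_AE)
  show "AE x in ivl_measure 0 1. v x * w x = v' x * w' x"
    using assms(1,2) by eventually_elim simp
qed (use assms in \<open>auto simp: L2_iff\<close>)

lemma L2_inner_nonneg: "0 \<le> L2_inner v v"
  unfolding L2_inner_def by (intro Bochner_Integration.integral_nonneg) simp

lemma L2_norm_inner: "(L2_norm 0 1 v)\<^sup>2 = L2_inner v v"
  unfolding L2_norm_square L2_inner_def by (simp add: power2_eq_square)

lemma L2_inner_young: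
  assumes "v \<in> L2 0 1" "w \<in> L2 0 1" "\<epsilon> > 0"
  shows "\<bar>L2_inner v w\<bar> \<le> \<epsilon> / 2 * L2_inner v v + L2_inner w w / (2 * \<epsilon>)"
proof -
  let ?M = "ivl_measure 0 1"
  have i: "integrable ?M (\<lambda>x. v x * v x)" "integrable ?M (\<lambda>x. w x * w x)" "integrable ?M (\<lambda>x. v x * w x)"
    using assms by (auto intro: L2_integrable_mult)
  have "\<bar>L2_inner v w\<bar> \<le> (\<integral>x. \<bar>v x * w x\<bar> \<partial>?M)"
    unfolding L2_inner_def using integral_norm_bound[of ?M "\<lambda>x. v x * w x"] by simp
  also have "\<dots> \<le> (\<integral>x. \<epsilon> / 2 * (v x * v x) + (w x * w x) / (2 * \<epsilon>) \<partial>?M)"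
  proof (rule integral_mono)
    fix x
    have "0 \<le> (\<epsilon> * \<bar>v x\<bar> - \<bar>w x\<bar>)\<^sup>2 / (2 * \<epsilon>)" using assms(3) by simp
    also have "\<dots> = \<epsilon> / 2 * (v x * v x) + (w x * w x) / (2 * \<epsilon>) - \<bar>v x * w x\<bar>"
      using assms(3) by (simp add: power2_diff power_mult_distrib field_simps abs_mult power2_eq_square)
    finally show "\<bar>v x * w x\<bar> \<le> \<epsilon> / 2 * (v x * v x) + (w x * w x) / (2 * \<epsilon>)" by simp
  qed (use i in auto)
  also have "\<dots> = \<epsilon> / 2 * L2_inner v v + L2_inner w w / (2 * \<epsilon>)"
    using i by (simp add: L2_inner_def)
  finally show ?thesis .
qed

lemma L2_inner_bounded:
  assumes q: "q \<in> L2 0 1" and \<phi>: "\<phi> \<in> borel_measurable (ivl_measure 0 1)" "\<And>x. x \<in> {0<..<1} \<Longrightarrow> \<bar>\<phi> x\<bar> \<le> C"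
    and C: "0 \<le> C"
  shows "\<bar>L2_inner q \<phi>\<bar> \<le> C * L2_norm 0 1 q"
proof -
  let ?M = "ivl_measure 0 1"
  define m where "m = L2_inner q \<phi>"
  have \<phi>L: "\<phi> \<in> L2 0 1" using \<phi> by (rule L2_bounded)
  have i1: "integrable ?M (\<lambda>x. q x * \<phi> x)" using q \<phi>L by (rule L2_integrable_mult)
  have i2: "integrable ?M (\<lambda>x. (q x)\<^sup>2 * (\<phi> x)\<^sup>2)"
    using integrable_ivl_bounded[OF integrable_ivl_bounded[OF L2_integrable_square[OF q] \<phi>] \<phi>]
    by (simp add: power2_eq_square mult.assoc)
  \<comment> \<open>On an interval of length one, \<open>m\<close> is the mean of the product, and a
    nonnegative variance says that \<open>m\<^sup>2\<close> is at most the mean square.\<close>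
  have "0 \<le> (\<integral>x. (q x * \<phi> x - m)\<^sup>2 \<partial>?M)" by simp
  also have "\<dots> = (\<integral>x. (q x)\<^sup>2 * (\<phi> x)\<^sup>2 - 2 * m * (q x * \<phi> x) + m\<^sup>2 \<partial>?M)"
    by (simp add: power2_diff power_mult_distrib algebra_simps)
  also have "\<dots> = (\<integral>x. (q x)\<^sup>2 * (\<phi> x)\<^sup>2 \<partial>?M) - 2 * m * m + m\<^sup>2"
    using i1 i2 integral_ivl_const[of 0 1 "m\<^sup>2"] integrable_ivl_const[of 0 1 "m\<^sup>2"]
    by (simp add: m_def L2_inner_def)
  finally have "m\<^sup>2 \<le> (\<integral>x. (q x)\<^sup>2 * (\<phi> x)\<^sup>2 \<partial>?M)" by (simp add: power2_eq_square)
  also have "\<dots> \<le> (\<integral>x. (q x)\<^sup>2 * C\<^sup>2 \<partial>?M)"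
  proof (rule integral_mono)
    fix x assume "x \<in> space ?M"
    then have "(\<phi> x)\<^sup>2 \<le> C\<^sup>2" using \<phi>(2)[of x] C by (simp add: abs_le_square_iff[symmetric])
    then show "(q x)\<^sup>2 * (\<phi> x)\<^sup>2 \<le> (q x)\<^sup>2 * C\<^sup>2" by (intro mult_left_mono) auto
  qed (use i2 q in \<open>auto simp: L2_iff\<close>)
  also have "\<dots> = (C * L2_norm 0 1 q)\<^sup>2"
    by (simp add: power_mult_distrib L2_norm_square)
  finally have "\<bar>m\<bar> \<le> \<bar>C * L2_norm 0 1 q\<bar>" by (simp add: abs_le_square_iff)
  moreover have "0 \<le> L2_norm 0 1 q"
    unfolding L2_norm_def set_integral_ivl by (intro real_sqrt_ge_zero) simp
  ultimately show ?thesis using C by (simp add: m_def)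
qed

section \<open>Weak derivatives, traces and integration by parts in space\<close>

lemma weak_derivD:
  assumes "weak_deriv a b v w"
  shows "v \<in> L2 a b" "w \<in> L2 a b"
    "\<And>\<phi>. \<phi> \<in> test_fun a b \<Longrightarrow> (\<integral>x. v x * deriv \<phi> x \<partial>ivl_measure a b) = - (\<integral>x. w x * \<phi> x \<partial>ivl_measure a b)"
  using assms by (auto simp: weak_deriv_def set_integral_ivl)

lemma weak_deriv_unique:
  assumes "weak_deriv a b v w" "weak_deriv a b v w'"
  shows "AE x in ivl_measure a b. w x = w' x"
proof -
  note i = weak_derivD(1,2)[OF assms(1), THEN L2_integrable] weak_derivD(1,2)[OF assms(2), THEN L2_integrable]
  have "AE x in ivl_measure a b. w x - w' x = 0"
  proof (rule test_fun_orthogonal_imp_zero)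
    fix \<phi> assume \<phi>: "\<phi> \<in> test_fun a b"
    show "(\<integral>x. (w x - w' x) * \<phi> x \<partial>ivl_measure a b) = 0"
      using weak_derivD(3)[OF assms(1) \<phi>] weak_derivD(3)[OF assms(2) \<phi>]
        integrable_mult_smooth[OF i(2) test_fun_smooth[OF \<phi>]] integrable_mult_smooth[OF i(4) test_fun_smooth[OF \<phi>]]
      by (simp add: left_diff_distrib)
  qed (use i in simp)
  then show ?thesis by simp
qed

lemma weak_deriv_cong_AE:
  assumes "weak_deriv a b v w" "v' \<in> borel_measurable (ivl_measure a b)" "AE x in ivl_measure a b. v x = v' x"
  shows "weak_deriv a b v' w"
proof -
  note L = weak_derivD(1,2)[OF assms(1)]
  have L': "v' \<in> L2 a b" using L2_cong_AE[OF L(1) assms(2,3)] .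
  have "(\<integral>x. v' x * deriv \<phi> x \<partial>ivl_measure a b) = - (\<integral>x. w x * \<phi> x \<partial>ivl_measure a b)"
    if \<phi>: "\<phi> \<in> test_fun a b" for \<phi>
  proof -
    have "(\<integral>x. v' x * deriv \<phi> x \<partial>ivl_measure a b) = (\<integral>x. v x * deriv \<phi> x \<partial>ivl_measure a b)"
    proof (rule integral_cong_AE)
      show "AE x in ivl_measure a b. v' x * deriv \<phi> x = v x * deriv \<phi> x"
        using assms(3) by eventually_elim simp
    qed (use integrable_mult_smooth[OF L2_integrable[OF L(1)] test_fun_deriv(1)[OF \<phi>]]
        integrable_mult_smooth[OF L2_integrable[OF L'] test_fun_deriv(1)[OF \<phi>]] in auto)
    then show ?thesis using weak_derivD(3)[OF assms(1) \<phi>] by simp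
  qed
  with L L' show ?thesis by (simp add: weak_deriv_def set_integral_ivl)
qed

lemma weak_deriv_wderiv: "v \<in> H1 a b \<Longrightarrow> weak_deriv a b v (wderiv a b v)"
  unfolding H1_def wderiv_def by (simp add: someI_ex)

text \<open>The two choices are equal as functions, not only almost everywhere, because the
  predicates under \<open>SOME\<close> coincide.\<close>

lemma wderiv_cong_AE:
  assumes "v \<in> borel_measurable (ivl_measure a b)" "v' \<in> borel_measurable (ivl_measure a b)"
    "AE x in ivl_measure a b. v x = v' x"
  shows "wderiv a b v = wderiv a b v'"
proof -
  have "AE x in ivl_measure a b. v' x = v x" using assms(3) by eventually_elim simp
  then have "weak_deriv a b v = weak_deriv a b v'"
    using weak_deriv_cong_AE[OF _ assms(2,3)] weak_deriv_cong_AE[OF _ assms(1)] by (intro ext iffI) auto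
  then show ?thesis by (simp add: wderiv_def)
qed

lemma trace_cong_AE:
  assumes "AE x in ivl_measure 0 1. v x = v' x"
  shows "trace v p = trace v' p"
proof -
  have "(AE x in ivl_measure 0 1. v x = w x) \<longleftrightarrow> (AE x in ivl_measure 0 1. v' x = w x)" for w
    using assms by (auto elim: eventually_elim2)
  then show ?thesis unfolding trace_def AE_ivl by simp
qed

text \<open>Inside the interval the set of disagreement is open and null, hence empty; the endpoints
  follow by closure.\<close>

lemma continuous_AE_eq_imp_eq:
  fixes f g :: "real \<Rightarrow> real"
  assumes "a < b" "continuous_on {a..b} f" "continuous_on {a..b} g"
    "AE x in ivl_measure a b. f x = g x" "p \<in> {a..b}"
  shows "f p = g p"
proof -
  have "f x = g x" if x: "x \<in> {a<..<b}" for x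
  proof (rule ccontr)
    assume ne: "f x \<noteq> g x"
    define S where "S = {y \<in> {a<..<b}. f y \<noteq> g y}"
    have co: "continuous_on {a<..<b} (\<lambda>y. f y - g y)"
      using assms(2,3) by (intro continuous_on_diff) (auto intro: continuous_on_subset)
    have "open ((\<lambda>y. f y - g y) -` (- {0}) \<inter> {a<..<b})"
      using continuous_open_preimage[OF co open_greaterThanLessThan, of "- {0}"] by (simp add: Int_commute open_Compl)
    also have "(\<lambda>y. f y - g y) -` (- {0}) \<inter> {a<..<b} = S"
      by (auto simp: S_def)
    finally have S: "open S" "S \<noteq> {}" using x ne by (auto simp: S_def)
    have "AE y in lborel. y \<notin> S"
      using assms(4) unfolding AE_ivl[symmetric] by eventually_elim (auto simp: S_def)
    then have "S \<in> null_sets lborel"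
      using S(1) by (subst (asm) AE_iff_null_sets[symmetric]) auto
    then have "negligible S"
      by (simp add: negligible_iff_null_sets null_sets_completionI)
    with S show False using open_not_negligible by blast
  qed
  note eq = this
  have "f p - g p = 0"
  proof (rule continuous_constant_on_closure[where S = "{a<..<b}" and f = "\<lambda>x. f x - g x" and a = 0])
    show "continuous_on (closure {a<..<b}) (\<lambda>x. f x - g x)"
      using assms by (auto intro: continuous_on_diff)
    show "p \<in> closure {a<..<b}" using assms by simp
    show "f x - g x = 0" if "x \<in> {a<..<b}" for x
      using eq[OF that] by simp
  qed
  then show ?thesis by simp
qed

text \<open>Two continuous representatives agree on all of \<open>{0..1}\<close>, so the definite
  description in \<open>trace\<close> denotes the expected value as soon as one of them is
  known.\<close>

lemma trace_eq:
  assumes "continuous_on {0..1} w" "AE x in ivl_measure 0 1. v x = w x" "p \<in> {0..1}"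
  shows "trace v p = w p"
  unfolding trace_def AE_ivl
proof (rule the_equality)
  show "\<exists>w'. continuous_on {0..1} w' \<and> (AE x in ivl_measure 0 1. v x = w' x) \<and> w' p = w p"
    using assms by blast
  fix c assume "\<exists>w'. continuous_on {0..1} w' \<and> (AE x in ivl_measure 0 1. v x = w' x) \<and> w' p = c"
  then obtain w' where w': "continuous_on {0..1} w'" "AE x in ivl_measure 0 1. v x = w' x" "w' p = c" by blast
  have "AE x in ivl_measure 0 1. w' x = w x"
    using w'(2) assms(2) by eventually_elim simp
  from continuous_AE_eq_imp_eq[OF _ w'(1) assms(1) this assms(3)] w'(3) show "c = w p" by simp
qed

lemma weak_deriv_ac:
  assumes "weak_deriv 0 1 v w"
  shows "AE x in ivl_measure 0 1. v x = trace v 0 + (\<integral>s. w s \<partial>ivl_measure 0 x)"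
    and "trace v 1 = trace v 0 + (\<integral>s. w s \<partial>ivl_measure 0 1)"
proof -
  note L = weak_derivD(1,2)[OF assms, THEN L2_integrable]
  obtain c where c: "AE x in ivl_measure 0 1. v x = c + (\<integral>s. w s \<partial>ivl_measure 0 x)"
    using weak_deriv_imp_ac[OF _ L weak_derivD(3)[OF assms]] by auto
  have "trace v p = c + (\<integral>s. w s \<partial>ivl_measure 0 p)" if "p \<in> {0..1}" for p
    by (rule trace_eq[OF _ c that]) (intro continuous_intros continuous_ivl_integral L)
  from this[of 0] this[of 1] have "trace v 0 = c" "trace v 1 = c + (\<integral>s. w s \<partial>ivl_measure 0 1)"
    by (simp_all add: integral_ivl_refl[simplified])
  with c show "AE x in ivl_measure 0 1. v x = trace v 0 + (\<integral>s. w s \<partial>ivl_measure 0 x)"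
    "trace v 1 = trace v 0 + (\<integral>s. w s \<partial>ivl_measure 0 1)" by auto
qed

lemma weak_deriv_by_parts:
  assumes "weak_deriv 0 1 v w" "weak_deriv 0 1 y z"
  shows "L2_inner v z + L2_inner w y = trace v 1 * trace y 1 - trace v 0 * trace y 0"
  using ac_integral_by_parts[OF zero_less_one
      weak_derivD(2)[OF assms(1), THEN L2_integrable] weak_derivD(2)[OF assms(2), THEN L2_integrable]
      weak_deriv_ac(1)[OF assms(1)] weak_deriv_ac(1)[OF assms(2)]
      weak_derivD(1)[OF assms(1), THEN L2_measurable] weak_derivD(1)[OF assms(2), THEN L2_measurable]]
  by (simp add: L2_inner_def weak_deriv_ac(2)[OF assms(1)] weak_deriv_ac(2)[OF assms(2)])

lemma trace_eq_L2_inner: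
  assumes "weak_deriv 0 1 v w"
  shows "trace v 0 = L2_inner v (\<lambda>x. 1) - L2_inner w (\<lambda>x. 1 - x)"
    and "trace v 1 = L2_inner v (\<lambda>x. 1) + L2_inner w (\<lambda>x. x)"
proof -
  \<comment> \<open>Integration by parts against the affine weight d + s x. The weight 1 - x removes
    the trace at 1, and the weight x removes the trace at 0.\<close>
  have parts: "(\<integral>x. v x * s \<partial>ivl_measure 0 1) + (\<integral>x. w x * (d + s * x) \<partial>ivl_measure 0 1) =
    trace v 1 * (d + s) - trace v 0 * d" for d s :: real
  proof -
    have "d + s * x = d + (\<integral>y. s \<partial>ivl_measure 0 x)" if "x \<in> space (ivl_measure 0 1)" for x
      using integral_ivl_const[of 0 x s] that by (simp del: Bochner_Integration.lebesgue_integral_const)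
    then have "AE x in ivl_measure 0 1. d + s * x = d + (\<integral>y. s \<partial>ivl_measure 0 x)"
      by (rule AE_I2)
    moreover have "(\<lambda>x. d + s * x) \<in> borel_measurable (ivl_measure 0 1)"
      by (intro borel_measurable_add borel_measurable_times measurable_ivl_borel) auto
    ultimately show ?thesis
      using ac_integral_by_parts[OF zero_less_one
          weak_derivD(2)[OF assms, THEN L2_integrable] integrable_ivl_const[of 0 1 s]
          weak_deriv_ac(1)[OF assms] _ weak_derivD(1)[OF assms, THEN L2_measurable],
          of "\<lambda>x. d + s * x" d] integral_ivl_const[of 0 1 s]
      by (simp only: weak_deriv_ac(2)[OF assms]) simp
  qed
  show "trace v 0 = L2_inner v (\<lambda>x. 1) - L2_inner w (\<lambda>x. 1 - x)"
    using parts[of "-1" 1] by (simp add: L2_inner_def)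
  show "trace v 1 = L2_inner v (\<lambda>x. 1) + L2_inner w (\<lambda>x. x)"
    using parts[of 1 0] by (simp add: L2_inner_def)
qed

subsection \<open>Absolute continuity in time\<close>

text \<open>The identity holds at every time of the closed interval, while the density
  \<open>G\<close> matters only up to a null set. Boundary conditions and the wave equation, valid
  for almost every time, are enough to evaluate \<open>G\<close>.\<close>

definition ac_on :: "real \<Rightarrow> (real \<Rightarrow> real) \<Rightarrow> (real \<Rightarrow> real) \<Rightarrow> bool" where
  "ac_on T F G \<longleftrightarrow> integrable (ivl_measure 0 T) G \<and>
     (\<forall>t\<in>{0..T}. F t = F 0 + (\<integral>s. G s \<partial>ivl_measure 0 t))"

text \<open>A pointwise reading of an \<open>L2\<close>-valued integral in time. The exceptional
  null set of \<open>x\<close> may depend on \<open>t\<close>, and no joint measurability of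
  \<open>A\<close> is asked for.\<close>

definition time_prim :: "real \<Rightarrow> (real \<Rightarrow> real \<Rightarrow> real) \<Rightarrow> (real \<Rightarrow> real \<Rightarrow> real) \<Rightarrow> bool" where
  "time_prim T A W \<longleftrightarrow> W \<in> Linf_L2 T \<and>
     (\<forall>t\<in>{0..T}. A t \<in> L2 0 1 \<and> (AE x in ivl_measure 0 1. A t x = A 0 x + (\<integral>s. W s x \<partial>ivl_measure 0 t)))"

lemma ivl_integral_square_le:
  fixes f :: "real \<Rightarrow> real"
  assumes "a \<le> b" "f \<in> L2 a b"
  shows "(\<integral>x. f x \<partial>ivl_measure a b)\<^sup>2 \<le> (b - a) * (\<integral>x. (f x)\<^sup>2 \<partial>ivl_measure a b)"
proof (cases "a = b")
  case True
  then show ?thesis using integral_ivl_refl[of b f] by simp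
next
  case False
  let ?M = "ivl_measure a b"
  define m where "m = (\<integral>x. f x \<partial>?M)"
  define L where "L = b - a"
  have L: "L > 0" using False assms(1) by (simp add: L_def)
  note i = L2_integrable[OF assms(2)] L2_integrable_square[OF assms(2)] integrable_ivl_const
  have "0 \<le> (\<integral>x. (L * f x - m)\<^sup>2 \<partial>?M)" by simp
  also have "\<dots> = (\<integral>x. L\<^sup>2 * (f x)\<^sup>2 - (2 * L * m) * f x + m\<^sup>2 \<partial>?M)"
    by (simp add: power2_diff power_mult_distrib algebra_simps)
  also have "\<dots> = (\<integral>x. L\<^sup>2 * (f x)\<^sup>2 - (2 * L * m) * f x \<partial>?M) + (\<integral>x. m\<^sup>2 \<partial>?M)"
    using i by (intro Bochner_Integration.integral_add) auto
  also have "(\<integral>x. m\<^sup>2 \<partial>?M) = L * m\<^sup>2"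
    using integral_ivl_const[OF assms(1)] by (simp add: L_def)
  also have "(\<integral>x. L\<^sup>2 * (f x)\<^sup>2 - (2 * L * m) * f x \<partial>?M) = L\<^sup>2 * (\<integral>x. (f x)\<^sup>2 \<partial>?M) - (2 * L * m) * m"
    using i by (simp add: m_def)
  finally have "L * m\<^sup>2 \<le> L * (L * (\<integral>x. (f x)\<^sup>2 \<partial>?M))"
    by (simp add: power2_eq_square algebra_simps)
  with L show ?thesis by (simp add: m_def L_def)
qed

lemma meas_QT_measurable:
  assumes "meas_QT T u"
  shows "(\<lambda>(t, x). u t x) \<in> borel_measurable (ivl_measure 0 T \<Otimes>\<^sub>M ivl_measure 0 1)"
    and "(\<lambda>(x, t). u t x) \<in> borel_measurable (ivl_measure 0 1 \<Otimes>\<^sub>M ivl_measure 0 T)"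
proof -
  let ?N = "ivl_measure 0 T" and ?M = "ivl_measure 0 1"
  have "(\<lambda>z. indicator ({0<..<T} \<times> {0<..<1}) z *\<^sub>R (case z of (t, x) \<Rightarrow> u t x)) \<in> borel_measurable lborel"
    using assms by (simp add: meas_QT_def set_borel_measurable_def)
  then have 1: "(\<lambda>z. indicator ({0<..<T} \<times> {0<..<1}) z *\<^sub>R (case z of (t, x) \<Rightarrow> u t x)) \<in> borel_measurable borel"
    by simp
  have id: "(\<lambda>z. (fst z, snd z)) \<in> borel_measurable (?N \<Otimes>\<^sub>M ?M)"
    by (intro borel_measurable_Pair measurable_compose[OF measurable_fst measurable_ivl_borel]
        measurable_compose[OF measurable_snd measurable_ivl_borel])
  have "(\<lambda>z. indicator ({0<..<T} \<times> {0<..<1}) (fst z, snd z) *\<^sub>R (case (fst z, snd z) of (t, x) \<Rightarrow> u t x))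
      \<in> borel_measurable (?N \<Otimes>\<^sub>M ?M)"
    using measurable_compose[OF id 1] .
  then show *: "(\<lambda>(t, x). u t x) \<in> borel_measurable (?N \<Otimes>\<^sub>M ?M)"
    by (rule measurable_cong[THEN iffD1, rotated]) (auto simp: space_pair_measure)
  show "(\<lambda>(x, t). u t x) \<in> borel_measurable (?M \<Otimes>\<^sub>M ?N)"
    using measurable_compose[OF measurable_pair_swap' *] by (simp add: case_prod_beta')
qed

lemma Linf_L2E:
  assumes "W \<in> Linf_L2 T"
  obtains C where "meas_QT T W" "AE t in ivl_measure 0 T. W t \<in> L2 0 1 \<and> L2_norm 0 1 (W t) \<le> C"
  using assms unfolding Linf_L2_def AE_ivl by blast

lemma Linf_L2_AE:
  assumes "W \<in> Linf_L2 T"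
  shows "AE t in ivl_measure 0 T. W t \<in> L2 0 1"
proof -
  from assms obtain C where "AE t in ivl_measure 0 T. W t \<in> L2 0 1 \<and> L2_norm 0 1 (W t) \<le> C"
    by (rule Linf_L2E)
  then show ?thesis by eventually_elim simp
qed

lemma Linf_L2_mono:
  assumes "W \<in> Linf_L2 T" "t \<le> T"
  shows "W \<in> Linf_L2 t"
proof -
  have "meas_QT t W"
    unfolding meas_QT_def
    by (rule set_borel_measurable_subset[where A = "{0<..<T} \<times> {0<..<1}"])
      (use assms in \<open>auto simp: Linf_L2_def meas_QT_def intro!: borel_open open_Times\<close>)
  moreover from assms obtain C where "AE t\<in>{0<..<T} in lborel. W t \<in> L2 0 1 \<and> L2_norm 0 1 (W t) \<le> C"
    by (auto simp: Linf_L2_def)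
  then have "AE s\<in>{0<..<t} in lborel. W s \<in> L2 0 1 \<and> L2_norm 0 1 (W s) \<le> C"
    by eventually_elim (use assms(2) in auto)
  ultimately show ?thesis by (auto simp: Linf_L2_def)
qed

lemma Linf_L2_integrable_square:
  assumes "W \<in> Linf_L2 T"
  shows "integrable (ivl_measure 0 1 \<Otimes>\<^sub>M ivl_measure 0 T) (\<lambda>(x, t). (W t x)\<^sup>2)"
proof -
  let ?N = "ivl_measure 0 T" and ?M = "ivl_measure 0 1"
  interpret NM: pair_sigma_finite ?N ?M by (rule pair_sigma_finite_ivl)
  from assms obtain C where C: "AE t in ?N. W t \<in> L2 0 1 \<and> L2_norm 0 1 (W t) \<le> C"
    by (rule Linf_L2E)
  have [measurable]: "(\<lambda>(t, x). W t x) \<in> borel_measurable (?N \<Otimes>\<^sub>M ?M)"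
    using assms by (intro meas_QT_measurable) (simp add: Linf_L2_def)
  then have m2: "(\<lambda>(t, x). (W t x)\<^sup>2) \<in> borel_measurable (?N \<Otimes>\<^sub>M ?M)"
    by (simp add: case_prod_beta')
  have "integrable (?N \<Otimes>\<^sub>M ?M) (\<lambda>(t, x). (W t x)\<^sup>2)"
  proof (rule NM.Fubini_integrable[OF m2])
    show "AE t in ?N. integrable ?M (\<lambda>x. case (t, x) of (t, x) \<Rightarrow> (W t x)\<^sup>2)"
      using C by eventually_elim (simp add: L2_integrable_square)
    show "integrable ?N (\<lambda>t. \<integral>x. norm (case (t, x) of (t, x) \<Rightarrow> (W t x)\<^sup>2) \<partial>?M)"
    proof (rule Bochner_Integration.integrable_bound[OF integrable_ivl_const[of 0 T "C\<^sup>2"]])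
      show "(\<lambda>t. \<integral>x. norm (case (t, x) of (t, x) \<Rightarrow> (W t x)\<^sup>2) \<partial>?M) \<in> borel_measurable ?N"
        using m2 by (intro NM.M2.borel_measurable_lebesgue_integral) simp
      show "AE t in ?N. norm (\<integral>x. norm (case (t, x) of (t, x) \<Rightarrow> (W t x)\<^sup>2) \<partial>?M) \<le> norm (C\<^sup>2)"
        using C
      proof eventually_elim
        case (elim t)
        have "(\<integral>x. (W t x)\<^sup>2 \<partial>?M) = (L2_norm 0 1 (W t))\<^sup>2" by (simp add: L2_norm_square)
        also have "\<dots> \<le> C\<^sup>2"
          using elim by (intro power_mono) (auto simp: L2_norm_def set_integral_ivl)
        finally show ?case by simp
      qed
    qed
  qed
  from NM.integrable_product_swap[OF this] show ?thesis by simp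
qed

lemma Linf_L2_integrable_weighted:
  assumes W: "W \<in> Linf_L2 T" and "smooth \<phi>" "smooth \<psi>"
  shows "integrable (ivl_measure 0 1 \<Otimes>\<^sub>M ivl_measure 0 T) (\<lambda>(x, t). W t x * (\<phi> x * \<psi> t))"
proof -
  let ?N = "ivl_measure 0 T" and ?M = "ivl_measure 0 1"
  interpret pair_sigma_finite ?M ?N by (rule pair_sigma_finite_ivl)
  have [measurable]: "(\<lambda>(x, t). W t x) \<in> borel_measurable (?M \<Otimes>\<^sub>M ?N)"
    using W by (intro meas_QT_measurable) (simp add: Linf_L2_def)
  have [measurable]: "\<phi> \<in> borel_measurable ?M" "\<psi> \<in> borel_measurable ?N"
    using assms by (auto intro: smooth_measurable)
  obtain C where C: "\<And>x. x \<in> {0<..<1} \<Longrightarrow> \<bar>\<phi> x\<bar> \<le> C"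
    using smooth_bounded[OF assms(2)] by blast
  obtain D where D: "\<And>t. t \<in> {0<..<T} \<Longrightarrow> \<bar>\<psi> t\<bar> \<le> D"
    using smooth_bounded[OF assms(3)] by blast
  have one: "integrable (?M \<Otimes>\<^sub>M ?N) (\<lambda>(x, t). 1 :: real)"
    by (rule Fubini_integrable) (auto intro: integrable_ivl_const)
  show ?thesis
  proof (rule Bochner_Integration.integrable_bound)
    show "integrable (?M \<Otimes>\<^sub>M ?N) (\<lambda>(x, t). (W t x)\<^sup>2 + (C * D)\<^sup>2)"
      using Bochner_Integration.integrable_add[OF Linf_L2_integrable_square[OF W]
          integrable_mult_right[OF one, of "(C * D)\<^sup>2"]]
      by (simp add: case_prod_beta')
    have "(\<lambda>z. W (snd z) (fst z) * (\<phi> (fst z) * \<psi> (snd z))) \<in> borel_measurable (?M \<Otimes>\<^sub>M ?N)"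
      by measurable
    then show "(\<lambda>(x, t). W t x * (\<phi> x * \<psi> t)) \<in> borel_measurable (?M \<Otimes>\<^sub>M ?N)"
      by (simp add: case_prod_beta')
    show "AE z in ?M \<Otimes>\<^sub>M ?N. norm (case z of (x, t) \<Rightarrow> W t x * (\<phi> x * \<psi> t))
        \<le> norm (case z of (x, t) \<Rightarrow> (W t x)\<^sup>2 + (C * D)\<^sup>2)"
    proof (rule AE_I2)
      fix z assume "z \<in> space (?M \<Otimes>\<^sub>M ?N)"
      then obtain x t where z: "z = (x, t)" "x \<in> {0<..<1}" "t \<in> {0<..<T}"
        by (auto simp: space_pair_measure)
      have "\<bar>\<phi> x\<bar> * \<bar>\<psi> t\<bar> \<le> C * D"
        using C[OF z(2)] D[OF z(3)] by (intro mult_mono) auto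
      then have "\<bar>W t x\<bar> * (\<bar>\<phi> x\<bar> * \<bar>\<psi> t\<bar>) \<le> \<bar>W t x\<bar> * (C * D)"
        by (intro mult_left_mono) auto
      also have "\<dots> \<le> (W t x)\<^sup>2 + (C * D)\<^sup>2"
      proof -
        have "2 * (\<bar>W t x\<bar> * (C * D)) \<le> (W t x)\<^sup>2 + (C * D)\<^sup>2"
          using sum_squares_bound[of "\<bar>W t x\<bar>" "C * D"] by (simp add: mult.assoc)
        moreover have "0 \<le> \<bar>W t x\<bar> * (C * D)"
          using order_trans[OF _ \<open>\<bar>\<phi> x\<bar> * \<bar>\<psi> t\<bar> \<le> C * D\<close>, of 0]
          by (intro mult_nonneg_nonneg[of "\<bar>W t x\<bar>" "C * D"]) simp_all
        ultimately show ?thesis by linarith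
      qed
      finally show "norm (case z of (x, t) \<Rightarrow> W t x * (\<phi> x * \<psi> t))
          \<le> norm (case z of (x, t) \<Rightarrow> (W t x)\<^sup>2 + (C * D)\<^sup>2)"
        by (simp add: z(1) abs_mult)
    qed
  qed
qed

text \<open>The weight \<psi> in time is there for testing distributional time derivatives; \<psi> =
  1 gives the plain exchange of the two integrals.\<close>

lemma Linf_L2_Fubini:
  assumes W: "W \<in> Linf_L2 T" and sm: "smooth \<phi>" "smooth \<psi>"
  shows "integrable (ivl_measure 0 T) (\<lambda>t. L2_inner (W t) \<phi> * \<psi> t)"
    and "integrable (ivl_measure 0 1) (\<lambda>x. \<phi> x * (\<integral>t. W t x * \<psi> t \<partial>ivl_measure 0 T))"
    and "(\<integral>t. L2_inner (W t) \<phi> * \<psi> t \<partial>ivl_measure 0 T) =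
      (\<integral>x. \<phi> x * (\<integral>t. W t x * \<psi> t \<partial>ivl_measure 0 T) \<partial>ivl_measure 0 1)"
proof -
  let ?N = "ivl_measure 0 T" and ?M = "ivl_measure 0 1"
  interpret pair_sigma_finite ?M ?N by (rule pair_sigma_finite_ivl)
  note I = Linf_L2_integrable_weighted[OF W sm]
  have x: "(\<integral>t. W t x * (\<phi> x * \<psi> t) \<partial>?N) = \<phi> x * (\<integral>t. W t x * \<psi> t \<partial>?N)" for x
    by (simp only: mult.left_commute[of "W _ _"] integral_mult_right_zero)
  have t: "(\<integral>x. W t x * (\<phi> x * \<psi> t) \<partial>?M) = L2_inner (W t) \<phi> * \<psi> t" for t
    unfolding L2_inner_def by (simp only: mult.assoc[symmetric] integral_mult_left_zero)
  show "integrable ?N (\<lambda>t. L2_inner (W t) \<phi> * \<psi> t)"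
    using integrable_snd[OF I] by (simp add: t)
  show "integrable ?M (\<lambda>x. \<phi> x * (\<integral>t. W t x * \<psi> t \<partial>?N))"
    using integrable_fst[OF I] by (simp add: x)
  show "(\<integral>t. L2_inner (W t) \<phi> * \<psi> t \<partial>?N) = (\<integral>x. \<phi> x * (\<integral>t. W t x * \<psi> t \<partial>?N) \<partial>?M)"
    using Fubini_integral[OF I] by (simp add: t x)
qed

text \<open>For fixed \<open>t\<close> the difference of both sides is orthogonal to every test
  function of \<open>x\<close>, so an identity of functions reduces to scalar identities. The
  primitives of \<open>u'\<close>, of \<open>u_tt\<close> and of the x-derivative of
  \<open>u'\<close> are all obtained in this form.\<close>

lemma time_primI:
  assumes W: "W \<in> Linf_L2 T" and V: "\<And>t. t \<in> {0..T} \<Longrightarrow> V t \<in> L2 0 1"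
    and dual: "\<And>t \<phi>. t \<in> {0..T} \<Longrightarrow> \<phi> \<in> test_fun 0 1 \<Longrightarrow>
      L2_inner (V t) \<phi> = L2_inner (V 0) \<phi> + (\<integral>s. L2_inner (W s) \<phi> \<partial>ivl_measure 0 t)"
  shows "time_prim T V W"
  unfolding time_prim_def
proof (intro conjI ballI W V)
  fix t assume t: "t \<in> {0..T}"
  let ?M = "ivl_measure 0 1" and ?P = "\<lambda>x. \<integral>s. W s x \<partial>ivl_measure 0 t"
  have Wt: "W \<in> Linf_L2 t" using Linf_L2_mono[OF W] t by simp
  have P: "integrable ?M ?P"
    using Linf_L2_Fubini(2)[OF Wt smooth_const[of 1] smooth_const[of 1]] by simp
  have V0: "V 0 \<in> L2 0 1" "V t \<in> L2 0 1" using V[of 0] V[OF t] t by simp_all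
  have "AE x in ?M. V t x - V 0 x - ?P x = 0"
  proof (rule test_fun_orthogonal_imp_zero)
    show "integrable ?M (\<lambda>x. V t x - V 0 x - ?P x)"
      using P V0[THEN L2_integrable] by simp
    fix \<phi> assume \<phi>: "\<phi> \<in> test_fun 0 1"
    note sm = test_fun_smooth[OF \<phi>]
    have i: "integrable ?M (\<lambda>x. V t x * \<phi> x)" "integrable ?M (\<lambda>x. V 0 x * \<phi> x)" "integrable ?M (\<lambda>x. ?P x * \<phi> x)"
      using P V0[THEN L2_integrable] sm by (auto intro: integrable_mult_smooth)
    have "(\<integral>s. L2_inner (W s) \<phi> \<partial>ivl_measure 0 t) = (\<integral>x. ?P x * \<phi> x \<partial>?M)"
      using Linf_L2_Fubini(3)[OF Wt sm smooth_const[of 1]] by (simp add: mult.commute)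
    with dual[OF t \<phi>] show "(\<integral>x. (V t x - V 0 x - ?P x) * \<phi> x \<partial>?M) = 0"
      using i by (simp add: L2_inner_def left_diff_distrib)
  qed
  then show "AE x in ?M. V t x = V 0 x + ?P x"
    by eventually_elim simp
qed

section \<open>Calculus of absolutely continuous functions and a Gronwall estimate\<close>

lemma ac_onD:
  assumes "ac_on T F G"
  shows "integrable (ivl_measure 0 T) G"
    and "t \<in> {0..T} \<Longrightarrow> F t = F 0 + (\<integral>s. G s \<partial>ivl_measure 0 t)"
  using assms unfolding ac_on_def by blast+

lemma ac_on_add:
  assumes "ac_on T F G" "ac_on T F' G'"
  shows "ac_on T (\<lambda>t. F t + F' t) (\<lambda>t. G t + G' t)"
  unfolding ac_on_def
proof (intro conjI ballI)
  note i = ac_onD(1)[OF assms(1)] ac_onD(1)[OF assms(2)]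
  show "integrable (ivl_measure 0 T) (\<lambda>t. G t + G' t)" using i by simp
  fix t assume t: "t \<in> {0..T}"
  then have "integrable (ivl_measure 0 t) G" "integrable (ivl_measure 0 t) G'"
    by (auto intro: integrable_ivl_subset[OF i(1)] integrable_ivl_subset[OF i(2)])
  then show "F t + F' t = F 0 + F' 0 + (\<integral>s. G s + G' s \<partial>ivl_measure 0 t)"
    using ac_onD(2)[OF assms(1) t] ac_onD(2)[OF assms(2) t] by simp
qed

lemma ac_on_cmult:
  assumes "ac_on T F G"
  shows "ac_on T (\<lambda>t. c * F t) (\<lambda>t. c * G t)"
  unfolding ac_on_def
proof (intro conjI ballI)
  show "integrable (ivl_measure 0 T) (\<lambda>t. c * G t)" using ac_onD(1)[OF assms] by simp
  fix t assume t: "t \<in> {0..T}"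
  show "c * F t = c * F 0 + (\<integral>s. c * G s \<partial>ivl_measure 0 t)"
    using ac_onD(2)[OF assms t] by (simp add: distrib_left)
qed

lemma ac_on_mult:
  assumes "ac_on T F G" "ac_on T F' G'"
  shows "ac_on T (\<lambda>t. F t * F' t) (\<lambda>t. F t * G' t + F' t * G t)"
proof -
  let ?D = "\<lambda>t. F t * G' t + F' t * G t"
  have *: "integrable (ivl_measure 0 t) ?D \<and> F t * F' t = F 0 * F' 0 + (\<integral>s. ?D s \<partial>ivl_measure 0 t)"
    if t: "t \<in> {0..T}" for t
  proof -
    let ?M = "ivl_measure 0 t"
    have i: "integrable ?M G" "integrable ?M G'"
      using t by (auto intro: integrable_ivl_subset[OF ac_onD(1)[OF assms(1)]] integrable_ivl_subset[OF ac_onD(1)[OF assms(2)]])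
    note P = ivl_integral_mult[OF i]
    let ?E = "\<lambda>s. (F 0 * G' s + F' 0 * G s) +
      (G s * (\<integral>r. G' r \<partial>ivl_measure 0 s) + G' s * (\<integral>r. G r \<partial>ivl_measure 0 s))"
    have eq: "?D s = ?E s" if "s \<in> space ?M" for s
    proof -
      have "s \<in> {0..T}" using that t by auto
      from ac_onD(2)[OF assms(1) this] ac_onD(2)[OF assms(2) this] show ?thesis
        by (simp add: algebra_simps)
    qed
    have "integrable ?M ?E" using i P by simp
    then have "integrable ?M ?D"
      by (subst Bochner_Integration.integrable_cong[OF refl eq])
    moreover have "(\<integral>s. ?D s \<partial>?M) = (\<integral>s. ?E s \<partial>?M)"
      by (rule Bochner_Integration.integral_cong[OF refl eq])
    moreover have "(\<integral>s. ?E s \<partial>?M) = (\<integral>s. F 0 * G' s + F' 0 * G s \<partial>?M) +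
      (\<integral>s. G s \<partial>?M) * (\<integral>s. G' s \<partial>?M)"
      unfolding P(3) using i P by (intro Bochner_Integration.integral_add) auto
    moreover have "(\<integral>s. F 0 * G' s + F' 0 * G s \<partial>?M) = F 0 * (\<integral>s. G' s \<partial>?M) + F' 0 * (\<integral>s. G s \<partial>?M)"
      using i by simp
    ultimately show ?thesis
      using ac_onD(2)[OF assms(1) t] ac_onD(2)[OF assms(2) t] by (simp add: algebra_simps)
  qed
  show ?thesis
  proof (cases "0 \<le> T")
    case True
    then have TT: "T \<in> {0..T}" by simp
    show ?thesis
      unfolding ac_on_def
      by (intro conjI ballI, rule conjunct1[OF *[OF TT]], erule conjunct2[OF *])
  next
    case False
    have "integrable (ivl_measure 0 T) ?D"
      by (rule Bochner_Integration.integrable_cong[OF refl, THEN iffD2, OF _ integrable_ivl_const[of 0 T 0]])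
        (use False in auto)
    with False show ?thesis unfolding ac_on_def by simp
  qed
qed

lemma ac_on_C1:
  assumes "\<And>x. (F has_real_derivative f x) (at x)" "continuous_on {0..T} f"
  shows "ac_on T F f"
  unfolding ac_on_def
proof (intro conjI ballI)
  show "integrable (ivl_measure 0 T) f" using assms(2) by (rule continuous_ivl_integrable)
  fix t assume t: "t \<in> {0..T}"
  have "continuous_on {0..t} f" using assms(2) t by (auto intro: continuous_on_subset)
  then have "(\<integral>s. f s \<partial>ivl_measure 0 t) = F t - F 0"
    using t assms(1) by (intro ivl_integral_FTC) (auto intro: has_field_derivative_at_within)
  then show "F t = F 0 + (\<integral>s. f s \<partial>ivl_measure 0 t)" by simp
qed

text \<open>The integrating factor is exp(c t). Giving up half of the decay rate of the forcing
  avoids resonance: since \<sigma> \<ge> 2 c, the forcing times exp(c t) is still at most k exp(-c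
  t), whose integral is at most k/c for every T.\<close>

lemma ac_on_gronwall:
  assumes T: "0 \<le> T" and L: "ac_on T L G" and c: "0 < c" and \<sigma>: "2 * c \<le> \<sigma>" and k: "0 \<le> k"
    and le: "AE t in ivl_measure 0 T. G t \<le> - c * L t + k * exp (- \<sigma> * t)"
  shows "L T \<le> exp (- c * T) * (L 0 + k / c)"
proof -
  let ?M = "ivl_measure 0 T"
  have "ac_on T (\<lambda>t. exp (c * t)) (\<lambda>t. c * exp (c * t))"
    by (rule ac_on_C1) (auto intro!: derivative_eq_intros continuous_intros)
  note A = ac_on_mult[OF L this]
  define e where "e t = k * exp (- c * t)" for t
  have e: "integrable ?M e" "(\<integral>t. e t \<partial>?M) = (- k / c * exp (- c * T)) - (- k / c * exp (- c * 0))"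
  proof -
    have D: "((\<lambda>t. - k / c * exp (- c * t)) has_real_derivative e t) (at t within {0..T})" for t
      unfolding e_def using c by (auto intro!: derivative_eq_intros)
    have C: "continuous_on {0..T} e" unfolding e_def by (intro continuous_intros)
    show "integrable ?M e" "(\<integral>t. e t \<partial>?M) = (- k / c * exp (- c * T)) - (- k / c * exp (- c * 0))"
      using ivl_integral_FTC[OF T D C] by auto
  qed
  have "L T * exp (c * T) = L 0 * exp (c * 0) + (\<integral>t. L t * (c * exp (c * t)) + exp (c * t) * G t \<partial>?M)"
    using ac_onD(2)[OF A, of T] T by simp
  also have "(\<integral>t. L t * (c * exp (c * t)) + exp (c * t) * G t \<partial>?M) \<le> (\<integral>t. e t \<partial>?M)"
  proof (rule integral_mono_AE[OF ac_onD(1)[OF A] e(1)])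
    have "AE t in ?M. t \<in> space ?M" by (rule AE_space)
    with le show "AE t in ?M. L t * (c * exp (c * t)) + exp (c * t) * G t \<le> e t"
    proof eventually_elim
      case (elim t)
      then have t: "0 < t" by simp
      have "exp (c * t) * G t \<le> exp (c * t) * (- c * L t + k * exp (- \<sigma> * t))"
        using elim by (intro mult_left_mono) auto
      also have "\<dots> = - (L t * (c * exp (c * t))) + k * exp (c * t - \<sigma> * t)"
        by (simp add: distrib_left exp_diff exp_minus field_simps)
      also have "k * exp (c * t - \<sigma> * t) \<le> k * exp (- c * t)"
      proof -
        have "2 * c * t \<le> \<sigma> * t" using \<sigma> t by (intro mult_right_mono) auto
        then show ?thesis using k by (intro mult_left_mono) auto
      qed
      finally show ?case by (simp add: e_def)
    qed
  qed
  also have "(\<integral>t. e t \<partial>?M) \<le> k / c"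
    unfolding e(2) using c k by simp
  finally have "L T * exp (c * T) \<le> L 0 + k / c" by simp
  then have "(L T * exp (c * T)) * exp (- c * T) \<le> (L 0 + k / c) * exp (- c * T)"
    by (intro mult_right_mono) auto
  moreover have "(L T * exp (c * T)) * exp (- c * T) = L T * exp (c * T + - c * T)"
    by (simp only: exp_add mult.assoc)
  moreover have "c * T + - c * T = 0" by simp
  ultimately show ?thesis by (simp only: exp_zero mult_1_right mult.commute)
qed

lemma time_prim_mono:
  assumes "time_prim T A W" "t \<le> T"
  shows "time_prim t A W"
  using assms Linf_L2_mono[of W T t] unfolding time_prim_def by auto

section \<open>Inner products of two primitives in time\<close>

text \<open>The version of \<open>A\<close> to which Fubini applies: for each time it equals
  \<open>A t\<close> almost everywhere in \<open>x\<close>, it is jointly measurable, and in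
  \<open>t\<close> it is an explicit primitive.\<close>

definition prim :: "(real \<Rightarrow> real) \<Rightarrow> (real \<Rightarrow> real \<Rightarrow> real) \<Rightarrow> real \<Rightarrow> real \<Rightarrow> real" where
  "prim a W t x = a x + (\<integral>s. W s x \<partial>ivl_measure 0 t)"

text \<open>Only the initial values of the two functions enter. One and the same density therefore
  serves every upper endpoint, as absolute continuity demands.\<close>

definition inner_rate ::
    "(real \<Rightarrow> real) \<Rightarrow> (real \<Rightarrow> real \<Rightarrow> real) \<Rightarrow> (real \<Rightarrow> real) \<Rightarrow> (real \<Rightarrow> real \<Rightarrow> real) \<Rightarrow> real \<Rightarrow> real" where
  "inner_rate a W b W' t = (\<integral>x. prim a W t x * W' t x + prim b W' t x * W t x \<partial>ivl_measure 0 1)"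

lemma prim_measurable:
  assumes a: "a \<in> borel_measurable (ivl_measure 0 1)" and W: "W \<in> Linf_L2 T"
  shows "(\<lambda>(x, t). prim a W t x) \<in> borel_measurable (ivl_measure 0 1 \<Otimes>\<^sub>M ivl_measure 0 T)"
proof -
  let ?N = "ivl_measure 0 T" and ?M = "ivl_measure 0 1"
  interpret N: sigma_finite_measure ?N by (rule sigma_finite_ivl)
  have W': "(\<lambda>(x, t). W t x) \<in> borel_measurable (?M \<Otimes>\<^sub>M ?N)"
    using W by (intro meas_QT_measurable) (simp add: Linf_L2_def)
  have ms: "(\<lambda>w. (fst (fst w), snd w)) \<in> measurable ((?M \<Otimes>\<^sub>M ?N) \<Otimes>\<^sub>M ?N) (?M \<Otimes>\<^sub>M ?N)"
    by measurable
  have Wm: "(\<lambda>w. W (snd w) (fst (fst w))) \<in> borel_measurable ((?M \<Otimes>\<^sub>M ?N) \<Otimes>\<^sub>M ?N)"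
    using measurable_compose[OF ms W'] by (simp add: case_prod_beta')
  note [measurable] = measurable_ivl_borel[of 0 T]
  have im: "(\<lambda>w. if snd w < snd (fst w) then 1 else 0 :: real) \<in> borel_measurable ((?M \<Otimes>\<^sub>M ?N) \<Otimes>\<^sub>M ?N)"
    by measurable
  have "(\<lambda>(z, s). indicator {..<snd z} s * W s (fst z)) \<in> borel_measurable ((?M \<Otimes>\<^sub>M ?N) \<Otimes>\<^sub>M ?N)"
    using borel_measurable_times[OF im Wm] by (simp add: case_prod_beta' indicator_def of_bool_def)
  then have "(\<lambda>z. \<integral>s. indicator {..<snd z} s * W s (fst z) \<partial>?N) \<in> borel_measurable (?M \<Otimes>\<^sub>M ?N)"
    by (rule N.borel_measurable_lebesgue_integral)
  moreover have "(\<lambda>z. a (fst z)) \<in> borel_measurable (?M \<Otimes>\<^sub>M ?N)"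
    using a by measurable
  ultimately have "(\<lambda>z. a (fst z) + (\<integral>s. indicator {..<snd z} s * W s (fst z) \<partial>?N)) \<in> borel_measurable (?M \<Otimes>\<^sub>M ?N)"
    by (rule borel_measurable_add[rotated])
  then show ?thesis
  proof (rule measurable_cong[THEN iffD1, rotated])
    fix z assume "z \<in> space (?M \<Otimes>\<^sub>M ?N)"
    then have "snd z \<le> T" by (auto simp: space_pair_measure)
    then show "a (fst z) + (\<integral>s. indicator {..<snd z} s * W s (fst z) \<partial>?N) = (case z of (x, t) \<Rightarrow> prim a W t x)"
      using integral_ivl_mono_end[of "snd z" T 0 "\<lambda>s. W s (fst z)"] by (simp add: prim_def case_prod_beta')
  qed
qed

lemma Linf_L2_AE_section:
  assumes "W \<in> Linf_L2 T"
  shows "AE x in ivl_measure 0 1. (\<lambda>t. W t x) \<in> L2 0 T"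
proof -
  let ?N = "ivl_measure 0 T" and ?M = "ivl_measure 0 1"
  interpret pair_sigma_finite ?M ?N by (rule pair_sigma_finite_ivl)
  have W: "(\<lambda>(x, t). W t x) \<in> borel_measurable (?M \<Otimes>\<^sub>M ?N)"
    using assms by (intro meas_QT_measurable) (simp add: Linf_L2_def)
  have "AE x in ?M. x \<in> space ?M" by (rule AE_space)
  with AE_integrable_fst'[OF Linf_L2_integrable_square[OF assms]] show ?thesis
  proof eventually_elim
    case (elim x)
    have "(\<lambda>t. W t x) \<in> borel_measurable ?N"
      using measurable_compose[OF measurable_Pair1'[OF elim(2)] W] by simp
    with elim(1) show ?case by (simp add: L2_iff)
  qed
qed

lemma abs_ivl_integral_le:
  fixes f :: "real \<Rightarrow> real"
  assumes "integrable (ivl_measure a b) f" "t \<le> b"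
  shows "\<bar>\<integral>s. f s \<partial>ivl_measure a t\<bar> \<le> (\<integral>s. \<bar>f s\<bar> \<partial>ivl_measure a b)"
proof -
  have m: "(\<lambda>s. indicator {..<t} s * f s) \<in> borel_measurable (ivl_measure a b)"
    using assms(1) by (intro borel_measurable_times borel_measurable_indicator_ivl) auto
  have i: "integrable (ivl_measure a b) (\<lambda>s. indicator {..<t} s * f s)"
    by (rule Bochner_Integration.integrable_bound[OF assms(1) m]) (auto simp: indicator_def)
  have "\<bar>\<integral>s. f s \<partial>ivl_measure a t\<bar> \<le> (\<integral>s. \<bar>indicator {..<t} s * f s\<bar> \<partial>ivl_measure a b)"
    unfolding integral_ivl_mono_end[OF assms(2)]
    using integral_norm_bound[of "ivl_measure a b" "\<lambda>s. indicator {..<t} s * f s"] by simp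
  also have "\<dots> \<le> (\<integral>s. \<bar>f s\<bar> \<partial>ivl_measure a b)"
    by (rule integral_mono) (use i assms(1) in \<open>auto simp: indicator_def\<close>)
  finally show ?thesis .
qed

text \<open>For almost every \<open>x\<close> the sections in time are square integrable, and the
  product rule for primitives applies to them. Integrating over \<open>x\<close> and exchanging the
  integrals gives the claim, once the integrand is dominated on the rectangle.\<close>

lemma inner_rate_endpoint:
  assumes T: "0 \<le> T" and A: "time_prim T A W" and B: "time_prim T B W'"
  shows "integrable (ivl_measure 0 T) (inner_rate (A 0) W (B 0) W')"
    and "L2_inner (A T) (B T) = L2_inner (A 0) (B 0) + (\<integral>t. inner_rate (A 0) W (B 0) W' t \<partial>ivl_measure 0 T)"
proof -
  let ?N = "ivl_measure 0 T" and ?M = "ivl_measure 0 1"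
  interpret pair_sigma_finite ?M ?N by (rule pair_sigma_finite_ivl)
  have W: "W \<in> Linf_L2 T" "W' \<in> Linf_L2 T" using A B by (auto simp: time_prim_def)
  have L: "A 0 \<in> L2 0 1" "A T \<in> L2 0 1" "B 0 \<in> L2 0 1" "B T \<in> L2 0 1"
    using A B T by (auto simp: time_prim_def)
  have ends: "AE x in ?M. A T x = A 0 x + (\<integral>s. W s x \<partial>?N)" "AE x in ?M. B T x = B 0 x + (\<integral>s. W' s x \<partial>?N)"
    using A B T by (auto simp: time_prim_def)
  have [measurable]: "(\<lambda>(x, t). W t x) \<in> borel_measurable (?M \<Otimes>\<^sub>M ?N)"
    "(\<lambda>(x, t). W' t x) \<in> borel_measurable (?M \<Otimes>\<^sub>M ?N)"
    "(\<lambda>(x, t). prim (A 0) W t x) \<in> borel_measurable (?M \<Otimes>\<^sub>M ?N)"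
    "(\<lambda>(x, t). prim (B 0) W' t x) \<in> borel_measurable (?M \<Otimes>\<^sub>M ?N)"
    using W by (auto intro!: prim_measurable L2_measurable L meas_QT_measurable(2)[of _ W] meas_QT_measurable(2)[of _ W'] elim: Linf_L2E)
  define H where "H x t = prim (A 0) W t x * W' t x + prim (B 0) W' t x * W t x" for x t
  have "(\<lambda>z. prim (A 0) W (snd z) (fst z) * W' (snd z) (fst z) + prim (B 0) W' (snd z) (fst z) * W (snd z) (fst z))
      \<in> borel_measurable (?M \<Otimes>\<^sub>M ?N)"
    by measurable
  then have Hm: "(\<lambda>(x, t). H x t) \<in> borel_measurable (?M \<Otimes>\<^sub>M ?N)"
    by (simp add: H_def case_prod_beta')
  \<comment> \<open>Bound for the time integral of the absolute value of \<open>H x\<close>. It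
    comes from estimating each primitive by its initial value plus the integral I of the absolute
    value of its density, and from I^2 \<le> T times the integral of the squared density.\<close>
  define R where "R x = (A 0 x)\<^sup>2 + (B 0 x)\<^sup>2 + 2 * (T * (\<integral>t. (W t x)\<^sup>2 \<partial>?N)) + 2 * (T * (\<integral>t. (W' t x)\<^sup>2 \<partial>?N))" for x
  have R: "integrable ?M R"
    unfolding R_def[abs_def]
    using integrable_fst'[OF Linf_L2_integrable_square[OF W(1)]] integrable_fst'[OF Linf_L2_integrable_square[OF W(2)]] L
    by (auto simp: L2_integrable_square)
  have key: "AE x in ?M. integrable ?N (H x) \<and>
      (\<integral>t. H x t \<partial>?N) = (A 0 x + (\<integral>s. W s x \<partial>?N)) * (B 0 x + (\<integral>s. W' s x \<partial>?N)) - A 0 x * B 0 x \<and>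
      (\<integral>t. \<bar>H x t\<bar> \<partial>?N) \<le> R x"
    using Linf_L2_AE_section[OF W(1)] Linf_L2_AE_section[OF W(2)]
  proof eventually_elim
    case (elim x)
    define w where "w t = W t x" for t
    define w' where "w' t = W' t x" for t
    define a where "a = A 0 x"
    define b where "b = B 0 x"
    define I where "I = (\<integral>s. \<bar>w s\<bar> \<partial>?N)"
    define J where "J = (\<integral>s. \<bar>w' s\<bar> \<partial>?N)"
    have L2: "w \<in> L2 0 T" "w' \<in> L2 0 T" using elim by (auto simp: w_def[abs_def] w'_def[abs_def])
    note i = L2[THEN L2_integrable]
    note P = ivl_integral_mult[OF i]
    have H: "H x = (\<lambda>t. (a * w' t + b * w t) + (w t * (\<integral>s. w' s \<partial>ivl_measure 0 t) + w' t * (\<integral>s. w s \<partial>ivl_measure 0 t)))"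
      by (rule ext) (simp add: H_def prim_def w_def[abs_def] w'_def[abs_def] a_def b_def algebra_simps)
    have Hi: "integrable ?N (H x)" unfolding H using i P by simp
    have "(\<integral>t. H x t \<partial>?N) = (\<integral>t. a * w' t + b * w t \<partial>?N) + (\<integral>t. w t \<partial>?N) * (\<integral>t. w' t \<partial>?N)"
      unfolding H P(3) using i P by (intro Bochner_Integration.integral_add) auto
    also have "\<dots> = (a + (\<integral>t. w t \<partial>?N)) * (b + (\<integral>t. w' t \<partial>?N)) - a * b"
      using i by (simp add: algebra_simps)
    finally have Hint: "(\<integral>t. H x t \<partial>?N) = (a + (\<integral>t. w t \<partial>?N)) * (b + (\<integral>t. w' t \<partial>?N)) - a * b" .
    have nn: "0 \<le> I" "0 \<le> J" by (auto simp: I_def J_def)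
    have absL2: "(\<lambda>s. \<bar>w s\<bar>) \<in> L2 0 T" "(\<lambda>s. \<bar>w' s\<bar>) \<in> L2 0 T"
      using L2 by (auto simp: L2_iff)
    have IJ: "I\<^sup>2 \<le> T * (\<integral>t. (w t)\<^sup>2 \<partial>?N)" "J\<^sup>2 \<le> T * (\<integral>t. (w' t)\<^sup>2 \<partial>?N)"
      using ivl_integral_square_le[OF T absL2(1)] ivl_integral_square_le[OF T absL2(2)]
      by (simp_all add: I_def J_def)
    have "(\<integral>t. \<bar>H x t\<bar> \<partial>?N) \<le> (\<integral>t. (\<bar>a\<bar> + I) * \<bar>w' t\<bar> + (\<bar>b\<bar> + J) * \<bar>w t\<bar> \<partial>?N)"
    proof (rule integral_mono)
      fix t assume t: "t \<in> space ?N"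
      have 1: "\<bar>a + (\<integral>s. w s \<partial>ivl_measure 0 t)\<bar> \<le> \<bar>a\<bar> + I" "\<bar>b + (\<integral>s. w' s \<partial>ivl_measure 0 t)\<bar> \<le> \<bar>b\<bar> + J"
        using abs_ivl_integral_le[OF i(1), of t] abs_ivl_integral_le[OF i(2), of t] t
        by (auto simp: I_def J_def)
      have "\<bar>H x t\<bar> \<le> \<bar>(a + (\<integral>s. w s \<partial>ivl_measure 0 t)) * w' t\<bar> + \<bar>(b + (\<integral>s. w' s \<partial>ivl_measure 0 t)) * w t\<bar>"
        unfolding H by (rule order_trans[OF _ abs_triangle_ineq]) (simp add: algebra_simps)
      also have "\<dots> \<le> (\<bar>a\<bar> + I) * \<bar>w' t\<bar> + (\<bar>b\<bar> + J) * \<bar>w t\<bar>"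
        unfolding abs_mult using 1 by (intro add_mono mult_right_mono) auto
      finally show "\<bar>H x t\<bar> \<le> (\<bar>a\<bar> + I) * \<bar>w' t\<bar> + (\<bar>b\<bar> + J) * \<bar>w t\<bar>" .
    qed (use Hi i in auto)
    also have "\<dots> = (\<bar>a\<bar> + I) * J + (\<bar>b\<bar> + J) * I"
      using i by (simp add: I_def J_def)
    also have "\<dots> \<le> a\<^sup>2 + b\<^sup>2 + 2 * I\<^sup>2 + 2 * J\<^sup>2"
    proof -
      have "2 * (\<bar>a\<bar> * J) \<le> a\<^sup>2 + J\<^sup>2" "2 * (\<bar>b\<bar> * I) \<le> b\<^sup>2 + I\<^sup>2" "2 * (I * J) \<le> I\<^sup>2 + J\<^sup>2"
        using sum_squares_bound[of "\<bar>a\<bar>" J] sum_squares_bound[of "\<bar>b\<bar>" I] sum_squares_bound[of I J]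
        by (simp_all add: mult.assoc)
      moreover have "0 \<le> a\<^sup>2" "0 \<le> b\<^sup>2" "0 \<le> I\<^sup>2" "0 \<le> J\<^sup>2" by simp_all
      moreover have "(\<bar>a\<bar> + I) * J + (\<bar>b\<bar> + J) * I = \<bar>a\<bar> * J + \<bar>b\<bar> * I + 2 * (I * J)"
        by (simp add: algebra_simps)
      ultimately show ?thesis by linarith
    qed
    also have "\<dots> \<le> R x"
      using IJ by (simp add: R_def a_def b_def w_def w'_def)
    finally show ?case
      using Hi Hint by (simp add: a_def b_def w_def w'_def)
  qed
  have HI: "integrable (?M \<Otimes>\<^sub>M ?N) (\<lambda>(x, t). H x t)"
  proof (rule Fubini_integrable[OF Hm])
    show "AE x in ?M. integrable ?N (\<lambda>t. case (x, t) of (x, t) \<Rightarrow> H x t)"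
      using key by eventually_elim simp
    show "integrable ?M (\<lambda>x. \<integral>t. norm (case (x, t) of (x, t) \<Rightarrow> H x t) \<partial>?N)"
    proof (rule Bochner_Integration.integrable_bound[OF R])
      show "(\<lambda>x. \<integral>t. norm (case (x, t) of (x, t) \<Rightarrow> H x t) \<partial>?N) \<in> borel_measurable ?M"
        using Hm by (intro M2.borel_measurable_lebesgue_integral) (simp add: case_prod_beta')
      show "AE x in ?M. norm (\<integral>t. norm (case (x, t) of (x, t) \<Rightarrow> H x t) \<partial>?N) \<le> norm (R x)"
        using key by eventually_elim auto
    qed
  qed
  have rate: "inner_rate (A 0) W (B 0) W' t = (\<integral>x. H x t \<partial>?M)" for t
    by (simp add: inner_rate_def H_def)
  show "integrable ?N (inner_rate (A 0) W (B 0) W')"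
    using integrable_snd[OF HI] by (simp add: rate[abs_def])
  have "(\<integral>t. inner_rate (A 0) W (B 0) W' t \<partial>?N) = (\<integral>x. (\<integral>t. H x t \<partial>?N) \<partial>?M)"
    unfolding rate using Fubini_integral[OF HI] by simp
  also have "\<dots> = (\<integral>x. A T x * B T x - A 0 x * B 0 x \<partial>?M)"
  proof (rule integral_cong_AE)
    show "AE x in ?M. (\<integral>t. H x t \<partial>?N) = A T x * B T x - A 0 x * B 0 x"
      using key ends by eventually_elim simp
    show "(\<lambda>x. \<integral>t. H x t \<partial>?N) \<in> borel_measurable ?M"
      using integrable_fst[OF HI] by (rule borel_measurable_integrable)
    show "(\<lambda>x. A T x * B T x - A 0 x * B 0 x) \<in> borel_measurable ?M"
      using L by (intro borel_measurable_diff borel_measurable_times) (auto simp: L2_iff)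
  qed
  also have "\<dots> = L2_inner (A T) (B T) - L2_inner (A 0) (B 0)"
    using L by (simp add: L2_inner_def L2_integrable_mult)
  finally show "L2_inner (A T) (B T) = L2_inner (A 0) (B 0) + (\<integral>t. inner_rate (A 0) W (B 0) W' t \<partial>?N)"
    by simp
qed

lemma time_prim_inner:
  assumes T: "0 \<le> T" and A: "time_prim T A W" and B: "time_prim T B W'"
  obtains G where "ac_on T (\<lambda>t. L2_inner (A t) (B t)) G"
    "AE t in ivl_measure 0 T. G t = L2_inner (A t) (W' t) + L2_inner (W t) (B t)"
proof
  let ?N = "ivl_measure 0 T" and ?M = "ivl_measure 0 1"
  let ?G = "inner_rate (A 0) W (B 0) W'"
  show "ac_on T (\<lambda>t. L2_inner (A t) (B t)) ?G"
    unfolding ac_on_def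
  proof (intro conjI ballI)
    show "integrable ?N ?G" using assms by (rule inner_rate_endpoint)
    fix t assume "t \<in> {0..T}"
    then have t: "0 \<le> t" "t \<le> T" by auto
    show "L2_inner (A t) (B t) = L2_inner (A 0) (B 0) + (\<integral>s. ?G s \<partial>ivl_measure 0 t)"
      by (rule inner_rate_endpoint(2)[OF t(1) time_prim_mono[OF A t(2)] time_prim_mono[OF B t(2)]])
  qed
  have W: "W \<in> Linf_L2 T" "W' \<in> Linf_L2 T" using A B by (auto simp: time_prim_def)
  have "AE t in ?N. t \<in> space ?N" by (rule AE_space)
  with Linf_L2_AE[OF W(1)] Linf_L2_AE[OF W(2)]
  show "AE t in ?N. ?G t = L2_inner (A t) (W' t) + L2_inner (W t) (B t)"
  proof eventually_elim
    case (elim t)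
    then have t: "t \<in> {0..T}" by auto
    have L: "A t \<in> L2 0 1" "B t \<in> L2 0 1" "A 0 \<in> L2 0 1" "B 0 \<in> L2 0 1"
      using A B t by (auto simp: time_prim_def)
    have eq: "AE x in ?M. A t x = prim (A 0) W t x" "AE x in ?M. B t x = prim (B 0) W' t x"
      using A B t by (auto simp: time_prim_def prim_def)
    have pm: "(\<lambda>(x, t). prim (A 0) W t x) \<in> borel_measurable (?M \<Otimes>\<^sub>M ?N)"
      "(\<lambda>(x, t). prim (B 0) W' t x) \<in> borel_measurable (?M \<Otimes>\<^sub>M ?N)"
      using W L by (auto intro!: prim_measurable L2_measurable)
    have sec: "prim (A 0) W t \<in> borel_measurable ?M" "prim (B 0) W' t \<in> borel_measurable ?M"
      using measurable_compose[OF measurable_Pair2'[OF elim(3)] pm(1)] measurable_compose[OF measurable_Pair2'[OF elim(3)] pm(2)]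
      by simp_all
    have "?G t = (\<integral>x. A t x * W' t x + B t x * W t x \<partial>?M)"
      unfolding inner_rate_def
    proof (rule integral_cong_AE)
      show "AE x in ?M. prim (A 0) W t x * W' t x + prim (B 0) W' t x * W t x = A t x * W' t x + B t x * W t x"
        using eq by eventually_elim simp
    qed (use sec elim L in \<open>auto simp: L2_iff\<close>)
    also have "\<dots> = L2_inner (A t) (W' t) + L2_inner (B t) (W t)"
      using L elim by (simp add: L2_inner_def L2_integrable_mult)
    finally show ?case by (simp add: L2_inner_commute)
  qed
qed

subsection \<open>Regularity in time of a strong solution\<close>

lemma C0_L2_D:
  assumes "w \<in> C0_L2 T" "t \<in> {0..T}"
  shows "w t \<in> L2 0 1"
    and "((\<lambda>s. L2_norm 0 1 (\<lambda>x. w s x - w t x)) \<longlongrightarrow> 0) (at t within {0..T})"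
  using assms unfolding C0_L2_def by blast+

lemma smooth_L2: "smooth \<phi> \<Longrightarrow> \<phi> \<in> L2 0 1"
proof -
  assume \<phi>: "smooth \<phi>"
  obtain C where "\<And>x. x \<in> {0<..<1} \<Longrightarrow> \<bar>\<phi> x\<bar> \<le> C"
    using smooth_bounded[OF \<phi>] by blast
  with smooth_measurable[OF \<phi>] show ?thesis by (rule L2_bounded)
qed

lemma L2_inner_smooth_bound:
  assumes "smooth \<phi>"
  obtains C where "\<And>q. q \<in> L2 0 1 \<Longrightarrow> \<bar>L2_inner q \<phi>\<bar> \<le> C * L2_norm 0 1 q"
proof -
  obtain C where C: "\<And>x. x \<in> {0<..<1} \<Longrightarrow> \<bar>\<phi> x\<bar> \<le> C"
    using smooth_bounded[OF assms] by blast
  have "0 \<le> C" using C[of "1/2"] by simp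
  show ?thesis
    by (rule that[of C]) (rule L2_inner_bounded[OF _ smooth_measurable[OF assms] C \<open>0 \<le> C\<close>])
qed

lemma C0_L2_inner_continuous:
  assumes w: "w \<in> C0_L2 T" and \<phi>: "smooth \<phi>"
  shows "continuous_on {0..T} (\<lambda>t. L2_inner (w t) \<phi>)"
  unfolding continuous_on
proof
  fix t assume t: "t \<in> {0..T}"
  obtain C where C: "\<And>q. q \<in> L2 0 1 \<Longrightarrow> \<bar>L2_inner q \<phi>\<bar> \<le> C * L2_norm 0 1 q"
    using L2_inner_smooth_bound[OF \<phi>] by blast
  have ev: "\<forall>\<^sub>F s in at t within {0..T}. norm (L2_inner (w s) \<phi> - L2_inner (w t) \<phi>)
      \<le> C * L2_norm 0 1 (\<lambda>x. w s x - w t x)"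
    unfolding eventually_at_filter
  proof (intro always_eventually allI impI)
    fix s assume "s \<noteq> t" and s: "s \<in> {0..T}"
    note L = C0_L2_D(1)[OF w s] C0_L2_D(1)[OF w t]
    from C[OF L2_diff[OF L]] show "norm (L2_inner (w s) \<phi> - L2_inner (w t) \<phi>)
      \<le> C * L2_norm 0 1 (\<lambda>x. w s x - w t x)"
      by (simp add: L2_inner_diff_left[OF L smooth_L2[OF \<phi>]])
  qed
  have "((\<lambda>s. C * L2_norm 0 1 (\<lambda>x. w s x - w t x)) \<longlongrightarrow> C * 0) (at t within {0..T})"
    by (intro tendsto_mult tendsto_const C0_L2_D(2)[OF w t])
  then have "((\<lambda>s. C * L2_norm 0 1 (\<lambda>x. w s x - w t x)) \<longlongrightarrow> 0) (at t within {0..T})" by simp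
  from Lim_null_comparison[OF ev this]
  show "((\<lambda>t. L2_inner (w t) \<phi>) \<longlongrightarrow> L2_inner (w t) \<phi>) (at t within {0..T})"
    by (simp add: LIM_zero_iff)
qed

lemma L2_diff_inner:
  assumes d: "L2_diff {0..T} u t v" and t: "t \<in> {0..T}" and u: "u \<in> C0_L2 T" and \<phi>: "smooth \<phi>"
  shows "((\<lambda>s. L2_inner (u s) \<phi>) has_real_derivative L2_inner v \<phi>) (at t within {0..T})"
proof -
  obtain C where C: "\<And>q. q \<in> L2 0 1 \<Longrightarrow> \<bar>L2_inner q \<phi>\<bar> \<le> C * L2_norm 0 1 q"
    using L2_inner_smooth_bound[OF \<phi>] by blast
  have v: "v \<in> L2 0 1" using d by (simp add: L2_diff_def)
  let ?q = "\<lambda>s x. (u s x - u t x) / (s - t) - v x"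
  have ev: "\<forall>\<^sub>F s in at t within {0..T}.
      norm ((L2_inner (u s) \<phi> - L2_inner (u t) \<phi>) / (s - t) - L2_inner v \<phi>) \<le> C * L2_norm 0 1 (?q s)"
    unfolding eventually_at_filter
  proof (intro always_eventually allI impI)
    fix s assume "s \<noteq> t" and s: "s \<in> {0..T}"
    note L = C0_L2_D(1)[OF u s] C0_L2_D(1)[OF u t]
    have q: "?q s = (\<lambda>x. (1 / (s - t)) * (u s x - u t x) - v x)" by auto
    have L': "(\<lambda>x. (1 / (s - t)) * (u s x - u t x)) \<in> L2 0 1"
      by (intro L2_cmult L2_diff L)
    have qL: "?q s \<in> L2 0 1" unfolding q by (intro L2_diff L' v)
    have "L2_inner (?q s) \<phi> = (L2_inner (u s) \<phi> - L2_inner (u t) \<phi>) / (s - t) - L2_inner v \<phi>"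
      unfolding q L2_inner_diff_left[OF L' v smooth_L2[OF \<phi>]] L2_inner_cmult_left
        L2_inner_diff_left[OF L smooth_L2[OF \<phi>]] by simp
    with C[OF qL] show "norm ((L2_inner (u s) \<phi> - L2_inner (u t) \<phi>) / (s - t) - L2_inner v \<phi>)
        \<le> C * L2_norm 0 1 (?q s)" by simp
  qed
  have "((\<lambda>s. C * L2_norm 0 1 (?q s)) \<longlongrightarrow> C * 0) (at t within {0..T})"
    using d by (intro tendsto_mult tendsto_const) (simp add: L2_diff_def)
  then have "((\<lambda>s. C * L2_norm 0 1 (?q s)) \<longlongrightarrow> 0) (at t within {0..T})" by simp
  from Lim_null_comparison[OF ev this] show ?thesis
    by (simp add: has_field_derivative_iff LIM_zero_iff)
qed

lemma C1_L2_inner_integral: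
  assumes C1: "C1_L2_deriv T u v" and \<phi>: "smooth \<phi>" and t: "t \<in> {0..T}"
  shows "L2_inner (u t) \<phi> = L2_inner (u 0) \<phi> + (\<integral>s. L2_inner (v s) \<phi> \<partial>ivl_measure 0 t)"
proof -
  from C1 have u: "u \<in> C0_L2 T" and v: "v \<in> C0_L2 T"
    and d: "\<And>t. t \<in> {0..T} \<Longrightarrow> L2_diff {0..T} u t (v t)"
    by (auto simp: C1_L2_deriv_def)
  have sub: "{0..t} \<subseteq> {0..T}" using t by auto
  have "(\<integral>s. L2_inner (v s) \<phi> \<partial>ivl_measure 0 t) = L2_inner (u t) \<phi> - L2_inner (u 0) \<phi>"
  proof (rule ivl_integral_FTC(2))
    show "0 \<le> t" using t by simp
    show "continuous_on {0..t} (\<lambda>s. L2_inner (v s) \<phi>)"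
      using C0_L2_inner_continuous[OF v \<phi>] sub by (rule continuous_on_subset)
    fix s assume "s \<in> {0..t}"
    then have s: "s \<in> {0..T}" using sub by auto
    from L2_diff_inner[OF d[OF s] s u \<phi>] sub
    show "((\<lambda>s. L2_inner (u s) \<phi>) has_real_derivative L2_inner (v s) \<phi>) (at s within {0..t})"
      by (rule DERIV_subset)
  qed
  then show ?thesis by simp
qed

lemma time_prim_C1:
  assumes "C1_L2_deriv T u v" "v \<in> Linf_L2 T"
  shows "time_prim T u v"
proof (rule time_primI[OF assms(2)])
  show "u t \<in> L2 0 1" if "t \<in> {0..T}" for t
    using assms(1) that C0_L2_D(1) unfolding C1_L2_deriv_def by blast
qed (rule C1_L2_inner_integral[OF assms(1) test_fun_smooth])

text \<open>Testing with products \<phi>(x) \<psi>(t) turns the distributional derivative into a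
  weak derivative of the scalar function \<open>L2_inner (v t) \<phi>\<close>. Continuity of
  \<open>v\<close> into \<open>L2\<close> then upgrades the resulting identity from almost every
  time to every time, and identifies the constant with the value at 0.\<close>

lemma time_prim_weak:
  assumes T: "0 < T" and v: "v \<in> C0_L2 T" "v \<in> Linf_L2 T" and w: "w \<in> Linf_L2 T" and wt: "weak_tderiv T v w"
  shows "time_prim T v w"
proof (rule time_primI[OF w C0_L2_D(1)[OF v(1)]])
  fix t \<phi> assume t: "t \<in> {0..T}" and "\<phi> \<in> test_fun 0 1"
  then have \<phi>: "smooth \<phi>" by (intro test_fun_smooth)
  let ?N = "ivl_measure 0 T" and ?M = "ivl_measure 0 1"
  let ?F = "\<lambda>t. L2_inner (v t) \<phi>" and ?G = "\<lambda>t. L2_inner (w t) \<phi>"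
  have F: "integrable ?N ?F" and G: "integrable ?N ?G"
    using Linf_L2_Fubini(1)[OF v(2) \<phi> smooth_const[of 1]] Linf_L2_Fubini(1)[OF w \<phi> smooth_const[of 1]]
    by simp_all
  obtain c where c: "AE s in ?N. ?F s = c + (\<integral>r. ?G r \<partial>ivl_measure 0 s)"
  proof (rule weak_deriv_imp_ac[OF T F G])
    fix \<psi> assume \<psi>: "\<psi> \<in> test_fun 0 T"
    note D = test_fun_deriv(1)[OF \<psi>] and S = test_fun_smooth[OF \<psi>]
    have ae: "AE x in ?M. (\<integral>t. v t x * deriv \<psi> t \<partial>?N) = - (\<integral>t. w t x * \<psi> t \<partial>?N)"
      using wt \<psi> unfolding weak_tderiv_def set_integral_ivl AE_ivl by blast
    have "(\<integral>s. ?F s * deriv \<psi> s \<partial>?N) = (\<integral>x. \<phi> x * (\<integral>t. v t x * deriv \<psi> t \<partial>?N) \<partial>?M)"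
      by (rule Linf_L2_Fubini(3)[OF v(2) \<phi> D])
    also have "\<dots> = (\<integral>x. - (\<phi> x * (\<integral>t. w t x * \<psi> t \<partial>?N)) \<partial>?M)"
    proof (rule integral_cong_AE)
      show "AE x in ?M. \<phi> x * (\<integral>t. v t x * deriv \<psi> t \<partial>?N) = - (\<phi> x * (\<integral>t. w t x * \<psi> t \<partial>?N))"
        using ae by eventually_elim simp
      show "(\<lambda>x. \<phi> x * (\<integral>t. v t x * deriv \<psi> t \<partial>?N)) \<in> borel_measurable ?M"
        using Linf_L2_Fubini(2)[OF v(2) \<phi> D] by (rule borel_measurable_integrable)
      show "(\<lambda>x. - (\<phi> x * (\<integral>t. w t x * \<psi> t \<partial>?N))) \<in> borel_measurable ?M"
        using Linf_L2_Fubini(2)[OF w \<phi> S] by (intro borel_measurable_uminus borel_measurable_integrable)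
    qed
    also have "\<dots> = - (\<integral>s. ?G s * \<psi> s \<partial>?N)"
      by (simp add: Linf_L2_Fubini(3)[OF w \<phi> S])
    finally show "(\<integral>s. ?F s * deriv \<psi> s \<partial>?N) = - (\<integral>s. ?G s * \<psi> s \<partial>?N)" .
  qed blast
  have cont: "continuous_on {0..T} (\<lambda>s. c + (\<integral>r. ?G r \<partial>ivl_measure 0 s))"
    by (intro continuous_intros continuous_ivl_integral G)
  have eq: "?F s = c + (\<integral>r. ?G r \<partial>ivl_measure 0 s)" if "s \<in> {0..T}" for s
    by (rule continuous_AE_eq_imp_eq[OF T C0_L2_inner_continuous[OF v(1) \<phi>] cont c that])
  have "?F 0 = c" using eq[of 0] T integral_ivl_refl[of 0 ?G] by simp
  with eq[OF t] show "?F t = ?F 0 + (\<integral>s. ?G s \<partial>ivl_measure 0 t)" by simp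
qed

text \<open>\<open>u_x\<close> is not assumed differentiable in time. With the x-derivative moved
  onto \<phi>, its inner product with \<phi> becomes that of \<open>- u\<close> with the derivative
  of \<phi>, which is differentiable in time; moving the derivative back for \<open>v\<close>
  produces \<open>z\<close>.\<close>

lemma time_prim_wderiv:
  assumes C1: "C1_L2_deriv T u v" and H: "\<And>t. t \<in> {0..T} \<Longrightarrow> u t \<in> H1 0 1"
    and z: "z \<in> Linf_L2 T" and vz: "AE t in ivl_measure 0 T. weak_deriv 0 1 (v t) (z t)"
  shows "time_prim T (\<lambda>t. wderiv 0 1 (u t)) z"
proof (rule time_primI[OF z])
  have wd: "weak_deriv 0 1 (u t) (wderiv 0 1 (u t))" if "t \<in> {0..T}" for t
    using H[OF that] by (rule weak_deriv_wderiv)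
  show "wderiv 0 1 (u t) \<in> L2 0 1" if "t \<in> {0..T}" for t
    using wd[OF that] by (rule weak_derivD)
  fix t \<phi> assume t: "t \<in> {0..T}" and \<phi>: "\<phi> \<in> test_fun 0 1"
  have dual: "L2_inner (wderiv 0 1 (u s)) \<phi> = - L2_inner (u s) (deriv \<phi>)" if "s \<in> {0..T}" for s
    using weak_derivD(3)[OF wd[OF that] \<phi>] by (simp add: L2_inner_def)
  have "(\<integral>s. L2_inner (z s) \<phi> \<partial>ivl_measure 0 t) = (\<integral>s. - L2_inner (v s) (deriv \<phi>) \<partial>ivl_measure 0 t)"
  proof (rule integral_cong_AE)
    have zt: "z \<in> Linf_L2 t" using Linf_L2_mono[OF z] t by simp
    show "(\<lambda>s. L2_inner (z s) \<phi>) \<in> borel_measurable (ivl_measure 0 t)"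
      using Linf_L2_Fubini(1)[OF zt test_fun_smooth[OF \<phi>] smooth_const[of 1]] by simp
    have "continuous_on {0..T} (\<lambda>s. L2_inner (v s) (deriv \<phi>))"
      using C1 by (intro C0_L2_inner_continuous test_fun_deriv(1)[OF \<phi>]) (simp add: C1_L2_deriv_def)
    then have "continuous_on {0..t} (\<lambda>s. L2_inner (v s) (deriv \<phi>))"
      using t by (auto intro: continuous_on_subset)
    then show "(\<lambda>s. - L2_inner (v s) (deriv \<phi>)) \<in> borel_measurable (ivl_measure 0 t)"
      by (intro borel_measurable_uminus borel_measurable_integrable continuous_ivl_integrable)
    have "AE s in ivl_measure 0 t. weak_deriv 0 1 (v s) (z s)"
      using vz t unfolding AE_ivl[symmetric] by (auto elim: eventually_mono)
    then show "AE s in ivl_measure 0 t. L2_inner (z s) \<phi> = - L2_inner (v s) (deriv \<phi>)"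
    proof eventually_elim
      case (elim s)
      show ?case using weak_derivD(3)[OF elim \<phi>] by (simp add: L2_inner_def)
    qed
  qed
  then have "(\<integral>s. L2_inner (z s) \<phi> \<partial>ivl_measure 0 t) = - (\<integral>s. L2_inner (v s) (deriv \<phi>) \<partial>ivl_measure 0 t)"
    by simp
  moreover have "0 \<in> {0..T}" using t by simp
  ultimately show "L2_inner (wderiv 0 1 (u t)) \<phi> = L2_inner (wderiv 0 1 (u 0)) \<phi> + (\<integral>s. L2_inner (z s) \<phi> \<partial>ivl_measure 0 t)"
    using C1_L2_inner_integral[OF C1 test_fun_deriv(1)[OF \<phi>] t] dual[OF t] dual[of 0] by simp
qed

text \<open>Lets a fixed function serve as second factor in \<open>time_prim_inner\<close>, which
  yields the absolute continuity of linear functionals such as the traces.\<close>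

lemma time_prim_const:
  assumes "\<phi> \<in> L2 0 1"
  shows "time_prim T (\<lambda>t. \<phi>) (\<lambda>t x. 0)"
proof -
  have "(\<lambda>t x. 0) \<in> Linf_L2 T"
    unfolding Linf_L2_def meas_QT_def
    using L2_const[of 0 0 1] by (auto simp: set_borel_measurable_def case_prod_beta' L2_norm_def intro!: exI[of _ 0])
  then show ?thesis using assms by (auto simp: time_prim_def)
qed

lemma ac_on_trace:
  assumes T: "0 \<le> T" and u: "time_prim T u v" and ux: "time_prim T (\<lambda>t. wderiv 0 1 (u t)) z"
    and H: "\<And>t. t \<in> {0..T} \<Longrightarrow> u t \<in> H1 0 1"
    and vz: "AE t in ivl_measure 0 T. weak_deriv 0 1 (v t) (z t)"
  shows "\<exists>r. ac_on T (\<lambda>t. trace (u t) 0) r \<and> (AE t in ivl_measure 0 T. r t = trace (v t) 0)"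
    and "\<exists>r. ac_on T (\<lambda>t. trace (u t) 1) r \<and> (AE t in ivl_measure 0 T. r t = trace (v t) 1)"
proof -
  let ?N = "ivl_measure 0 T"
  have pair: "\<exists>G. ac_on T (\<lambda>t. L2_inner (A t) \<phi>) G \<and> (AE t in ?N. G t = L2_inner (W t) \<phi>)"
    if A: "time_prim T A W" and \<phi>: "\<phi> \<in> L2 0 1" for A W \<phi>
  proof -
    obtain G where "ac_on T (\<lambda>t. L2_inner (A t) \<phi>) G"
      "AE t in ?N. G t = L2_inner (A t) (\<lambda>x. 0) + L2_inner (W t) \<phi>"
      using time_prim_inner[OF T A time_prim_const[OF \<phi>]] .
    moreover have "L2_inner q (\<lambda>x. 0) = 0" for q by (simp add: L2_inner_def)
    ultimately show ?thesis by auto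
  qed
  have cong: "ac_on T F' G" if "ac_on T F G" "\<And>t. t \<in> {0..T} \<Longrightarrow> F' t = F t" for F F' G
    unfolding ac_on_def
  proof (intro conjI ballI)
    show "integrable ?N G" using that(1) by (rule ac_onD)
    fix t assume t: "t \<in> {0..T}"
    have "0 \<in> {0..T}" using T by simp
    then show "F' t = F' 0 + (\<integral>s. G s \<partial>ivl_measure 0 t)"
      using ac_onD(2)[OF that(1) t] that(2)[OF t] that(2)[of 0] by simp
  qed
  have L: "(\<lambda>x. 1 - x) \<in> L2 0 1" "(\<lambda>x. x) \<in> L2 0 1"
    by (rule L2_bounded[where C = 1]; auto intro!: borel_measurable_diff measurable_ivl_borel)+
  have tr: "trace (u t) 0 = L2_inner (u t) (\<lambda>x. 1) + (- 1) * L2_inner (wderiv 0 1 (u t)) (\<lambda>x. 1 - x)"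
    "trace (u t) 1 = L2_inner (u t) (\<lambda>x. 1) + L2_inner (wderiv 0 1 (u t)) (\<lambda>x. x)" if "t \<in> {0..T}" for t
    using trace_eq_L2_inner[OF weak_deriv_wderiv[OF H[OF that]]] by simp_all
  obtain G1 where G1: "ac_on T (\<lambda>t. L2_inner (u t) (\<lambda>x. 1)) G1" "AE t in ?N. G1 t = L2_inner (v t) (\<lambda>x. 1)"
    using pair[OF u L2_const[of 1]] by blast
  obtain G2 where G2: "ac_on T (\<lambda>t. L2_inner (wderiv 0 1 (u t)) (\<lambda>x. 1 - x)) G2"
    "AE t in ?N. G2 t = L2_inner (z t) (\<lambda>x. 1 - x)"
    using pair[OF ux L(1)] by blast
  obtain G3 where G3: "ac_on T (\<lambda>t. L2_inner (wderiv 0 1 (u t)) (\<lambda>x. x)) G3"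
    "AE t in ?N. G3 t = L2_inner (z t) (\<lambda>x. x)"
    using pair[OF ux L(2)] by blast
  show "\<exists>r. ac_on T (\<lambda>t. trace (u t) 0) r \<and> (AE t in ?N. r t = trace (v t) 0)"
  proof (intro exI conjI)
    show "ac_on T (\<lambda>t. trace (u t) 0) (\<lambda>t. G1 t + (- 1) * G2 t)"
      by (rule cong[OF ac_on_add[OF G1(1) ac_on_cmult[OF G2(1)]] tr(1)])
    show "AE t in ?N. G1 t + (- 1) * G2 t = trace (v t) 0"
      using G1(2) G2(2) vz by eventually_elim (simp add: trace_eq_L2_inner(1))
  qed
  show "\<exists>r. ac_on T (\<lambda>t. trace (u t) 1) r \<and> (AE t in ?N. r t = trace (v t) 1)"
  proof (intro exI conjI)
    show "ac_on T (\<lambda>t. trace (u t) 1) (\<lambda>t. G1 t + G3 t)"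
      by (rule cong[OF ac_on_add[OF G1(1) G3(1)] tr(2)])
    show "AE t in ?N. G1 t + G3 t = trace (v t) 1"
      using G1(2) G3(2) vz by eventually_elim (simp add: trace_eq_L2_inner(2))
  qed
qed

subsection \<open>The Lyapunov inequality\<close>

text \<open>\<theta> is the ratio of the cross coefficient to the largest one that the
  arithmetic-geometric mean inequality can absorb. As \<theta> < 1, a fraction 1 - \<theta> of the
  diagonal part survives.\<close>

lemma quadratic_form_coercive:
  fixes lam0 lam1 \<Lambda> :: real
  assumes "lam0 > 0" "lam1 > 0" "\<bar>\<Lambda>\<bar> < 2 * sqrt (lam0 * lam1)"
  obtains \<mu> where "\<mu> > 0" "\<And>r s. \<mu> * (r\<^sup>2 + s\<^sup>2) \<le> lam0 * r\<^sup>2 + lam1 * s\<^sup>2 + \<Lambda> * r * s"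
proof -
  define \<theta> where "\<theta> = \<bar>\<Lambda>\<bar> / (2 * sqrt (lam0 * lam1))"
  have sq: "0 < sqrt (lam0 * lam1)" using assms by simp
  have \<theta>: "0 \<le> \<theta>" "\<theta> < 1" using assms sq by (auto simp: \<theta>_def)
  define \<mu> where "\<mu> = (1 - \<theta>) * min lam0 lam1"
  show ?thesis
  proof (rule that)
    show "\<mu> > 0" using \<theta> assms by (simp add: \<mu>_def)
    fix r s :: real
    have "2 * (sqrt lam0 * \<bar>r\<bar>) * (sqrt lam1 * \<bar>s\<bar>) \<le> (sqrt lam0 * \<bar>r\<bar>)\<^sup>2 + (sqrt lam1 * \<bar>s\<bar>)\<^sup>2"
      by (rule sum_squares_bound)
    then have 1: "2 * sqrt (lam0 * lam1) * (\<bar>r\<bar> * \<bar>s\<bar>) \<le> lam0 * r\<^sup>2 + lam1 * s\<^sup>2"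
      using assms by (simp add: power_mult_distrib real_sqrt_mult mult_ac)
    have "\<bar>\<Lambda> * r * s\<bar> = \<theta> * (2 * sqrt (lam0 * lam1) * (\<bar>r\<bar> * \<bar>s\<bar>))"
      using sq assms(1,2) by (simp add: \<theta>_def abs_mult)
    also have "\<dots> \<le> \<theta> * (lam0 * r\<^sup>2 + lam1 * s\<^sup>2)"
      using 1 \<theta> by (intro mult_left_mono)
    finally have "(1 - \<theta>) * (lam0 * r\<^sup>2 + lam1 * s\<^sup>2) \<le> lam0 * r\<^sup>2 + lam1 * s\<^sup>2 + \<Lambda> * r * s"
      by (simp add: algebra_simps abs_le_iff)
    moreover have "min lam0 lam1 * r\<^sup>2 \<le> lam0 * r\<^sup>2" "min lam0 lam1 * s\<^sup>2 \<le> lam1 * s\<^sup>2"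
      by (auto intro: mult_right_mono)
    then have "\<mu> * (r\<^sup>2 + s\<^sup>2) \<le> (1 - \<theta>) * (lam0 * r\<^sup>2 + lam1 * s\<^sup>2)"
      unfolding \<mu>_def mult.assoc using \<theta> by (intro mult_left_mono) (auto simp: distrib_left)
    ultimately show "\<mu> * (r\<^sup>2 + s\<^sup>2) \<le> lam0 * r\<^sup>2 + lam1 * s\<^sup>2 + \<Lambda> * r * s" by linarith
  qed
qed

lemma young_ineq:
  fixes a b e :: real
  assumes "e > 0"
  shows "\<bar>a * b\<bar> \<le> e * a\<^sup>2 + b\<^sup>2 / (4 * e)"
proof -
  have "0 \<le> (2 * e * \<bar>a\<bar> - \<bar>b\<bar>)\<^sup>2 / (4 * e)" using assms by simp
  also have "\<dots> = e * a\<^sup>2 + b\<^sup>2 / (4 * e) - \<bar>a * b\<bar>"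
    using assms by (simp add: power2_diff power_mult_distrib abs_mult field_simps power2_eq_square)
  finally show ?thesis by simp
qed

text \<open>
  Quantities at a fixed time, as real variables:
  \<open>nV, nX, nU, nf\<close> stand for \<open>\<parallel>u'\<parallel>\<^sup>2, \<parallel>u\<^sub>x\<parallel>\<^sup>2, \<parallel>u\<parallel>\<^sup>2, \<parallel>f\<parallel>\<^sup>2\<close>; \<open>p, q\<close> for \<open>u(0), u(1)\<close>; \<open>r, s\<close> for \<open>u'(0), u'(1)\<close>;
  \<open>m, fV, fU\<close> for \<open>\<langle>u, u'\<rangle>, \<langle>u', f\<rangle>, \<langle>u, f\<rangle>\<close>.  The corrector is \<open>\<Psi>\<close>, and the rates are the time derivatives of \<open>E\<close>
  and \<open>\<Psi>\<close> along solutions.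
\<close>

definition energy_form :: "real \<Rightarrow> real \<Rightarrow> real \<Rightarrow> real \<Rightarrow> real \<Rightarrow> real \<Rightarrow> real \<Rightarrow> real \<Rightarrow> real" where
  "energy_form h0 h1 K nV nX nU p q = nV / 2 + (nX + h0 * p\<^sup>2 + h1 * q\<^sup>2) / 2 + K / 2 * nU"

definition corrector :: "real \<Rightarrow> real \<Rightarrow> real \<Rightarrow> real \<Rightarrow> real \<Rightarrow> real \<Rightarrow> real \<Rightarrow> real" where
  "corrector lam0 lam1 lam m nU p q = m + lam / 2 * nU + lam0 / 2 * p\<^sup>2 + lam1 / 2 * q\<^sup>2"

definition energy_rate :: "real \<Rightarrow> real \<Rightarrow> real \<Rightarrow> real \<Rightarrow> real \<Rightarrow> real \<Rightarrow> real \<Rightarrow>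
    real \<Rightarrow> real \<Rightarrow> real \<Rightarrow> real \<Rightarrow> real \<Rightarrow> real \<Rightarrow> real \<Rightarrow> real \<Rightarrow> real" where
  "energy_rate lam0 lam1 ht0 ht1 lamt0 lamt1 lam nV p q r s fV g0 g1 =
     - lam * nV + fV - (lam0 * r\<^sup>2 + lam1 * s\<^sup>2 + (lamt0 + lamt1) * r * s)
     - ht1 * q * r - ht0 * p * s - g0 * r - g1 * s"

definition corrector_rate :: "real \<Rightarrow> real \<Rightarrow> real \<Rightarrow> real \<Rightarrow> real \<Rightarrow> real \<Rightarrow> real \<Rightarrow> real \<Rightarrow>
    real \<Rightarrow> real \<Rightarrow> real \<Rightarrow> real \<Rightarrow> real \<Rightarrow> real \<Rightarrow> real \<Rightarrow> real \<Rightarrow> real \<Rightarrow> real" where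
  "corrector_rate h0 h1 ht0 ht1 lamt0 lamt1 K nV nX nU p q r s fU g0 g1 =
     nV - (nX + h0 * p\<^sup>2 + h1 * q\<^sup>2) - K * nU + fU - (ht0 + ht1) * (p * q)
     - lamt1 * s * p - lamt0 * r * q - g0 * p - g1 * q"

text \<open>Each boundary velocity occurs in two unsigned products, one with a boundary value and
  one with boundary data. Spending \<mu>/4 of its square on each of them leaves half of the coercive
  term.\<close>

lemma energy_rate_le:
  fixes \<mu> \<eta> :: real
  assumes mu: "\<mu> > 0" "\<And>r s. \<mu> * (r\<^sup>2 + s\<^sup>2) \<le> lam0 * r\<^sup>2 + lam1 * s\<^sup>2 + (lamt0 + lamt1) * r * s"
    and h: "\<bar>ht0\<bar> \<le> \<eta>" "\<bar>ht1\<bar> \<le> \<eta>"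
    and fV: "fV \<le> lam / 2 * nV + nf / (2 * lam)"
  shows "energy_rate lam0 lam1 ht0 ht1 lamt0 lamt1 lam nV p q r s fV g0 g1
    \<le> - (lam / 2) * nV - \<mu> / 2 * (r\<^sup>2 + s\<^sup>2) + \<eta>\<^sup>2 / \<mu> * (p\<^sup>2 + q\<^sup>2) + nf / (2 * lam) + (g0\<^sup>2 + g1\<^sup>2) / \<mu>"
proof -
  have e: "\<mu> / 4 > 0" using mu by simp
  have pr: "\<bar>r * b\<bar> \<le> \<mu> / 4 * r\<^sup>2 + b\<^sup>2 / \<mu>" for r b
    using young_ineq[OF e, of r b] by simp
  have sq: "(h * y)\<^sup>2 / \<mu> \<le> \<eta>\<^sup>2 / \<mu> * y\<^sup>2" if "\<bar>h\<bar> \<le> \<eta>" for h y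
  proof -
    have "h\<^sup>2 \<le> \<eta>\<^sup>2" using that by (simp add: abs_le_square_iff[symmetric])
    then have "h\<^sup>2 * y\<^sup>2 / \<mu> \<le> \<eta>\<^sup>2 * y\<^sup>2 / \<mu>"
      using mu by (intro divide_right_mono mult_right_mono) auto
    then show ?thesis by (simp add: power_mult_distrib)
  qed
  have "- (r * (ht1 * q)) \<le> \<mu> / 4 * r\<^sup>2 + \<eta>\<^sup>2 / \<mu> * q\<^sup>2"
    using pr[of r "ht1 * q"] sq[OF h(2), of q] by linarith
  moreover have "- (s * (ht0 * p)) \<le> \<mu> / 4 * s\<^sup>2 + \<eta>\<^sup>2 / \<mu> * p\<^sup>2"
    using pr[of s "ht0 * p"] sq[OF h(1), of p] by linarith
  moreover have "- (r * g0) \<le> \<mu> / 4 * r\<^sup>2 + g0\<^sup>2 / \<mu>" "- (s * g1) \<le> \<mu> / 4 * s\<^sup>2 + g1\<^sup>2 / \<mu>"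
    using pr[of r g0] pr[of s g1] by linarith+
  ultimately show ?thesis
    using mu(2)[of r s] fV unfolding energy_rate_def
    by (simp add: algebra_simps add_divide_distrib)
qed

text \<open>With \<open>B\<close> the squared a-norm, four boundary products cost B/8 each, and the
  product of the two boundary values costs B/4, by 8 \<kappa> \<eta> \<le> 1. A quarter of
  \<open>B\<close> remains.\<close>

lemma corrector_rate_le:
  fixes \<kappa> \<eta> :: real
  assumes \<kappa>: "\<kappa> > 0" "p\<^sup>2 \<le> \<kappa> * (nX + h0 * p\<^sup>2 + h1 * q\<^sup>2)" "q\<^sup>2 \<le> \<kappa> * (nX + h0 * p\<^sup>2 + h1 * q\<^sup>2)"
    and h: "\<bar>ht0\<bar> \<le> \<eta>" "\<bar>ht1\<bar> \<le> \<eta>" "8 * \<kappa> * \<eta> \<le> 1"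
    and fU: "fU \<le> K / 2 * nU + nf / (2 * K)"
  shows "corrector_rate h0 h1 ht0 ht1 lamt0 lamt1 K nV nX nU p q r s fU g0 g1
    \<le> nV - (nX + h0 * p\<^sup>2 + h1 * q\<^sup>2) / 4 - K / 2 * nU + 2 * \<kappa> * (lamt1\<^sup>2 * s\<^sup>2 + lamt0\<^sup>2 * r\<^sup>2)
      + nf / (2 * K) + 2 * \<kappa> * (g0\<^sup>2 + g1\<^sup>2)"
proof -
  define B where "B = nX + h0 * p\<^sup>2 + h1 * q\<^sup>2"
  have B: "p\<^sup>2 \<le> \<kappa> * B" "q\<^sup>2 \<le> \<kappa> * B" using \<kappa> by (auto simp: B_def)
  have e: "1 / (8 * \<kappa>) > 0" using \<kappa> by simp
  have y: "- (y * b) \<le> B / 8 + 2 * \<kappa> * b\<^sup>2" if "y\<^sup>2 \<le> \<kappa> * B" for y b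
  proof -
    have "1 / (8 * \<kappa>) * y\<^sup>2 \<le> 1 / (8 * \<kappa>) * (\<kappa> * B)"
      using that e by (intro mult_left_mono) auto
    also have "\<dots> = B / 8" using \<kappa> by simp
    finally have "1 / (8 * \<kappa>) * y\<^sup>2 \<le> B / 8" .
    moreover have "b\<^sup>2 / (4 * (1 / (8 * \<kappa>))) = 2 * \<kappa> * b\<^sup>2" using \<kappa> by simp
    ultimately show ?thesis using young_ineq[OF e, of y b] by linarith
  qed
  have "0 \<le> \<kappa> * B" using B(1) zero_le_power2[of p] by linarith
  then have B0: "0 \<le> B" using \<kappa> by (simp add: zero_le_mult_iff)
  have pq: "\<bar>p * q\<bar> \<le> \<kappa> * B"
  proof -
    have "2 * (\<bar>p\<bar> * \<bar>q\<bar>) \<le> p\<^sup>2 + q\<^sup>2" using sum_squares_bound[of "\<bar>p\<bar>" "\<bar>q\<bar>"] by (simp add: mult.assoc)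
    then show ?thesis using B by (simp add: abs_mult)
  qed
  have "- ((ht0 + ht1) * (p * q)) \<le> \<bar>ht0 + ht1\<bar> * \<bar>p * q\<bar>"
    by (metis abs_ge_minus_self abs_mult)
  also have "\<dots> \<le> (2 * \<eta>) * (\<kappa> * B)"
    using pq h(1,2) by (intro mult_mono) auto
  also have "\<dots> = (8 * \<kappa> * \<eta>) * (B / 4)" by simp
  also have "\<dots> \<le> 1 * (B / 4)"
    using h(3) B0 by (intro mult_right_mono) auto
  finally have "- ((ht0 + ht1) * (p * q)) \<le> B / 4" by simp
  moreover have "- (p * (lamt1 * s)) \<le> B / 8 + 2 * \<kappa> * (lamt1 * s)\<^sup>2" "- (q * (lamt0 * r)) \<le> B / 8 + 2 * \<kappa> * (lamt0 * r)\<^sup>2"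
    "- (p * g0) \<le> B / 8 + 2 * \<kappa> * g0\<^sup>2" "- (q * g1) \<le> B / 8 + 2 * \<kappa> * g1\<^sup>2"
    using y B by auto
  ultimately have "corrector_rate h0 h1 ht0 ht1 lamt0 lamt1 K nV nX nU p q r s fU g0 g1
    \<le> nV - B / 4 - K / 2 * nU + 2 * \<kappa> * (lamt1\<^sup>2 * s\<^sup>2 + lamt0\<^sup>2 * r\<^sup>2)
      + nf / (2 * K) + 2 * \<kappa> * (g0\<^sup>2 + g1\<^sup>2)"
    using fU unfolding corrector_rate_def B_def[symmetric]
    by (simp add: algebra_simps power_mult_distrib)
  then show ?thesis unfolding B_def .
qed

lemma corrector_le:
  assumes "K > 0" "lam > 0" "lam0 > 0" "lam1 > 0" "\<kappa> > 0"
    and nn: "0 \<le> nV" "0 \<le> nU"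
    and \<kappa>: "p\<^sup>2 \<le> \<kappa> * (nX + h0 * p\<^sup>2 + h1 * q\<^sup>2)" "q\<^sup>2 \<le> \<kappa> * (nX + h0 * p\<^sup>2 + h1 * q\<^sup>2)"
    and m: "\<bar>m\<bar> \<le> (nU + nV) / 2"
  shows "\<bar>corrector lam0 lam1 lam m nU p q\<bar>
    \<le> (1 + (1 + lam) / K + (lam0 + lam1) * \<kappa>) * energy_form h0 h1 K nV nX nU p q"
proof -
  define B where "B = nX + h0 * p\<^sup>2 + h1 * q\<^sup>2"
  define E where "E = energy_form h0 h1 K nV nX nU p q"
  have B: "p\<^sup>2 \<le> \<kappa> * B" "q\<^sup>2 \<le> \<kappa> * B" using \<kappa> by (auto simp: B_def)
  have "0 \<le> \<kappa> * B" using B(1) zero_le_power2[of p] by linarith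
  then have B0: "0 \<le> B" using assms(5) by (simp add: zero_le_mult_iff)
  have E: "E = nV / 2 + B / 2 + K / 2 * nU" by (simp add: E_def energy_form_def B_def)
  have KU: "0 \<le> K / 2 * nU" using assms by simp
  have "nV / 2 \<le> E" using KU B0 by (simp add: E)
  moreover have "(1 + lam) / 2 * nU \<le> (1 + lam) / K * E"
  proof -
    have "(1 + lam) / K * (K / 2 * nU) \<le> (1 + lam) / K * E"
      using assms KU B0 by (intro mult_left_mono) (auto simp: E)
    then show ?thesis using assms by simp
  qed
  moreover have "lam0 / 2 * p\<^sup>2 \<le> lam0 * \<kappa> * E" "lam1 / 2 * q\<^sup>2 \<le> lam1 * \<kappa> * E"
  proof -
    have BE: "\<kappa> * B \<le> \<kappa> * (2 * E)" using assms KU nn by (intro mult_left_mono) (auto simp: E)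
    have "lam0 / 2 * p\<^sup>2 \<le> lam0 / 2 * (\<kappa> * (2 * E))" "lam1 / 2 * q\<^sup>2 \<le> lam1 / 2 * (\<kappa> * (2 * E))"
      using assms(3,4) order_trans[OF B(1) BE] order_trans[OF B(2) BE] by (intro mult_left_mono; simp)+
    then show "lam0 / 2 * p\<^sup>2 \<le> lam0 * \<kappa> * E" "lam1 / 2 * q\<^sup>2 \<le> lam1 * \<kappa> * E" by simp_all
  qed
  moreover have "\<bar>corrector lam0 lam1 lam m nU p q\<bar> \<le> \<bar>m\<bar> + lam / 2 * nU + lam0 / 2 * p\<^sup>2 + lam1 / 2 * q\<^sup>2"
  proof -
    have "0 \<le> lam / 2 * nU" "0 \<le> lam0 / 2 * p\<^sup>2" "0 \<le> lam1 / 2 * q\<^sup>2" using assms by auto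
    then show ?thesis unfolding corrector_def by linarith
  qed
  moreover have "(1 + lam) / 2 * nU = nU / 2 + lam / 2 * nU" by (simp add: field_simps)
  moreover have "(1 + (1 + lam) / K + (lam0 + lam1) * \<kappa>) * E = E + (1 + lam) / K * E + (lam0 * \<kappa> * E + lam1 * \<kappa> * E)"
    by (simp only: distrib_right mult_1)
  \<comment> \<open>With all products named by variables, the combination of the bounds is purely
    linear.\<close>
  moreover have "c \<le> y" if "v / 2 \<le> e" "u' \<le> a1" "p' \<le> a2" "q' \<le> a3" "c \<le> b + l + p' + q'"
    "u' = u / 2 + l" "y = e + a1 + (a2 + a3)" "b \<le> (u + v) / 2" for c y v e u' a1 p' a2 q' a3 b l u :: real
    using that by argo
  ultimately show ?thesis
    using m unfolding E_def[symmetric] by blast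
qed

text \<open>Solutions enter only through the bound on the trace at 1 and Young's inequality for
  \<open>m\<close>, \<open>fV\<close> and \<open>fU\<close>; the boundary velocities are arbitrary
  reals. The constants are thus found by real arithmetic, before the couplings and the data are
  given.\<close>

lemma lyapunov_constants:
  fixes h0 h1 lam0 lam1 lamt0 lamt1 K lam :: real
  assumes "h0 > 0" "lam0 > 0" "lam1 > 0" "K > 0" "lam > 0" "h1 \<ge> 0"
    and "\<bar>lamt0 + lamt1\<bar> < 2 * sqrt (lam0 * lam1)"
  obtains \<eta> \<delta> C \<beta> where "\<eta> > 0" "C \<ge> 0" "\<beta> > 0"
    "\<And>nV nX nU p q m. 0 \<le> nV \<Longrightarrow> 0 \<le> nX \<Longrightarrow> 0 \<le> nU \<Longrightarrow> q\<^sup>2 \<le> 2 * p\<^sup>2 + 2 * nX \<Longrightarrow> \<bar>m\<bar> \<le> (nU + nV) / 2 \<Longrightarrow>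
      energy_form h0 h1 K nV nX nU p q \<le> 2 * (energy_form h0 h1 K nV nX nU p q + \<delta> * corrector lam0 lam1 lam m nU p q) \<and>
      energy_form h0 h1 K nV nX nU p q + \<delta> * corrector lam0 lam1 lam m nU p q \<le> 2 * energy_form h0 h1 K nV nX nU p q"
    "\<And>ht0 ht1 nV nX nU nf p q r s g0 g1 fV fU m.
      \<bar>ht0\<bar> < \<eta> \<Longrightarrow> \<bar>ht1\<bar> < \<eta> \<Longrightarrow> 0 \<le> nV \<Longrightarrow> 0 \<le> nX \<Longrightarrow> 0 \<le> nU \<Longrightarrow> 0 \<le> nf \<Longrightarrow>
      q\<^sup>2 \<le> 2 * p\<^sup>2 + 2 * nX \<Longrightarrow> \<bar>m\<bar> \<le> (nU + nV) / 2 \<Longrightarrow>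
      fV \<le> lam / 2 * nV + nf / (2 * lam) \<Longrightarrow> fU \<le> K / 2 * nU + nf / (2 * K) \<Longrightarrow>
      energy_rate lam0 lam1 ht0 ht1 lamt0 lamt1 lam nV p q r s fV g0 g1
        + \<delta> * corrector_rate h0 h1 ht0 ht1 lamt0 lamt1 K nV nX nU p q r s fU g0 g1
      \<le> - \<beta> * (energy_form h0 h1 K nV nX nU p q + \<delta> * corrector lam0 lam1 lam m nU p q) + C * (nf + g0\<^sup>2 + g1\<^sup>2)"
proof -
  obtain \<mu> where mu: "\<mu> > 0" "\<And>r s. \<mu> * (r\<^sup>2 + s\<^sup>2) \<le> lam0 * r\<^sup>2 + lam1 * s\<^sup>2 + (lamt0 + lamt1) * r * s"
    using quadratic_form_coercive[OF assms(2,3,7)] by blast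
  \<comment> \<open>A trace constant: 2/h0 times h0 p^2 pays for 2 p^2, and the summand 2 pays for 2
    \<open>nX\<close>.\<close>
  define \<kappa> where "\<kappa> = 2 / h0 + 2"
  have \<kappa>: "\<kappa> > 0" using assms by (simp add: \<kappa>_def add_pos_pos)
  define D where "D = 1 + (1 + lam) / K + (lam0 + lam1) * \<kappa>"
  have D: "D > 0" using assms \<kappa> by (auto simp: D_def intro!: add_pos_nonneg mult_nonneg_nonneg divide_nonneg_nonneg)
  define l where "l = lamt0\<^sup>2 + lamt1\<^sup>2 + 1"
  have l: "l > 0" by (simp add: l_def add_nonneg_pos)
  \<comment> \<open>The three bounds ensure, in turn, that \<delta> \<open>nV\<close> uses half of
    the available damping, that the boundary velocities in the corrector's rate are absorbed by
    \<mu>/2 (r^2 + s^2), and that \<delta> times the corrector is at most half the energy, by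
    \<open>corrector_le\<close> with its constant \<open>D\<close>.\<close>
  define \<delta> where "\<delta> = min (lam / 4) (min (\<mu> / (4 * \<kappa> * l)) (1 / (2 * D)))"
  have \<delta>: "\<delta> > 0" using assms mu \<kappa> D l by (simp add: \<delta>_def)
  have \<delta>1: "\<delta> \<le> lam / 4" by (simp add: \<delta>_def)
  have "\<delta> \<le> \<mu> / (4 * \<kappa> * l)" by (simp add: \<delta>_def)
  then have \<delta>2: "\<delta> * (2 * \<kappa> * l) \<le> \<mu> / 2" using \<kappa> l by (simp add: field_simps)
  have "\<delta> \<le> 1 / (2 * D)" by (simp add: \<delta>_def)
  then have \<delta>3: "\<delta> * D \<le> 1 / 2" using D by (simp add: field_simps)
  \<comment> \<open>The first bound is the hypothesis of \<open>corrector_rate_le\<close>. The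
    second keeps the coupling terms of the energy rate below \<delta>/8 times the squared a-norm,
    half of what the corrector supplies.\<close>
  define \<eta> where "\<eta> = min (1 / (8 * \<kappa>)) (sqrt (\<delta> * \<mu> / (16 * \<kappa>)))"
  have \<eta>: "\<eta> > 0" using \<kappa> \<delta> mu by (simp add: \<eta>_def)
  have "\<eta> \<le> 1 / (8 * \<kappa>)" by (simp add: \<eta>_def)
  then have \<eta>1: "8 * \<kappa> * \<eta> \<le> 1" using \<kappa> by (simp add: field_simps)
  have "\<eta>\<^sup>2 \<le> (sqrt (\<delta> * \<mu> / (16 * \<kappa>)))\<^sup>2" using \<eta> by (intro power_mono) (auto simp: \<eta>_def)
  then have "\<eta>\<^sup>2 \<le> \<delta> * \<mu> / (16 * \<kappa>)" using \<kappa> \<delta> mu by simp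
  then have \<eta>2: "\<eta>\<^sup>2 / \<mu> * (2 * \<kappa>) \<le> \<delta> / 8" using \<kappa> mu by (simp add: field_simps)
  define C where "C = 1 / (2 * lam) + 1 / \<mu> + \<delta> * (1 / (2 * K) + 2 * \<kappa>)"
  have trace_bound: "p\<^sup>2 \<le> \<kappa> * (nX + h0 * p\<^sup>2 + h1 * q\<^sup>2)" "q\<^sup>2 \<le> \<kappa> * (nX + h0 * p\<^sup>2 + h1 * q\<^sup>2)"
    if "0 \<le> nX" "q\<^sup>2 \<le> 2 * p\<^sup>2 + 2 * nX" for nX p q
  proof -
    have "2 * p\<^sup>2 + 2 * nX \<le> \<kappa> * (nX + h0 * p\<^sup>2)"
      using assms(1) that(1) by (simp add: \<kappa>_def algebra_simps add_nonneg_nonneg)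
    also have "\<dots> \<le> \<kappa> * (nX + h0 * p\<^sup>2 + h1 * q\<^sup>2)"
      using assms(6) \<kappa> by (intro mult_left_mono) auto
    finally have *: "2 * p\<^sup>2 + 2 * nX \<le> \<kappa> * (nX + h0 * p\<^sup>2 + h1 * q\<^sup>2)" .
    moreover have "0 \<le> p\<^sup>2" by simp
    ultimately show "p\<^sup>2 \<le> \<kappa> * (nX + h0 * p\<^sup>2 + h1 * q\<^sup>2)" using that(1) by linarith
    show "q\<^sup>2 \<le> \<kappa> * (nX + h0 * p\<^sup>2 + h1 * q\<^sup>2)" using * that(2) by linarith
  qed
  have equiv: "energy_form h0 h1 K nV nX nU p q \<le> 2 * (energy_form h0 h1 K nV nX nU p q + \<delta> * corrector lam0 lam1 lam m nU p q) \<and>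
      energy_form h0 h1 K nV nX nU p q + \<delta> * corrector lam0 lam1 lam m nU p q \<le> 2 * energy_form h0 h1 K nV nX nU p q"
    if nn: "0 \<le> nV" "0 \<le> nX" "0 \<le> nU" and q: "q\<^sup>2 \<le> 2 * p\<^sup>2 + 2 * nX" and m: "\<bar>m\<bar> \<le> (nU + nV) / 2"
    for nV nX nU p q m
  proof -
    define E where "E = energy_form h0 h1 K nV nX nU p q"
    define P where "P = corrector lam0 lam1 lam m nU p q"
    have E0: "0 \<le> E" using assms nn by (simp add: E_def energy_form_def)
    have "\<bar>P\<bar> \<le> D * E"
      unfolding P_def E_def D_def
      by (rule corrector_le[OF assms(4,5,2,3) \<kappa> nn(1,3) trace_bound[OF nn(2) q] m])
    then have "\<delta> * \<bar>P\<bar> \<le> \<delta> * (D * E)" using \<delta> by (intro mult_left_mono) auto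
    also have "\<dots> \<le> 1 / 2 * E" unfolding mult.assoc[symmetric] using \<delta>3 E0 by (intro mult_right_mono) auto
    finally have "\<bar>\<delta> * P\<bar> \<le> E / 2" using \<delta> by (simp add: abs_mult)
    then have "- (E / 2) \<le> \<delta> * P" "\<delta> * P \<le> E / 2" by linarith+
    then show ?thesis using E0 unfolding E_def[symmetric] P_def[symmetric] by auto
  qed
  have rate: "energy_rate lam0 lam1 ht0 ht1 lamt0 lamt1 lam nV p q r s fV g0 g1
        + \<delta> * corrector_rate h0 h1 ht0 ht1 lamt0 lamt1 K nV nX nU p q r s fU g0 g1
      \<le> - (\<delta> / 8) * (energy_form h0 h1 K nV nX nU p q + \<delta> * corrector lam0 lam1 lam m nU p q) + C * (nf + g0\<^sup>2 + g1\<^sup>2)"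
    if h: "\<bar>ht0\<bar> < \<eta>" "\<bar>ht1\<bar> < \<eta>" and nn: "0 \<le> nV" "0 \<le> nX" "0 \<le> nU" "0 \<le> nf"
      and q: "q\<^sup>2 \<le> 2 * p\<^sup>2 + 2 * nX" and m: "\<bar>m\<bar> \<le> (nU + nV) / 2"
      and f: "fV \<le> lam / 2 * nV + nf / (2 * lam)" "fU \<le> K / 2 * nU + nf / (2 * K)"
    for ht0 ht1 nV nX nU nf p q r s g0 g1 fV fU m
  proof -
    define B where "B = nX + h0 * p\<^sup>2 + h1 * q\<^sup>2"
    define E where "E = energy_form h0 h1 K nV nX nU p q"
    define P where "P = corrector lam0 lam1 lam m nU p q"
    define N where "N = nf + g0\<^sup>2 + g1\<^sup>2"
    have E: "E = nV / 2 + B / 2 + K / 2 * nU" by (simp add: E_def energy_form_def B_def)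
    note tb = trace_bound[OF nn(2) q]
    have B: "p\<^sup>2 \<le> \<kappa> * B" "q\<^sup>2 \<le> \<kappa> * B" using tb by (simp_all add: B_def)
    have B0: "0 \<le> B" using assms nn by (simp add: B_def)
    have h': "\<bar>ht0\<bar> \<le> \<eta>" "\<bar>ht1\<bar> \<le> \<eta>" using h by auto
    have R1: "energy_rate lam0 lam1 ht0 ht1 lamt0 lamt1 lam nV p q r s fV g0 g1
      \<le> - (lam / 2) * nV - \<mu> / 2 * (r\<^sup>2 + s\<^sup>2) + \<eta>\<^sup>2 / \<mu> * (p\<^sup>2 + q\<^sup>2) + nf / (2 * lam) + (g0\<^sup>2 + g1\<^sup>2) / \<mu>"
      by (rule energy_rate_le[OF mu h' f(1)])
    have "corrector_rate h0 h1 ht0 ht1 lamt0 lamt1 K nV nX nU p q r s fU g0 g1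
      \<le> nV - B / 4 - K / 2 * nU + 2 * \<kappa> * (lamt1\<^sup>2 * s\<^sup>2 + lamt0\<^sup>2 * r\<^sup>2) + nf / (2 * K) + 2 * \<kappa> * (g0\<^sup>2 + g1\<^sup>2)"
      unfolding B_def by (rule corrector_rate_le[OF \<kappa> tb h' \<eta>1 f(2)])
    then have R2: "\<delta> * corrector_rate h0 h1 ht0 ht1 lamt0 lamt1 K nV nX nU p q r s fU g0 g1
      \<le> \<delta> * nV - \<delta> / 4 * B - \<delta> * (K / 2 * nU) + \<delta> * (2 * \<kappa> * (lamt1\<^sup>2 * s\<^sup>2 + lamt0\<^sup>2 * r\<^sup>2))
        + \<delta> * (nf / (2 * K) + 2 * \<kappa> * (g0\<^sup>2 + g1\<^sup>2))"
      using \<delta> mult_left_mono[of _ _ \<delta>] by (fastforce simp: algebra_simps)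
    have 1: "\<eta>\<^sup>2 / \<mu> * (p\<^sup>2 + q\<^sup>2) \<le> \<delta> / 8 * B"
    proof -
      have "\<eta>\<^sup>2 / \<mu> * (p\<^sup>2 + q\<^sup>2) \<le> \<eta>\<^sup>2 / \<mu> * (2 * \<kappa> * B)"
        using B mu by (intro mult_left_mono) auto
      also have "\<dots> = (\<eta>\<^sup>2 / \<mu> * (2 * \<kappa>)) * B" by simp
      also have "\<dots> \<le> \<delta> / 8 * B" using \<eta>2 B0 by (intro mult_right_mono)
      finally show ?thesis .
    qed
    have 2: "\<delta> * (2 * \<kappa> * (lamt1\<^sup>2 * s\<^sup>2 + lamt0\<^sup>2 * r\<^sup>2)) \<le> \<mu> / 2 * (r\<^sup>2 + s\<^sup>2)"
    proof -
      have "lamt1\<^sup>2 * s\<^sup>2 + lamt0\<^sup>2 * r\<^sup>2 \<le> l * s\<^sup>2 + l * r\<^sup>2"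
        by (intro add_mono mult_right_mono) (auto simp: l_def)
      then have "\<delta> * (2 * \<kappa> * (lamt1\<^sup>2 * s\<^sup>2 + lamt0\<^sup>2 * r\<^sup>2)) \<le> \<delta> * (2 * \<kappa> * (l * s\<^sup>2 + l * r\<^sup>2))"
        using \<delta> \<kappa> by (intro mult_left_mono) auto
      also have "\<dots> = \<delta> * (2 * \<kappa> * l) * (r\<^sup>2 + s\<^sup>2)" by (simp add: algebra_simps)
      also have "\<dots> \<le> \<mu> / 2 * (r\<^sup>2 + s\<^sup>2)" using \<delta>2 by (intro mult_right_mono) auto
      finally show ?thesis .
    qed
    have 3: "\<delta> * nV \<le> lam / 4 * nV" using \<delta>1 nn by (intro mult_right_mono)
    have 4: "nf / (2 * lam) + (g0\<^sup>2 + g1\<^sup>2) / \<mu> + \<delta> * (nf / (2 * K) + 2 * \<kappa> * (g0\<^sup>2 + g1\<^sup>2)) \<le> C * N"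
    proof -
      have "0 \<le> nf / \<mu> + (g0\<^sup>2 + g1\<^sup>2) / (2 * lam) + \<delta> * (2 * \<kappa> * nf + (g0\<^sup>2 + g1\<^sup>2) / (2 * K))"
        using assms mu \<kappa> \<delta> nn by simp
      also have "\<dots> = C * N - (nf / (2 * lam) + (g0\<^sup>2 + g1\<^sup>2) / \<mu> + \<delta> * (nf / (2 * K) + 2 * \<kappa> * (g0\<^sup>2 + g1\<^sup>2)))"
        by (simp add: C_def N_def algebra_simps add_divide_distrib)
      finally show ?thesis by simp
    qed
    \<comment> \<open>What survives all absorptions is \<open>lam / 4 * nV\<close>, \<delta>/8 times
      \<open>B\<close> and \<delta> K/2 times \<open>nU\<close>. It controls \<delta>/4 of the
      energy, hence \<delta>/8 of the perturbed energy, which is the rate \<beta>.\<close>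
    have 5: "\<delta> / 4 * E \<le> lam / 4 * nV + \<delta> / 8 * B + \<delta> * (K / 2 * nU)"
    proof -
      have "\<delta> / 4 * E = \<delta> * nV / 8 + \<delta> / 8 * B + \<delta> * (K / 2 * nU) / 4" by (simp add: E algebra_simps)
      moreover have "0 \<le> \<delta> * (K / 2 * nU)" "0 \<le> \<delta> * nV" using \<delta> assms nn by auto
      ultimately show ?thesis using 3 by linarith
    qed
    have 6: "\<delta> / 8 * (E + \<delta> * P) \<le> \<delta> / 4 * E"
    proof -
      have "\<delta> / 8 * (E + \<delta> * P) \<le> \<delta> / 8 * (2 * E)"
        using equiv[OF nn(1-3) q m] \<delta> unfolding E_def[symmetric] P_def[symmetric] by (intro mult_left_mono) auto
      also have "\<dots> = \<delta> / 4 * E" by simp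
      finally show ?thesis .
    qed
    show ?thesis
      unfolding E_def[symmetric] P_def[symmetric] N_def[symmetric]
      using R1 R2 1 2 3 4 5 6 by (simp only: minus_mult_left[symmetric])
  qed
  have C0: "C \<ge> 0" using assms mu \<delta> \<kappa> by (simp add: C_def)
  have b0: "\<delta> / 8 > 0" using \<delta> by simp
  show ?thesis
  proof (rule that[of \<eta> C "\<delta> / 8" \<delta>])
    show "\<eta> > 0" "C \<ge> 0" "\<delta> / 8 > 0" by fact+
  qed (fact equiv, fact rate)
qed

subsection \<open>Exponential decay\<close>

text \<open>The equation is tested with the velocity and with the solution, followed by integration
  by parts in space. Square integrability of \<open>f\<close> at the given time is read off the
  equation, whose other terms all lie in \<open>L2\<close>.\<close>

lemma wave_identities:
  assumes U: "weak_deriv 0 1 U X" and V: "weak_deriv 0 1 V Z" and X: "weak_deriv 0 1 X XX"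
    and W: "W \<in> L2 0 1" and f: "f \<in> borel_measurable (ivl_measure 0 1)"
    and eq: "AE x in ivl_measure 0 1. W x - XX x + K * U x + lam * V x = f x"
  shows "f \<in> L2 0 1"
    and "L2_inner V W + L2_inner X Z + K * L2_inner U V =
      - lam * L2_inner V V + L2_inner V f + trace X 1 * trace V 1 - trace X 0 * trace V 0"
    and "L2_inner U W = - L2_inner X X - K * L2_inner U U - lam * L2_inner U V + L2_inner U f
      + trace X 1 * trace U 1 - trace X 0 * trace U 0"
proof -
  note L = weak_derivD(1)[OF U] weak_derivD(1)[OF V] weak_derivD(2)[OF X] W
  have L1: "(\<lambda>x. W x - XX x) \<in> L2 0 1" by (intro L2_diff L)
  have L2: "(\<lambda>x. K * U x) \<in> L2 0 1" "(\<lambda>x. lam * V x) \<in> L2 0 1" by (intro L2_cmult L)+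
  have L3: "(\<lambda>x. W x - XX x + K * U x) \<in> L2 0 1" by (intro L2_add L1 L2)
  have L4: "(\<lambda>x. W x - XX x + K * U x + lam * V x) \<in> L2 0 1" by (intro L2_add L3 L2)
  show fL: "f \<in> L2 0 1" by (rule L2_cong_AE[OF L4 f eq])
  have inner: "L2_inner f \<phi> = L2_inner W \<phi> - L2_inner XX \<phi> + K * L2_inner U \<phi> + lam * L2_inner V \<phi>"
    if \<phi>: "\<phi> \<in> L2 0 1" for \<phi>
  proof -
    have "L2_inner f \<phi> = L2_inner (\<lambda>x. W x - XX x + K * U x + lam * V x) \<phi>"
      by (rule L2_inner_cong_AE[OF _ _ fL L4 \<phi> \<phi>]) (use eq in \<open>auto elim: eventually_mono\<close>)
    also have "\<dots> = L2_inner W \<phi> - L2_inner XX \<phi> + K * L2_inner U \<phi> + lam * L2_inner V \<phi>"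
      by (simp only: L2_inner_add_left[OF L3 L2(2) \<phi>] L2_inner_add_left[OF L1 L2(1) \<phi>]
          L2_inner_diff_left[OF L(4,3) \<phi>] L2_inner_cmult_left)
    finally show ?thesis .
  qed
  show "L2_inner V W + L2_inner X Z + K * L2_inner U V =
      - lam * L2_inner V V + L2_inner V f + trace X 1 * trace V 1 - trace X 0 * trace V 0"
    using inner[OF L(2)] weak_deriv_by_parts[OF X V]
    by (simp add: L2_inner_commute[of V W] L2_inner_commute[of V f])
  show "L2_inner U W = - L2_inner X X - K * L2_inner U U - lam * L2_inner U V + L2_inner U f
      + trace X 1 * trace U 1 - trace X 0 * trace U 0"
    using inner[OF L(1)] weak_deriv_by_parts[OF X U]
    by (simp add: L2_inner_commute[of U W] L2_inner_commute[of U f] L2_inner_commute[of U V])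
qed

text \<open>Two \<open>L2\<close> derivatives at the same time agree after testing with \<phi>, by
  uniqueness of scalar derivatives. The strict inequality \<open>t < T\<close> makes
  \<open>{0..}\<close> and \<open>{0..T}\<close> coincide near \<open>t\<close>.\<close>

lemma tderiv_eq:
  assumes C1: "C1_L2_deriv T u v" and t: "0 \<le> t" "t < T"
  shows "(L2_norm 0 1 (tderiv u t))\<^sup>2 = L2_inner (v t) (v t)"
proof -
  have tT: "t \<in> {0..T}" using t by simp
  from C1 have u: "u \<in> C0_L2 T" and d: "L2_diff {0..T} u t (v t)"
    using tT unfolding C1_L2_deriv_def by blast+
  have at_eq: "at t within {0..} = at t within {0..T}"
    by (rule at_within_nhd[of t "{..<T}"]) (use t in auto)
  have "L2_diff {0..} u t (v t)" using d by (simp add: L2_diff_def at_eq)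
  then have "L2_diff {0..} u t (tderiv u t)"
    unfolding tderiv_def by (rule someI[of "L2_diff {0..} u t"])
  then have d': "L2_diff {0..T} u t (tderiv u t)" by (simp add: L2_diff_def at_eq)
  have L: "v t \<in> L2 0 1" "tderiv u t \<in> L2 0 1" using d d' by (simp_all add: L2_diff_def)
  have "AE x in ivl_measure 0 1. tderiv u t x - v t x = 0"
  proof (rule test_fun_orthogonal_imp_zero)
    show "integrable (ivl_measure 0 1) (\<lambda>x. tderiv u t x - v t x)"
      using L[THEN L2_integrable] by simp
    fix \<phi> assume "\<phi> \<in> test_fun 0 1"
    then have \<phi>: "smooth \<phi>" by (rule test_fun_smooth)
    have "L2_inner (tderiv u t) \<phi> = L2_inner (v t) \<phi>"
    proof (rule vector_derivative_unique_within_closed_interval[of 0 T t "\<lambda>s. L2_inner (u s) \<phi>"])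
      show "((\<lambda>s. L2_inner (u s) \<phi>) has_vector_derivative L2_inner (tderiv u t) \<phi>) (at t within cbox 0 T)"
        "((\<lambda>s. L2_inner (u s) \<phi>) has_vector_derivative L2_inner (v t) \<phi>) (at t within cbox 0 T)"
        using L2_diff_inner[OF d' tT u \<phi>] L2_diff_inner[OF d tT u \<phi>]
        by (simp_all add: has_real_derivative_iff_has_vector_derivative)
    qed (use t in auto)
    then have "L2_inner (\<lambda>x. tderiv u t x - v t x) \<phi> = 0"
      using L2_inner_diff_left[OF L(2,1) smooth_L2[OF \<phi>]] by simp
    then show "(\<integral>x. (tderiv u t x - v t x) * \<phi> x \<partial>ivl_measure 0 1) = 0"
      by (simp add: L2_inner_def)
  qed
  then have ae: "AE x in ivl_measure 0 1. tderiv u t x = v t x" by simp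
  show ?thesis
    unfolding L2_norm_inner by (rule L2_inner_cong_AE[OF ae ae L(2,1) L(2,1)])
qed

lemma norm_a_square:
  assumes "0 \<le> h0" "0 \<le> h1"
  shows "(norm_a h0 h1 v)\<^sup>2 = L2_inner (wderiv 0 1 v) (wderiv 0 1 v) + h0 * (trace v 0)\<^sup>2 + h1 * (trace v 1)\<^sup>2"
  using assms L2_inner_nonneg[of "wderiv 0 1 v"] by (simp add: norm_a_def L2_norm_inner)

lemma trace_1_square_le:
  assumes "v \<in> H1 0 1"
  shows "(trace v 1)\<^sup>2 \<le> 2 * (trace v 0)\<^sup>2 + 2 * L2_inner (wderiv 0 1 v) (wderiv 0 1 v)"
proof -
  let ?w = "wderiv 0 1 v"
  note wd = weak_deriv_wderiv[OF assms]
  define I where "I = (\<integral>s. ?w s \<partial>ivl_measure 0 1)"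
  have "I\<^sup>2 \<le> L2_inner ?w ?w"
    using ivl_integral_square_le[OF zero_le_one weak_derivD(2)[OF wd]]
    by (simp add: I_def L2_inner_def power2_eq_square)
  moreover have "trace v 1 = trace v 0 + I" using weak_deriv_ac(2)[OF wd] by (simp add: I_def)
  moreover have "(trace v 0 + I)\<^sup>2 \<le> 2 * (trace v 0)\<^sup>2 + 2 * I\<^sup>2"
    using sum_squares_bound[of "trace v 0" I] by (simp add: power2_sum)
  ultimately show ?thesis by simp
qed

section \<open>From a strong solution to the scalar differential inequality\<close>

text \<open>The energy as a function of a position and a velocity, so that it can be evaluated at
  the initial data as well as along a solution.\<close>

definition sol_energy :: "real \<Rightarrow> real \<Rightarrow> real \<Rightarrow> (real \<Rightarrow> real) \<Rightarrow> (real \<Rightarrow> real) \<Rightarrow> real" where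
  "sol_energy h0 h1 K U V = energy_form h0 h1 K (L2_inner V V)
     (L2_inner (wderiv 0 1 U) (wderiv 0 1 U)) (L2_inner U U) (trace U 0) (trace U 1)"

definition sol_corrector :: "real \<Rightarrow> real \<Rightarrow> real \<Rightarrow> (real \<Rightarrow> real) \<Rightarrow> (real \<Rightarrow> real) \<Rightarrow> real" where
  "sol_corrector lam0 lam1 lam U V =
     corrector lam0 lam1 lam (L2_inner U V) (L2_inner U U) (trace U 0) (trace U 1)"

lemma energy_eq_sol_energy:
  assumes "0 \<le> h0" "0 \<le> h1" "C1_L2_deriv T u v" "0 \<le> t" "t < T"
  shows "energy h0 h1 K u t = sol_energy h0 h1 K (u t) (v t)"
  unfolding energy_def sol_energy_def energy_form_def
  using tderiv_eq[OF assms(3-5)] norm_a_square[OF assms(1,2), of "u t"] by (simp add: L2_norm_inner)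

lemma sol_energy_cong_AE:
  assumes U: "U \<in> L2 0 1" "U' \<in> L2 0 1" "AE x in ivl_measure 0 1. U x = U' x"
    and V: "V \<in> L2 0 1" "V' \<in> L2 0 1" "AE x in ivl_measure 0 1. V x = V' x"
  shows "sol_energy h0 h1 K U V = sol_energy h0 h1 K U' V'"
  unfolding sol_energy_def wderiv_cong_AE[OF L2_measurable[OF U(1)] L2_measurable[OF U(2)] U(3)]
    trace_cong_AE[OF U(3)] L2_inner_cong_AE[OF U(3) U(3) U(1,2) U(1,2)] L2_inner_cong_AE[OF V(3) V(3) V(1,2) V(1,2)] ..

lemma AE_atLeast_imp_AE_ivl:
  assumes "AE t\<in>{0<..} in lborel. Q t"
  shows "AE t in ivl_measure 0 T. Q t"
  unfolding AE_ivl[symmetric] using assms by eventually_elim simp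

lemma meas_QT_section:
  assumes "meas_QT T f" "t \<in> {0<..<T}"
  shows "f t \<in> borel_measurable (ivl_measure 0 1)"
proof -
  have "t \<in> space (ivl_measure 0 T)" using assms(2) by simp
  from measurable_compose[OF measurable_Pair1'[OF this] meas_QT_measurable(1)[OF assms(1)]] show ?thesis by simp
qed

text \<open>The interface between the equation and the algebra: the perturbed energy is absolutely
  continuous, and its density is almost everywhere the combination estimated in
  \<open>lyapunov_constants\<close>. The witnesses \<open>r\<close> and \<open>s\<close> are
  densities of the boundary values of \<open>u\<close>.\<close>

lemma strong_solution_rates:
  assumes sol: "strong_solution h0 h1 lam0 lam1 ht0 ht1 lamt0 lamt1 K lam f g0 g1 u0 u1 u"
  obtains v where "\<And>T. 0 < T \<Longrightarrow> C1_L2_deriv T u v"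
    and "\<And>T t. 0 < T \<Longrightarrow> t \<in> {0..T} \<Longrightarrow> u t \<in> H1 0 1"
    and "AE x in ivl_measure 0 1. u 0 x = u0 x" and "AE x in ivl_measure 0 1. v 0 x = u1 x"
    and "\<And>T \<delta>. 0 < T \<Longrightarrow> meas_QT T f \<Longrightarrow>
      \<exists>G. ac_on T (\<lambda>t. sol_energy h0 h1 K (u t) (v t) + \<delta> * sol_corrector lam0 lam1 lam (u t) (v t)) G \<and>
       (AE t in ivl_measure 0 T. f t \<in> L2 0 1 \<and> (\<exists>r s. G t =
          energy_rate lam0 lam1 ht0 ht1 lamt0 lamt1 lam (L2_inner (v t) (v t)) (trace (u t) 0) (trace (u t) 1) r s
            (L2_inner (v t) (f t)) (g0 t) (g1 t)
          + \<delta> * corrector_rate h0 h1 ht0 ht1 lamt0 lamt1 K (L2_inner (v t) (v t))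
            (L2_inner (wderiv 0 1 (u t)) (wderiv 0 1 (u t))) (L2_inner (u t) (u t)) (trace (u t) 0) (trace (u t) 1) r s
            (L2_inner (u t) (f t)) (g0 t) (g1 t)))"
proof -
  from sol obtain ut utt ux uxx where
    reg: "\<And>T. 0 < T \<Longrightarrow> u \<in> C0_H1 T \<and> C1_L2_deriv T u ut \<and> u \<in> Linf_H2 T \<and> ut \<in> Linf_H1 T \<and>
      utt \<in> Linf_L2 T \<and> weak_tderiv T ut utt"
    and wd: "AE t\<in>{0<..} in lborel. weak_deriv 0 1 (u t) (ux t) \<and> weak_deriv 0 1 (ux t) (uxx t)"
    and pde: "AE (t, x) in lborel. 0 < t \<and> x \<in> {0<..<1} \<longrightarrow>
      utt t x - uxx t x + K * u t x + lam * ut t x = f t x"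
    and bc0: "AE t\<in>{0<..} in lborel. trace (ux t) 0 = h0 * trace (u t) 0 + lam0 * trace (ut t) 0
      + ht1 * trace (u t) 1 + lamt1 * trace (ut t) 1 + g0 t"
    and bc1: "AE t\<in>{0<..} in lborel. - trace (ux t) 1 = h1 * trace (u t) 1 + lam1 * trace (ut t) 1
      + ht0 * trace (u t) 0 + lamt0 * trace (ut t) 0 + g1 t"
    and ic: "AE x\<in>{0<..<1} in lborel. u 0 x = u0 x" "AE x\<in>{0<..<1} in lborel. ut 0 x = u1 x"
    unfolding strong_solution_def by blast
  have "AE z in lborel \<Otimes>\<^sub>M lborel. (case z of (t, x) \<Rightarrow> 0 < t \<and> x \<in> {0<..<1} \<longrightarrow>
      utt t x - uxx t x + K * u t x + lam * ut t x = f t x)"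
    using pde by (simp only: lborel_prod)
  from lborel_pair.AE_pair[OF this]
  have pde': "AE t\<in>{0<..} in lborel. AE x in ivl_measure 0 1. utt t x - uxx t x + K * u t x + lam * ut t x = f t x"
  proof eventually_elim
    case (elim t)
    show ?case
    proof
      assume "t \<in> {0<..}"
      with elim show "AE x in ivl_measure 0 1. utt t x - uxx t x + K * u t x + lam * ut t x = f t x"
        unfolding AE_ivl[symmetric] by simp
    qed
  qed
  have H: "u t \<in> H1 0 1" if "0 < T" "t \<in> {0..T}" for T t
    using reg[OF that(1)] that(2) unfolding C0_H1_def by blast
  show ?thesis
  proof (rule that[of ut])
    show "C1_L2_deriv T u ut" if "0 < T" for T using reg[OF that] by blast
    show "AE x in ivl_measure 0 1. u 0 x = u0 x" "AE x in ivl_measure 0 1. ut 0 x = u1 x"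
      using ic by (simp_all only: AE_ivl)
    fix T \<delta> :: real assume T: "0 < T" and fm: "meas_QT T f"
    let ?N = "ivl_measure 0 T"
    let ?X = "\<lambda>t. wderiv 0 1 (u t)"
    have T0: "0 \<le> T" using T by simp
    have C1: "C1_L2_deriv T u ut" and utH: "ut \<in> Linf_H1 T" and utt: "utt \<in> Linf_L2 T"
      and wt: "weak_tderiv T ut utt"
      using reg[OF T] by auto
    have utL: "ut \<in> Linf_L2 T" using utH by (simp add: Linf_H1_def)
    obtain z where z: "z \<in> Linf_L2 T" "AE t in ?N. weak_deriv 0 1 (ut t) (z t)"
      using utH unfolding Linf_H1_def AE_ivl by blast
    have utC: "ut \<in> C0_L2 T" using C1 by (simp add: C1_L2_deriv_def)
    note tu = time_prim_C1[OF C1 utL]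
    note tv = time_prim_weak[OF T utC utL utt wt]
    note tx = time_prim_wderiv[OF C1 H[OF T] z]
    obtain G1 where G1: "ac_on T (\<lambda>t. L2_inner (ut t) (ut t)) G1"
      "AE t in ?N. G1 t = L2_inner (ut t) (utt t) + L2_inner (utt t) (ut t)"
      using time_prim_inner[OF T0 tv tv] .
    obtain G2 where G2: "ac_on T (\<lambda>t. L2_inner (?X t) (?X t)) G2"
      "AE t in ?N. G2 t = L2_inner (?X t) (z t) + L2_inner (z t) (?X t)"
      using time_prim_inner[OF T0 tx tx] .
    obtain G3 where G3: "ac_on T (\<lambda>t. L2_inner (u t) (u t)) G3"
      "AE t in ?N. G3 t = L2_inner (u t) (ut t) + L2_inner (ut t) (u t)"
      using time_prim_inner[OF T0 tu tu] .
    obtain G4 where G4: "ac_on T (\<lambda>t. L2_inner (u t) (ut t)) G4"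
      "AE t in ?N. G4 t = L2_inner (u t) (utt t) + L2_inner (ut t) (ut t)"
      using time_prim_inner[OF T0 tu tv] .
    obtain r where r: "ac_on T (\<lambda>t. trace (u t) 0) r" "AE t in ?N. r t = trace (ut t) 0"
      using ac_on_trace(1)[OF T0 tu tx H[OF T] z(2)] by blast
    obtain s where s: "ac_on T (\<lambda>t. trace (u t) 1) s" "AE t in ?N. s t = trace (ut t) 1"
      using ac_on_trace(2)[OF T0 tu tx H[OF T] z(2)] by blast
    define p where "p t = trace (u t) 0" for t
    define q where "q t = trace (u t) 1" for t
    note r1 = r(1)[folded p_def] and s1 = s(1)[folded q_def]
    note P = ac_on_mult[OF r1 r1] and Q = ac_on_mult[OF s1 s1]
    \<comment> \<open>Nested so that the density is assembled term by term by the sum, scalar and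
      product rules.\<close>
    define G where "G t = (1 / 2 * G1 t + (1 / 2 * G2 t + (h0 / 2 * (p t * r t + p t * r t)
        + (h1 / 2 * (q t * s t + q t * s t) + K / 2 * G3 t))))
      + \<delta> * (G4 t + (lam / 2 * G3 t + (lam0 / 2 * (p t * r t + p t * r t) + lam1 / 2 * (q t * s t + q t * s t))))" for t
    have "ac_on T (\<lambda>t. (1 / 2 * L2_inner (ut t) (ut t) + (1 / 2 * L2_inner (?X t) (?X t) + (h0 / 2 * (p t * p t)
        + (h1 / 2 * (q t * q t) + K / 2 * L2_inner (u t) (u t)))))
      + \<delta> * (L2_inner (u t) (ut t) + (lam / 2 * L2_inner (u t) (u t) + (lam0 / 2 * (p t * p t) + lam1 / 2 * (q t * q t))))) G"
      unfolding G_def[abs_def] by (intro ac_on_add ac_on_cmult G1 G2 G3 G4 P Q)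
    moreover have "(1 / 2 * L2_inner (ut t) (ut t) + (1 / 2 * L2_inner (?X t) (?X t) + (h0 / 2 * (p t * p t)
        + (h1 / 2 * (q t * q t) + K / 2 * L2_inner (u t) (u t)))))
      + \<delta> * (L2_inner (u t) (ut t) + (lam / 2 * L2_inner (u t) (u t) + (lam0 / 2 * (p t * p t) + lam1 / 2 * (q t * q t))))
      = sol_energy h0 h1 K (u t) (ut t) + \<delta> * sol_corrector lam0 lam1 lam (u t) (ut t)" for t
      by (simp add: sol_energy_def sol_corrector_def energy_form_def corrector_def p_def q_def
          power2_eq_square add_divide_distrib)
    ultimately have ac: "ac_on T (\<lambda>t. sol_energy h0 h1 K (u t) (ut t) + \<delta> * sol_corrector lam0 lam1 lam (u t) (ut t)) G"
      by simp
    have sp: "AE t in ?N. t \<in> space ?N" by (rule AE_space)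
    note ae = sp G1(2) G2(2) G3(2) G4(2) r(2) s(2) z(2) Linf_L2_AE[OF utt]
      AE_atLeast_imp_AE_ivl[OF wd, of T] AE_atLeast_imp_AE_ivl[OF pde', of T]
      AE_atLeast_imp_AE_ivl[OF bc0, of T] AE_atLeast_imp_AE_ivl[OF bc1, of T]
    have "AE t in ?N. f t \<in> L2 0 1 \<and> (\<exists>r s. G t =
          energy_rate lam0 lam1 ht0 ht1 lamt0 lamt1 lam (L2_inner (ut t) (ut t)) (trace (u t) 0) (trace (u t) 1) r s
            (L2_inner (ut t) (f t)) (g0 t) (g1 t)
          + \<delta> * corrector_rate h0 h1 ht0 ht1 lamt0 lamt1 K (L2_inner (ut t) (ut t))
            (L2_inner (?X t) (?X t)) (L2_inner (u t) (u t)) (trace (u t) 0) (trace (u t) 1) r s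
            (L2_inner (u t) (f t)) (g0 t) (g1 t))"
      using ae
    proof eventually_elim
      case (elim t)
      then have t: "t \<in> {0<..<T}" by simp
      have U: "weak_deriv 0 1 (u t) (ux t)" and XX: "weak_deriv 0 1 (ux t) (uxx t)" using elim by auto
      have fmt: "f t \<in> borel_measurable (ivl_measure 0 1)" using fm t by (rule meas_QT_section)
      note id = wave_identities[OF U elim(8) XX elim(9) fmt elim(11)]
      have "t \<in> {0..T}" using t by simp
      from H[OF T this] have wU: "weak_deriv 0 1 (u t) (?X t)" by (rule weak_deriv_wderiv)
      \<comment> \<open>The boundary conditions and the equation speak of the witness
        \<open>ux\<close>, the energy of the chosen \<open>wderiv\<close>; they agree almost
        everywhere.\<close>
      have Xeq: "AE x in ivl_measure 0 1. ux t x = ?X t x" by (rule weak_deriv_unique[OF U wU])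
      note XL = weak_derivD(2)[OF U] weak_derivD(2)[OF wU]
      have XX': "L2_inner (ux t) (ux t) = L2_inner (?X t) (?X t)"
        by (rule L2_inner_cong_AE[OF Xeq Xeq XL XL])
      have XZ: "L2_inner (ux t) (z t) = L2_inner (?X t) (z t)"
        by (rule L2_inner_cong_AE[OF Xeq _ XL]) (use weak_derivD(2)[OF elim(8)] in auto)
      define b0 where "b0 = trace (ux t) 0"
      define b1 where "b1 = trace (ux t) 1"
      have b0: "b0 = h0 * p t + lam0 * r t + ht1 * q t + lamt1 * s t + g0 t"
        using elim(12) by (simp add: b0_def p_def q_def elim(6,7))
      have b1: "b1 = - (h1 * q t + lam1 * s t + ht0 * p t + lamt0 * r t + g1 t)"
        using elim(13) by (simp add: b1_def p_def q_def elim(6,7))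
      have e1: "L2_inner (ut t) (utt t) + L2_inner (?X t) (z t) + K * L2_inner (u t) (ut t) =
          - lam * L2_inner (ut t) (ut t) + L2_inner (ut t) (f t) + b1 * s t - b0 * r t"
        using id(2) by (simp add: XZ b0_def b1_def elim(6,7))
      have e2: "L2_inner (u t) (utt t) = - L2_inner (?X t) (?X t) - K * L2_inner (u t) (u t)
          - lam * L2_inner (u t) (ut t) + L2_inner (u t) (f t) + b1 * q t - b0 * p t"
        using id(3) by (simp add: XX' b0_def b1_def p_def q_def)
      \<comment> \<open>When the boundary conditions are inserted, the terms with
        \<open>h0 * p t * r t\<close> and \<open>h1 * q t * s t\<close> cancel against the boundary
        work. In the corrector part, the three terms with \<open>lam\<close>, \<open>lam0\<close>
        and \<open>lam1\<close> cancel the damping contributions; this is why \<Psi> contains the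
        corresponding squares.\<close>
      have Gt: "G t = (L2_inner (ut t) (utt t) + L2_inner (?X t) (z t) + K * L2_inner (u t) (ut t)
          + h0 * p t * r t + h1 * q t * s t)
        + \<delta> * (L2_inner (u t) (utt t) + L2_inner (ut t) (ut t) + lam * L2_inner (u t) (ut t)
          + lam0 * p t * r t + lam1 * q t * s t)"
        unfolding G_def elim(2-5) L2_inner_commute[of "utt t" "ut t"] L2_inner_commute[of "z t" "?X t"]
          L2_inner_commute[of "ut t" "u t"]
        by (simp add: algebra_simps)
      have "G t = energy_rate lam0 lam1 ht0 ht1 lamt0 lamt1 lam (L2_inner (ut t) (ut t)) (p t) (q t) (r t) (s t)
            (L2_inner (ut t) (f t)) (g0 t) (g1 t)
          + \<delta> * corrector_rate h0 h1 ht0 ht1 lamt0 lamt1 K (L2_inner (ut t) (ut t))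
            (L2_inner (?X t) (?X t)) (L2_inner (u t) (u t)) (p t) (q t) (r t) (s t)
            (L2_inner (u t) (f t)) (g0 t) (g1 t)"
        unfolding Gt e1 e2 b0 b1 energy_rate_def corrector_rate_def
        by (simp add: algebra_simps power2_eq_square)
      with id(1) show ?case unfolding p_def q_def by blast
    qed
    with ac show "\<exists>G. ac_on T (\<lambda>t. sol_energy h0 h1 K (u t) (ut t) + \<delta> * sol_corrector lam0 lam1 lam (u t) (ut t)) G \<and>
       (AE t in ?N. f t \<in> L2 0 1 \<and> (\<exists>r s. G t =
          energy_rate lam0 lam1 ht0 ht1 lamt0 lamt1 lam (L2_inner (ut t) (ut t)) (trace (u t) 0) (trace (u t) 1) r s
            (L2_inner (ut t) (f t)) (g0 t) (g1 t)
          + \<delta> * corrector_rate h0 h1 ht0 ht1 lamt0 lamt1 K (L2_inner (ut t) (ut t))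
            (L2_inner (?X t) (?X t)) (L2_inner (u t) (u t)) (trace (u t) 0) (trace (u t) 1) r s
            (L2_inner (u t) (f t)) (g0 t) (g1 t)))"
      by blast
  qed (rule H)
qed

theorem theorem5p4:
  fixes h0 h1 lam0 lam1 lamt0 lamt1 K lam :: real
  assumes "h0 > 0" and "lam0 > 0" and "lam1 > 0" and "K > 0" and "lam > 0" and "h1 \<ge> 0"
    and "\<bar>lamt0 + lamt1\<bar> < 2 * sqrt (lam0 * lam1)"
  shows "\<exists>\<eta>>0. \<forall>ht0 ht1. \<bar>ht0\<bar> < \<eta> \<and> \<bar>ht1\<bar> < \<eta> \<longrightarrow>
    (\<forall>f g0 g1 u0 u1 \<sigma>1 \<sigma>2.
       admissible_data f g0 g1 u0 u1 \<and> \<sigma>1 > 0 \<and> \<sigma>2 > 0 \<and>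
       (\<forall>t\<ge>0. (L2_norm 0 1 (f t))\<^sup>2 + (g0 t)\<^sup>2 + (g1 t)\<^sup>2 \<le> \<sigma>1 * exp (- \<sigma>2 * t)) \<longrightarrow>
       (\<exists>\<gamma>1>0. \<exists>\<gamma>2>0. \<forall>u.
          strong_solution h0 h1 lam0 lam1 ht0 ht1 lamt0 lamt1 K lam f g0 g1 u0 u1 u \<longrightarrow>
          (\<forall>t\<ge>0. energy h0 h1 K u t \<le> \<gamma>1 * exp (- \<gamma>2 * t))))"
proof (rule lyapunov_constants[OF assms])
  fix \<eta> \<delta> C \<beta> :: real
  assume \<eta>: "\<eta> > 0" and C: "C \<ge> 0" and \<beta>: "\<beta> > 0"
    and equiv: "\<And>nV nX nU p q m. 0 \<le> nV \<Longrightarrow> 0 \<le> nX \<Longrightarrow> 0 \<le> nU \<Longrightarrow> q\<^sup>2 \<le> 2 * p\<^sup>2 + 2 * nX \<Longrightarrow> \<bar>m\<bar> \<le> (nU + nV) / 2 \<Longrightarrow>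
      energy_form h0 h1 K nV nX nU p q \<le> 2 * (energy_form h0 h1 K nV nX nU p q + \<delta> * corrector lam0 lam1 lam m nU p q) \<and>
      energy_form h0 h1 K nV nX nU p q + \<delta> * corrector lam0 lam1 lam m nU p q \<le> 2 * energy_form h0 h1 K nV nX nU p q"
    and rate: "\<And>ht0 ht1 nV nX nU nf p q r s g0 g1 fV fU m.
      \<bar>ht0\<bar> < \<eta> \<Longrightarrow> \<bar>ht1\<bar> < \<eta> \<Longrightarrow> 0 \<le> nV \<Longrightarrow> 0 \<le> nX \<Longrightarrow> 0 \<le> nU \<Longrightarrow> 0 \<le> nf \<Longrightarrow>
      q\<^sup>2 \<le> 2 * p\<^sup>2 + 2 * nX \<Longrightarrow> \<bar>m\<bar> \<le> (nU + nV) / 2 \<Longrightarrow>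
      fV \<le> lam / 2 * nV + nf / (2 * lam) \<Longrightarrow> fU \<le> K / 2 * nU + nf / (2 * K) \<Longrightarrow>
      energy_rate lam0 lam1 ht0 ht1 lamt0 lamt1 lam nV p q r s fV g0 g1
        + \<delta> * corrector_rate h0 h1 ht0 ht1 lamt0 lamt1 K nV nX nU p q r s fU g0 g1
      \<le> - \<beta> * (energy_form h0 h1 K nV nX nU p q + \<delta> * corrector lam0 lam1 lam m nU p q) + C * (nf + g0\<^sup>2 + g1\<^sup>2)"
  have h: "0 \<le> h0" "0 \<le> h1" using assms by auto
  show ?thesis
  proof (rule exI[of _ \<eta>], rule conjI[OF \<eta>], intro allI impI)
    fix ht0 ht1 f g0 g1 u0 u1 \<sigma>1 \<sigma>2
    assume "\<bar>ht0\<bar> < \<eta> \<and> \<bar>ht1\<bar> < \<eta>"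
      and data: "admissible_data f g0 g1 u0 u1 \<and> 0 < \<sigma>1 \<and> 0 < \<sigma>2 \<and>
       (\<forall>t\<ge>0. (L2_norm 0 1 (f t))\<^sup>2 + (g0 t)\<^sup>2 + (g1 t)\<^sup>2 \<le> \<sigma>1 * exp (- \<sigma>2 * t))"
    then have ht: "\<bar>ht0\<bar> < \<eta>" "\<bar>ht1\<bar> < \<eta>" and \<sigma>: "0 < \<sigma>1" "0 < \<sigma>2"
      and dec: "\<And>t. 0 \<le> t \<Longrightarrow> (L2_norm 0 1 (f t))\<^sup>2 + (g0 t)\<^sup>2 + (g1 t)\<^sup>2 \<le> \<sigma>1 * exp (- \<sigma>2 * t)"
      by auto
    have fm: "meas_QT T f" if "0 < T" for T
      using data that by (simp add: admissible_data_def L2_QT_def)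
    have u01: "u0 \<in> L2 0 1" "u1 \<in> L2 0 1"
      using data by (auto simp: admissible_data_def H1_def H2_def dest: weak_derivD(1))
    \<comment> \<open>Below \<beta>, so that it is admissible in the Lyapunov inequality, and at
      most half the decay rate of the data, as \<open>ac_on_gronwall\<close> requires.\<close>
    define c where "c = min \<beta> (\<sigma>2 / 2)"
    have c: "0 < c" "c \<le> \<beta>" "2 * c \<le> \<sigma>2" using \<beta> \<sigma> by (auto simp: c_def)
    define k where "k = C * \<sigma>1"
    have k: "0 \<le> k" using C \<sigma> by (simp add: k_def)
    \<comment> \<open>Formed from the initial data alone, since \<gamma> has to be fixed before the
      solution.\<close>
    define E0 where "E0 = sol_energy h0 h1 K u0 u1"
    have E0: "0 \<le> E0"
      using h assms(4) by (auto simp: E0_def sol_energy_def energy_form_def L2_inner_nonneg)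
    \<comment> \<open>Passing from the energy to the perturbed energy and back costs a factor 2 each
      way, hence 4 \<open>E0\<close> and 2 k/c; the summand 1 makes \<gamma> positive for vanishing
      \<open>E0\<close> and \<open>k\<close>.\<close>
    define \<gamma> where "\<gamma> = 4 * E0 + 2 * (k / c) + 1"
    have \<gamma>: "0 < \<gamma>" using E0 k c by (simp add: \<gamma>_def add_nonneg_pos)
    show "\<exists>\<gamma>1>0. \<exists>\<gamma>2>0. \<forall>u. strong_solution h0 h1 lam0 lam1 ht0 ht1 lamt0 lamt1 K lam f g0 g1 u0 u1 u \<longrightarrow>
        (\<forall>t\<ge>0. energy h0 h1 K u t \<le> \<gamma>1 * exp (- \<gamma>2 * t))"
    proof (rule exI[of _ \<gamma>], rule conjI[OF \<gamma>], rule exI[of _ c], rule conjI[OF c(1)], intro allI impI)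
      fix u T
      assume sol: "strong_solution h0 h1 lam0 lam1 ht0 ht1 lamt0 lamt1 K lam f g0 g1 u0 u1 u" and T: "0 \<le> (T::real)"
      show "energy h0 h1 K u T \<le> \<gamma> * exp (- c * T)"
      proof (rule strong_solution_rates[OF sol])
        fix v
        assume C1: "\<And>T. 0 < T \<Longrightarrow> C1_L2_deriv T u v"
          and H: "\<And>T t. 0 < T \<Longrightarrow> t \<in> {0..T} \<Longrightarrow> u t \<in> H1 0 1"
          and ic: "AE x in ivl_measure 0 1. u 0 x = u0 x" "AE x in ivl_measure 0 1. v 0 x = u1 x"
          and ex: "\<And>T \<delta>. 0 < T \<Longrightarrow> meas_QT T f \<Longrightarrow>
            \<exists>G. ac_on T (\<lambda>t. sol_energy h0 h1 K (u t) (v t) + \<delta> * sol_corrector lam0 lam1 lam (u t) (v t)) G \<and>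
             (AE t in ivl_measure 0 T. f t \<in> L2 0 1 \<and> (\<exists>r s. G t =
                energy_rate lam0 lam1 ht0 ht1 lamt0 lamt1 lam (L2_inner (v t) (v t)) (trace (u t) 0) (trace (u t) 1) r s
                  (L2_inner (v t) (f t)) (g0 t) (g1 t)
                + \<delta> * corrector_rate h0 h1 ht0 ht1 lamt0 lamt1 K (L2_inner (v t) (v t))
                  (L2_inner (wderiv 0 1 (u t)) (wderiv 0 1 (u t))) (L2_inner (u t) (u t)) (trace (u t) 0) (trace (u t) 1) r s
                  (L2_inner (u t) (f t)) (g0 t) (g1 t)))"
        let ?E = "\<lambda>t. sol_energy h0 h1 K (u t) (v t)"
        let ?L = "\<lambda>t. sol_energy h0 h1 K (u t) (v t) + \<delta> * sol_corrector lam0 lam1 lam (u t) (v t)"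
        \<comment> \<open>On \<open>{0..T + 1}\<close> the time \<open>T\<close> lies strictly
          before the right end, as \<open>energy_eq_sol_energy\<close> requires, and the interval
          has positive length even for \<open>T = 0\<close>.\<close>
        have T1: "0 < T + 1" using T by simp
        have uv: "u t \<in> L2 0 1" "v t \<in> L2 0 1" if "t \<in> {0..T}" for t
        proof -
          have "u \<in> C0_L2 (T + 1)" "v \<in> C0_L2 (T + 1)" using C1[OF T1] by (simp_all add: C1_L2_deriv_def)
          then show "u t \<in> L2 0 1" "v t \<in> L2 0 1" using that by (auto intro: C0_L2_D(1))
        qed
        have uH: "u t \<in> H1 0 1" if "t \<in> {0..T}" for t using H[OF T1, of t] that by simp
        have m: "\<bar>L2_inner (u t) (v t)\<bar> \<le> (L2_inner (u t) (u t) + L2_inner (v t) (v t)) / 2" if "t \<in> {0..T}" for t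
          using L2_inner_young[OF uv[OF that], of 1] by simp
        have EL: "?E t \<le> 2 * ?L t \<and> ?L t \<le> 2 * ?E t" if "t \<in> {0..T}" for t
          unfolding sol_energy_def sol_corrector_def
          by (rule equiv[OF L2_inner_nonneg L2_inner_nonneg L2_inner_nonneg trace_1_square_le[OF uH[OF that]] m[OF that]])
        have E_nonneg: "0 \<le> ?E t" for t
          using h assms(4) by (auto simp: sol_energy_def energy_form_def L2_inner_nonneg)
        have en: "energy h0 h1 K u T = ?E T"
          by (rule energy_eq_sol_energy[OF h C1[OF T1] T]) simp
        have z: "0 \<in> {0..T}" using T by simp
        have init: "?E 0 = E0"
          unfolding E0_def by (rule sol_energy_cong_AE[OF uv(1)[OF z] u01(1) ic(1) uv(2)[OF z] u01(2) ic(2)])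
        have "?L T \<le> exp (- c * T) * (?L 0 + k / c)"
        proof (cases "T = 0")
          case True
          then show ?thesis using k c by simp
        next
          case False
          with T have Tp: "0 < T" by simp
          obtain G where G: "ac_on T ?L G" and Gae: "AE t in ivl_measure 0 T. f t \<in> L2 0 1 \<and> (\<exists>r s. G t =
                energy_rate lam0 lam1 ht0 ht1 lamt0 lamt1 lam (L2_inner (v t) (v t)) (trace (u t) 0) (trace (u t) 1) r s
                  (L2_inner (v t) (f t)) (g0 t) (g1 t)
                + \<delta> * corrector_rate h0 h1 ht0 ht1 lamt0 lamt1 K (L2_inner (v t) (v t))
                  (L2_inner (wderiv 0 1 (u t)) (wderiv 0 1 (u t))) (L2_inner (u t) (u t)) (trace (u t) 0) (trace (u t) 1) r s
                  (L2_inner (u t) (f t)) (g0 t) (g1 t))"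
            using ex[OF Tp fm[OF Tp], of \<delta>] by blast
          show ?thesis
          proof (rule ac_on_gronwall[OF T G c(1,3) k])
            have "AE t in ivl_measure 0 T. t \<in> space (ivl_measure 0 T)" by (rule AE_space)
            with Gae show "AE t in ivl_measure 0 T. G t \<le> - c * ?L t + k * exp (- \<sigma>2 * t)"
            proof eventually_elim
              case (elim t)
              then have t: "t \<in> {0..T}" "0 \<le> t" by auto
              have fL: "f t \<in> L2 0 1" using elim by blast
              have fV: "L2_inner (v t) (f t) \<le> lam / 2 * L2_inner (v t) (v t) + L2_inner (f t) (f t) / (2 * lam)"
                using L2_inner_young[OF uv(2)[OF t(1)] fL assms(5)] by simp
              have fU: "L2_inner (u t) (f t) \<le> K / 2 * L2_inner (u t) (u t) + L2_inner (f t) (f t) / (2 * K)"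
                using L2_inner_young[OF uv(1)[OF t(1)] fL assms(4)] by simp
              from elim obtain r s where "G t =
                energy_rate lam0 lam1 ht0 ht1 lamt0 lamt1 lam (L2_inner (v t) (v t)) (trace (u t) 0) (trace (u t) 1) r s
                  (L2_inner (v t) (f t)) (g0 t) (g1 t)
                + \<delta> * corrector_rate h0 h1 ht0 ht1 lamt0 lamt1 K (L2_inner (v t) (v t))
                  (L2_inner (wderiv 0 1 (u t)) (wderiv 0 1 (u t))) (L2_inner (u t) (u t)) (trace (u t) 0) (trace (u t) 1) r s
                  (L2_inner (u t) (f t)) (g0 t) (g1 t)" by blast
              also have "\<dots> \<le> - \<beta> * ?L t + C * (L2_inner (f t) (f t) + (g0 t)\<^sup>2 + (g1 t)\<^sup>2)"
                unfolding sol_energy_def sol_corrector_def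
                by (rule rate[OF ht L2_inner_nonneg L2_inner_nonneg L2_inner_nonneg L2_inner_nonneg
                      trace_1_square_le[OF uH[OF t(1)]] m[OF t(1)] fV fU])
              also have "C * (L2_inner (f t) (f t) + (g0 t)\<^sup>2 + (g1 t)\<^sup>2) \<le> k * exp (- \<sigma>2 * t)"
                unfolding k_def mult.assoc using dec[OF t(2)] C by (intro mult_left_mono) (simp_all add: L2_norm_inner)
              also have "- \<beta> * ?L t \<le> - c * ?L t"
              proof -
                \<comment> \<open>The perturbed energy inherits nonnegativity from the energy, so
                  the rate may be lowered from \<beta> to \<open>c\<close>.\<close>
                have "0 \<le> 2 * ?L t" by (rule order_trans[OF E_nonneg conjunct1[OF EL[OF t(1)]]])
                then have "0 \<le> ?L t" by (simp only: zero_le_mult_iff) simp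
                then have "c * ?L t \<le> \<beta> * ?L t" using c(2) by (intro mult_right_mono)
                then show ?thesis by simp
              qed
              finally show "G t \<le> - c * ?L t + k * exp (- \<sigma>2 * t)" by simp
            qed
          qed
        qed
        moreover have "2 * l \<le> e * (2 * a + 2 * b)" if "l \<le> e * (a + b)" for l e a b :: real
          using that by (simp add: algebra_simps)
        ultimately have "2 * ?L T \<le> exp (- c * T) * (2 * ?L 0 + 2 * (k / c))"
          by blast
        also have "2 * ?L 0 + 2 * (k / c) \<le> \<gamma>"
          using EL[OF z] init by (simp add: \<gamma>_def)
        finally have "2 * ?L T \<le> exp (- c * T) * \<gamma>" by simp
        moreover have "?E T \<le> 2 * ?L T" using EL[of T] T by simp
        ultimately have "?E T \<le> exp (- c * T) * \<gamma>" by (rule order_trans[rotated])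
        then show "energy h0 h1 K u T \<le> \<gamma> * exp (- c * T)"
          unfolding en by (simp only: mult.commute)
      qed
    qed
  qed
qed

end
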